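(* Let $\mathcal H$ be a separable Banach space, $\Psi:\mathcal H\to\mathbb R$ measurable, $\mathcal K$ a Markov transition kernel on $\mathcal H$, $\lambda$ a Radon probability measure on $\mathcal H$, and let $\mathcal P$ be the RCAR-MH kernel built from $(\Psi,\mathcal K,\lambda)$ (see context). Let $q\ge0$. Assume that $\Psi$ satisfies: (1a) for every $R>0$ there is $M_1(R)\ge0$ with $\Psi(u)\le M_1(R)$ for all $u\in B_R(0)$; (1b) there exist $M_2,M_3\ge0$ with $\Psi(u)\ge M_3-M_2\log(1+\|u\|^q)$ for all $u\in\mathcal H$; (1c) for every $\tilde\beta,\tilde b\in(0,1)$ there exist $R_0(\tilde\beta,\tilde b)>0$, $M_4(\tilde\beta,\tilde b)>0$ such that for all $u$ with $\|u\|>R_0$, $\inf_{v\in B_{\tilde b(1-\tilde\beta)\|u\|}(\tilde\beta u)}\exp(\Psi(u)-\Psi(v))\ge M_4$; (1d) there exists $L>0$ with $|\Psi(u)-\Psi(v)|\le L(1\vee\|u\|^q\vee\|v\|^q)\|u-v\|$ for all $u,v\in\mathcal H$. Assume that $\mathcal K$ satisfies, with $\zeta_u\sim\mathcal K(u,\cdot)$: (2a) $\|\zeta_u\|<\|u\|$ a.s. for every $u\neq0$, and $\zeta_0=0$ a.s.; (2b) there exist $0<b_0<\beta_0<1$ and $\epsilon_0>0$ with $\mathbb P[\|\zeta_u-\beta_0u\|\le b_0(1-\beta_0)\|u\|]\ge\epsilon_0$ for all $u\in\mathcal H$; (2c) for all $u,v\in\mathcal H$ there is a coupling $\varpi_{u,v}$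 of $\mathcal K(u,\cdot)$ and $\mathcal K(v,\cdot)$ such that, for $(\zeta_u,\zeta_v)\sim\varpi_{u,v}$, $\|\zeta_u-\zeta_v\|<\|u-v\|$ a.s. if $u\ne v$ (and $\zeta_u=\zeta_v$ a.s. if $u=v$), and there is a uniform constant $\beta_c\in(0,1)$ with $\sup_{u\neq v}\|u-v\|^{-1}\int\|\zeta_u-\zeta_v\|\,\varpi_{u,v}(d\zeta_u,d\zeta_v)\le\beta_c$. Assume finally that $\int\|\xi\|^p\lambda(d\xi)<\infty$ for an integer $p\ge1\vee\lceil q\rceil$. Then $\mathcal P$ has a unique invariant probability measure.
   Context: $B_R(v)$ denotes the closed ball of radius $R$ centered at $v$. Given $(\Psi,\mathcal K,\lambda)$, put $\mathcal Q(u,\cdot):=\mathcal K(u,\cdot)*\lambda$ (the law of $\zeta_u+\xi$ with independent $\zeta_u\sim\mathcal K(u,\cdot)$, $\xi\sim\lambda$) and $\alpha(u,v):=1\wedge\exp(\Psi(u)-\Psi(v))$. The RCAR-MH kernel is $$\mathcal P(u,dv):=\alpha(u,v)\,\mathcal Q(u,dv)+\delta_u(dv)\int_{\mathcal H}(1-\alpha(u,w))\,\mathcal Q(u,dw).$$ *)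

theory Defs
  imports "HOL-Probability.Probability"
begin

text \<open>
  A separable Banach space is rendered by the sorts \<open>banach\<close> and \<open>second_countable_topology\<close>
  (for metric spaces, separable and second countable agree), with its Borel sigma-algebra.
\<close>

definition radon_prob :: "('a :: topological_space) measure \<Rightarrow> bool" where
  "radon_prob M \<longleftrightarrow>
     prob_space M \<and> sets M = sets borel \<and>
     (\<forall>B\<in>sets borel. emeasure M B = (SUP K\<in>{K. K \<subseteq> B \<and> compact K}. emeasure M K))"

definition markov_kernel :: "('a :: topological_space \<Rightarrow> 'a measure) \<Rightarrow> bool" where
  "markov_kernel K \<longleftrightarrow> K \<in> borel \<rightarrow>\<^sub>M prob_algebra borel"

text \<open>
  \<open>\<parallel>u\<parallel>\<^sup>q\<close> for real \<open>q \<ge> 0\<close>. Since \<open>0 powr 0 = 0\<close>, the usual convention \<open>0\<^sup>0 = 1\<close>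
  has to be restored by hand.
\<close>
definition norm_pow :: "real \<Rightarrow> 'a :: real_normed_vector \<Rightarrow> real" where
  "norm_pow q u = (if q = 0 then 1 else norm u powr q)"

text \<open>
  The law of \<open>\<zeta> + \<xi>\<close>. The library constant \<^const>\<open>convolution\<close> is restricted
  to ordered Euclidean spaces, so the same formula is restated here.
\<close>
definition conv_law :: "('a :: banach) measure \<Rightarrow> 'a measure \<Rightarrow> 'a measure" where
  "conv_law M N = distr (M \<Otimes>\<^sub>M N) borel (\<lambda>(x, y). x + y)"

definition mh_accept :: "('a \<Rightarrow> real) \<Rightarrow> 'a \<Rightarrow> 'a \<Rightarrow> real" where
  "mh_accept \<Psi> u v = min 1 (exp (\<Psi> u - \<Psi> v))"

definition rcar_proposal ::
    "('a :: banach \<Rightarrow> 'a measure) \<Rightarrow> 'a measure \<Rightarrow> 'a \<Rightarrow> 'a measure" where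
  "rcar_proposal K lam u = conv_law (K u) lam"

text \<open>
  \<^const>\<open>measure_of\<close> yields the zero measure if the given set function is not countably
  additive; \<open>emeasure_rcar_mh_kernel\<close> below shows that this case does not arise.
\<close>
definition rcar_mh_kernel ::
    "('a :: banach \<Rightarrow> real) \<Rightarrow> ('a \<Rightarrow> 'a measure) \<Rightarrow> 'a measure \<Rightarrow> 'a \<Rightarrow> 'a measure" where
  "rcar_mh_kernel \<Psi> K lam u =
     measure_of UNIV (sets borel)
       (\<lambda>A. (\<integral>\<^sup>+v. ennreal (mh_accept \<Psi> u v) * indicator A v \<partial>rcar_proposal K lam u)
          + indicator A u * (\<integral>\<^sup>+w. ennreal (1 - mh_accept \<Psi> u w) \<partial>rcar_proposal K lam u))"

definition is_coupling ::
    "('a \<times> 'a) measure \<Rightarrow> ('a :: topological_space) measure \<Rightarrow> 'a measure \<Rightarrow> bool" where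
  "is_coupling W M N \<longleftrightarrow>
     sets W = sets (borel \<Otimes>\<^sub>M borel) \<and> distr W borel fst = M \<and> distr W borel snd = N"

definition invariant_prob ::
    "('a :: topological_space \<Rightarrow> 'a measure) \<Rightarrow> 'a measure \<Rightarrow> bool" where
  "invariant_prob P \<mu> \<longleftrightarrow>
     prob_space \<mu> \<and> sets \<mu> = sets borel \<and>
     (\<forall>A\<in>sets borel. (\<integral>\<^sup>+u. emeasure (P u) A \<partial>\<mu>) = emeasure \<mu> A)"

lemma sets_rcar_mh_kernel [simp]: "sets (rcar_mh_kernel \<Psi> K lam (u :: 'a :: banach)) = sets borel"
  unfolding rcar_mh_kernel_def
  using sets.sets_measure_of_eq[of "borel :: 'a measure"] by (simp only: space_borel)

lemma space_rcar_mh_kernel [simp]: "space (rcar_mh_kernel \<Psi> K lam u) = UNIV"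
  using sets_eq_imp_space_eq[OF sets_rcar_mh_kernel] by simp

lemma sets_rcar_proposal [simp, measurable_cong]: "sets (rcar_proposal K lam u) = sets borel"
  by (simp add: rcar_proposal_def conv_law_def)

lemma emeasure_rcar_mh_kernel:
  fixes \<Psi> :: "'a :: {banach, second_countable_topology} \<Rightarrow> real"
  assumes [measurable]: "\<Psi> \<in> borel_measurable borel" and A: "A \<in> sets borel"
  shows "emeasure (rcar_mh_kernel \<Psi> K lam u) A =
      (\<integral>\<^sup>+v. ennreal (mh_accept \<Psi> u v) * indicator A v \<partial>rcar_proposal K lam u)
        + indicator A u * (\<integral>\<^sup>+w. ennreal (1 - mh_accept \<Psi> u w) \<partial>rcar_proposal K lam u)"
proof -
  let ?Q = "rcar_proposal K lam u"
  let ?c = "\<integral>\<^sup>+w. ennreal (1 - mh_accept \<Psi> u w) \<partial>?Q"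
  let ?D = "density ?Q (\<lambda>v. ennreal (mh_accept \<Psi> u v))"
  let ?\<mu> = "\<lambda>A. (\<integral>\<^sup>+v. ennreal (mh_accept \<Psi> u v) * indicator A v \<partial>?Q) + indicator A u * ?c"
  have m [measurable]: "(\<lambda>v. ennreal (mh_accept \<Psi> u v)) \<in> borel_measurable ?Q"
    unfolding mh_accept_def by measurable
  have eq: "?\<mu> B = emeasure ?D B + emeasure (return borel u) B * ?c" if "B \<in> sets borel" for B
    using that by (simp add: emeasure_density)
  have "countably_additive (sets borel) ?\<mu>"
  proof (rule countably_additiveI)
    fix F :: "nat \<Rightarrow> 'a set"
    assume F: "range F \<subseteq> sets borel" "disjoint_family F" "\<Union> (range F) \<in> sets borel"
    have FB: "F i \<in> sets borel" for i using F(1) by auto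
    have "(\<Sum>i. ?\<mu> (F i)) = (\<Sum>i. emeasure ?D (F i) + emeasure (return borel u) (F i) * ?c)"
      by (rule suminf_cong) (rule eq[OF FB])
    also have "\<dots> = (\<Sum>i. emeasure ?D (F i)) + (\<Sum>i. emeasure (return borel u) (F i)) * ?c"
      by (subst suminf_add[symmetric]) simp_all
    also have "\<dots> = emeasure ?D (\<Union> (range F)) + emeasure (return borel u) (\<Union> (range F)) * ?c"
      using F by (subst (1 2) suminf_emeasure) auto
    also have "\<dots> = ?\<mu> (\<Union> (range F))" by (rule eq[OF F(3), symmetric])
    finally show "(\<Sum>i. ?\<mu> (F i)) = ?\<mu> (\<Union> (range F))" .
  qed
  moreover have "positive (sets borel) ?\<mu>"
    by (simp add: positive_def)
  moreover have "sigma_algebra UNIV (sets (borel :: 'a measure))"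
    using sets.sigma_algebra_axioms[of "borel :: 'a measure"] by simp
  ultimately show ?thesis
    unfolding rcar_mh_kernel_def using A by (intro emeasure_measure_of_sigma)
qed

lemma prob_space_rcar_mh_kernel:
  fixes \<Psi> :: "'a :: {banach, second_countable_topology} \<Rightarrow> real"
  assumes [measurable]: "\<Psi> \<in> borel_measurable borel"
    and K: "markov_kernel K" and lam: "prob_space lam" "sets lam = sets borel"
  shows "prob_space (rcar_mh_kernel \<Psi> K lam u)"
proof
  let ?Q = "rcar_proposal K lam u"
  have "K u \<in> space (prob_algebra borel)"
    using measurable_space[OF K[unfolded markov_kernel_def]] by simp
  then have Ku: "prob_space (K u)" "sets (K u) = sets borel"
    by (auto simp: space_prob_algebra)
  interpret KL: pair_prob_space "K u" lam
    using Ku lam by (simp add: pair_prob_space_def pair_sigma_finite_def prob_space_imp_sigma_finite)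
  have "(\<lambda>(x, y). x + y) \<in> (borel :: 'a measure) \<Otimes>\<^sub>M borel \<rightarrow>\<^sub>M borel" by measurable
  then have "(\<lambda>(x, y). x + y) \<in> K u \<Otimes>\<^sub>M lam \<rightarrow>\<^sub>M borel"
    using measurable_cong_sets[OF sets_pair_measure_cong[OF Ku(2) lam(2)] refl] by blast
  then have "prob_space ?Q"
    unfolding rcar_proposal_def conv_law_def by (rule KL.prob_space_distr)
  then interpret Q: prob_space ?Q .
  have [measurable]: "mh_accept \<Psi> u \<in> borel_measurable ?Q"
    unfolding mh_accept_def by measurable
  have "emeasure (rcar_mh_kernel \<Psi> K lam u) UNIV =
      (\<integral>\<^sup>+v. ennreal (mh_accept \<Psi> u v) + ennreal (1 - mh_accept \<Psi> u v) \<partial>?Q)"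
    by (subst emeasure_rcar_mh_kernel) (auto simp: nn_integral_add)
  also have "\<dots> = (\<integral>\<^sup>+v. 1 \<partial>?Q)"
    by (intro nn_integral_cong) (auto simp: mh_accept_def simp flip: ennreal_plus)
  also have "\<dots> = 1" using Q.emeasure_space_1 by simp
  finally show "emeasure (rcar_mh_kernel \<Psi> K lam u) (space (rcar_mh_kernel \<Psi> K lam u)) = 1"
    by simp
qed

end

theory Submission
  imports Defs
begin

text \<open>The proof is a weak Harris argument, carried out on functions instead of measures. Let \<open>V u = \<parallel>u\<parallel>\<^sup>p\<close>.
There is a cost \<open>D\<close> on pairs of states, at least a multiple of \<open>min 1 \<parallel>x - y\<parallel>\<close>, and some \<open>\<alpha> < 1\<close>
such that \<open>\<bar>f x - f y\<bar> \<le> M * D x y\<close> for all \<open>x, y\<close> implies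
\<open>\<bar>(Pf) x - (Pf) y\<bar> \<le> \<alpha> * M * D x y\<close>, for every \<open>f\<close> with values in \<open>[0, 1]\<close>. This
needs a coupling of \<open>P u\<close> and \<open>P v\<close> for one pair \<open>(u, v)\<close> at a time, and hence no measurable
dependence of the couplings on the pair.

Given the contraction, \<open>P\<^sup>n f\<close> becomes constant, which gives uniqueness. For existence, the laws of
the chain started at a point form a Cauchy sequence, uniformly over the functions with given \<open>M\<close>. Their
limit is a functional, and completeness of the space makes it \<open>\<sigma>\<close>-continuous, so that a
Daniell-Caratheodory construction represents it by a measure (\<open>representing_measure\<close>,
\<open>limit_measure_exists\<close>, \<open>contracting_kernel_unique_invariant\<close>).

The cost is \<open>D u v = sqrt (d u v * (1 + \<gamma> * (V u + V v)))\<close> with \<open>d \<le> 1\<close>. Let the two chains use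
coupled contractions, the same innovation and the same uniform variable for the acceptance. Three effects
make \<open>D\<close> decrease in mean.

\<^item> At small distances \<open>d\<close> is \<open>\<parallel>u - v\<parallel> * (\<kappa> + V u + V v) / \<epsilon>\<close>. In a bounded region this decreases
  because the contraction is accepted with a probability bounded below, and far out because the weight does
  (\<open>drift\<close>). The chains disagree about acceptance with a probability of at most a constant times
  \<open>\<parallel>u - v\<parallel> * (\<kappa> + V u + V v)\<close>, which is negligible for small \<open>\<epsilon>\<close> (\<open>small_scale_contraction\<close>).

\<^item> At large distances in a bounded region the chains may accept a fixed number of contractions with small
  innovations and so come close. The cost \<open>d\<close> is slightly smaller the fewer such steps are needed
  (\<open>contracting_cost_exists\<close>).

\<^item> If a chain is far out and \<open>d = 1\<close>, then \<open>d\<close> cannot increase and the factor \<open>1 + \<gamma> * (V u + V v)\<close>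
  decreases by the drift.

The square root separates \<open>d\<close> from \<open>V\<close> by the Cauchy-Schwarz inequality
(\<open>tilted_cost_contraction\<close>). Without it the bound for the disagreement, which grows like
\<open>\<parallel>\<xi>\<parallel>\<^sup>q\<close>, would be multiplied by \<open>V\<close>, and the innovation would need moments of order \<open>p + q\<close>.\<close>


section \<open>Lipschitz functions determine Borel probability measures\<close>

text \<open>For closed \<open>F \<noteq> {}\<close> these functions decrease to the indicator of \<open>F\<close>. As \<open>infdist x {} = 0\<close>,
  the bumps of the empty set are constantly one.\<close>

definition bump :: "'a :: metric_space set \<Rightarrow> nat \<Rightarrow> 'a \<Rightarrow> real" where
  "bump F n x = max 0 (1 - real n * infdist x F)"

lemma bump_0 [simp]: "bump F 0 x = 1"
  by (simp add: bump_def)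

lemma bump_nonneg: "0 \<le> bump F n x" and bump_le_1: "bump F n x \<le> 1"
  by (auto simp: bump_def infdist_nonneg)

lemma bump_on: "x \<in> F \<Longrightarrow> bump F n x = 1"
  by (simp add: bump_def)

lemma bump_antimono: "bump F (Suc n) x \<le> bump F n x"
  using infdist_nonneg[of x F] by (simp add: bump_def algebra_simps max_def)

lemma bump_lipschitz: "\<bar>bump F n x - bump F n y\<bar> \<le> real n * dist x y"
proof -
  have "\<bar>bump F n x - bump F n y\<bar> \<le> \<bar>real n * infdist x F - real n * infdist y F\<bar>"
    by (auto simp: bump_def)
  also have "\<dots> = real n * \<bar>infdist x F - infdist y F\<bar>"
    by (simp add: abs_mult flip: right_diff_distrib)
  also have "\<dots> \<le> real n * dist x y"
    by (intro mult_left_mono infdist_triangle_abs) auto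
  finally show ?thesis .
qed

lemma bump_measurable [measurable]: "bump F n \<in> borel_measurable borel"
  unfolding bump_def[abs_def] by (intro borel_measurable_continuous_onI continuous_intros)

lemma bump_tendsto_0:
  assumes "closed F" "F \<noteq> {}" "x \<notin> F"
  shows "(\<lambda>n. bump F n x) \<longlonglongrightarrow> 0"
proof -
  have "0 < infdist x F" using assms by (rule infdist_pos_not_in_closed)
  then obtain N where N: "1 / infdist x F < real N" using reals_Archimedean2 by blast
  have "bump F n x = 0" if "n \<ge> N" for n
  proof -
    have "1 < real N * infdist x F" using N \<open>0 < infdist x F\<close> by (simp add: field_simps)
    also have "\<dots> \<le> real n * infdist x F" using that \<open>0 < infdist x F\<close> by simp
    finally show ?thesis by (simp add: bump_def)
  qed
  then show ?thesis
    by (intro tendsto_eventually) (auto simp: eventually_sequentially)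
qed

lemma bump_tendsto_indicator:
  assumes "closed F" "F \<noteq> {}"
  shows "(\<lambda>n. bump F n x) \<longlonglongrightarrow> indicator F x"
  using bump_tendsto_0[OF assms] by (cases "x \<in> F") (auto simp: bump_on)

text \<open>The closed sets are an intersection-stable generator of the Borel sets, and their measures are limits
  of integrals of bumps.\<close>

lemma prob_measure_eqI_bump:
  fixes M N :: "'a :: metric_space measure"
  assumes M: "prob_space M" "sets M = sets borel" and N: "prob_space N" "sets N = sets borel"
    and eq: "\<And>F n. closed F \<Longrightarrow> (\<integral>x. bump F n x \<partial>M) = (\<integral>x. bump F n x \<partial>N)"
  shows "M = N"
proof -
  have lim: "(\<lambda>n. \<integral>x. bump F n x \<partial>Q) \<longlonglongrightarrow> measure Q F"
    if Q: "prob_space Q" "sets Q = sets borel" and F: "closed F" "F \<noteq> {}" for Q :: "'a measure" and F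
  proof -
    interpret Q: prob_space Q by fact
    have m: "borel_measurable Q = borel_measurable borel"
      using Q(2) by (rule measurable_cong_sets) simp
    have FQ: "F \<in> sets Q" using F Q(2) by simp
    have "(\<lambda>n. \<integral>x. bump F n x \<partial>Q) \<longlonglongrightarrow> (\<integral>x. indicator F x \<partial>Q)"
      using F FQ by (intro integral_dominated_convergence[where w="\<lambda>_. 1"])
        (auto simp: m bump_tendsto_indicator bump_nonneg bump_le_1)
    then show ?thesis using FQ by simp
  qed
  interpret M: prob_space M by fact
  interpret N: prob_space N by fact
  show ?thesis
  proof (rule measure_eqI_generator_eq[where E="Collect closed" and \<Omega>=UNIV and A="\<lambda>_. UNIV"])
    fix F :: "'a set" assume "F \<in> Collect closed"
    then have F: "closed F" by simp
    show "emeasure M F = emeasure N F"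
    proof (cases "F = {}")
      case False
      have "measure M F = measure N F"
        using LIMSEQ_unique[OF lim[OF M F False]] lim[OF N F False] by (simp add: eq F)
      then show ?thesis by (simp add: M.emeasure_eq_measure N.emeasure_eq_measure)
    qed simp
  qed (use M(2) N(2) in \<open>auto simp: Int_stable_def borel_eq_closed\<close>)
qed

section \<open>From a positive functional on Lipschitz functions to a measure\<close>

text \<open>The layer-cake decomposition: each summand is the part of \<open>y\<close> between the levels \<open>k\<close> and \<open>k + 1\<close>.\<close>

lemma sum_unit_steps:
  fixes y :: real assumes "0 \<le> y"
  shows "(\<Sum>k<m. max 0 (min 1 (y - real k))) = min y (real m)"
  using assms by (induction m) auto

text \<open>The functions in \<open>C\<close> have values in \<open>[0, 1]\<close>, so \<open>C\<close> is not a vector space, and linearity is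
  phrased for those finite sums that stay in \<open>C\<close> up to a scalar. The assumption \<open>smooth\<close> is where
  \<open>\<sigma>\<close>-continuity enters.\<close>

locale daniell_functional =
  fixes C :: "('a :: metric_space \<Rightarrow> real) set" and \<Lambda> :: "('a \<Rightarrow> real) \<Rightarrow> real"
  assumes unit: "f \<in> C \<Longrightarrow> 0 \<le> f x \<and> f x \<le> 1"
    and measurable_C: "f \<in> C \<Longrightarrow> f \<in> borel_measurable borel"
    and lipschitz_C: "(\<And>x. 0 \<le> f x \<and> f x \<le> 1) \<Longrightarrow> (\<And>x y. \<bar>f x - f y\<bar> \<le> M * dist x y) \<Longrightarrow> f \<in> C"
    and times_C: "f \<in> C \<Longrightarrow> g \<in> C \<Longrightarrow> (\<lambda>x. f x * g x) \<in> C"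
    and clip_C: "f \<in> C \<Longrightarrow> (\<lambda>x. max 0 (min 1 (a * f x - b))) \<in> C"
    and mono: "f \<in> C \<Longrightarrow> g \<in> C \<Longrightarrow> (\<And>x. f x \<le> g x) \<Longrightarrow> \<Lambda> f \<le> \<Lambda> g"
    and linear: "(\<And>i. c i \<in> C) \<Longrightarrow> f \<in> C \<Longrightarrow> (\<And>x. (\<Sum>i<m. c i x) = a * f x) \<Longrightarrow>
          (\<Sum>i<(m :: nat). \<Lambda> (c i)) = a * \<Lambda> f"
    and one: "\<Lambda> (\<lambda>_. 1) = 1"
    and smooth: "(\<And>i. s i \<in> C) \<Longrightarrow> (\<And>x. 1 \<le> (\<Sum>i. ennreal (s i x))) \<Longrightarrow>
          1 \<le> (\<Sum>i. ennreal (\<Lambda> (s i)))"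
begin

lemma zero_C: "(\<lambda>_. 0) \<in> C" and one_C: "(\<lambda>_. 1) \<in> C"
  by (rule lipschitz_C[where M=0]; simp)+

lemma \<Lambda>_zero: "\<Lambda> (\<lambda>_. 0) = 0"
  using linear[of "\<lambda>_ _. 0" "\<lambda>_. 0" 0 1] zero_C by simp

lemma \<Lambda>_nonneg: "f \<in> C \<Longrightarrow> 0 \<le> \<Lambda> f"
  using mono[OF zero_C, of f] unit[of f] \<Lambda>_zero by simp

lemma bump_C: "bump F n \<in> C"
  by (rule lipschitz_C[OF _ bump_lipschitz]) (simp add: bump_nonneg bump_le_1)

lemma compl_C: assumes "f \<in> C" shows "(\<lambda>x. 1 - f x) \<in> C"
proof -
  have "(\<lambda>x. max 0 (min 1 ((-1) * f x - (-1)))) \<in> C" using assms by (rule clip_C)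
  also have "(\<lambda>x. max 0 (min 1 ((-1) * f x - (-1)))) = (\<lambda>x. 1 - f x)"
    using unit[OF assms] by (auto simp: fun_eq_iff)
  finally show ?thesis .
qed

lemma \<Lambda>_compl: assumes "f \<in> C" shows "\<Lambda> (\<lambda>x. 1 - f x) = 1 - \<Lambda> f"
proof -
  have "(\<lambda>x. if i = 0 then f x else 1 - f x) \<in> C" for i :: nat
    using assms compl_C[OF assms] by (cases "i = 0") auto
  then show ?thesis
    using linear[of "\<lambda>i x. if i = 0 then f x else 1 - f x" "\<lambda>_. 1" "Suc (Suc 0)" 1] one_C one
    by simp
qed

text \<open>A set is covered by functions instead of open sets, and a cover is priced by the functional. A cover
  can then be split by a partition of unity, and covers of countably many sets can be merged into one.\<close>

definition covers :: "'a set \<Rightarrow> (nat \<Rightarrow> 'a \<Rightarrow> real) set" where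
  "covers A = {f. (\<forall>i. f i \<in> C) \<and> (\<forall>x\<in>A. 1 \<le> (\<Sum>i. ennreal (f i x)))}"

definition price :: "(nat \<Rightarrow> 'a \<Rightarrow> real) \<Rightarrow> ennreal" where
  "price f = (\<Sum>i. ennreal (\<Lambda> (f i)))"

definition outer :: "'a set \<Rightarrow> ennreal" where
  "outer A = (INF f\<in>covers A. price f)"

lemma outer_le: "f \<in> covers A \<Longrightarrow> outer A \<le> price f"
  unfolding outer_def by (rule INF_lower)

lemma outer_mono: "A \<subseteq> B \<Longrightarrow> outer A \<le> outer B"
  unfolding outer_def by (rule INF_superset_mono) (auto simp: covers_def)

lemma single_cover:
  assumes "f \<in> C" "\<And>x. x \<in> A \<Longrightarrow> 1 \<le> f x"
  shows "outer A \<le> ennreal (\<Lambda> f)"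
proof -
  define s where "s i = (if i = 0 then f else (\<lambda>_. 0))" for i :: nat
  have sum: "(\<Sum>i. ennreal (if i = 0 then a else 0)) = ennreal a" for a
    by (subst suminf_finite[of "{0::nat}"]) auto
  have "s \<in> covers A"
    using assms zero_C sum[of "f _"] by (auto simp: covers_def s_def if_distribR cong: if_cong)
  moreover have "price s = ennreal (\<Lambda> f)"
    using sum[of "\<Lambda> f"] by (simp add: price_def s_def if_distrib[of \<Lambda>] \<Lambda>_zero cong: if_cong)
  ultimately show ?thesis using outer_le by metis
qed

lemma outer_empty: "outer {} = 0"
  using single_cover[OF zero_C, of "{}"] by (simp add: \<Lambda>_zero)

lemma outer_UNIV: "outer UNIV = 1"
proof (rule antisym)
  show "outer UNIV \<le> 1" using single_cover[OF one_C, of UNIV] by (simp add: one)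
  show "1 \<le> outer UNIV"
    unfolding outer_def price_def by (rule INF_greatest) (auto simp: covers_def intro!: smooth)
qed

lemma outer_countably_subadditive: "outer (\<Union>i. A i) \<le> (\<Sum>i. outer (A i))"
proof (rule ennreal_le_epsilon)
  fix e :: real assume fin: "(\<Sum>i. outer (A i)) < top" and e: "0 < e"
  have "\<exists>f\<in>covers (A i). price f \<le> outer (A i) + ennreal (e * (1/2) ^ Suc i)" for i
  proof -
    have "outer (A i) \<noteq> \<infinity>"
      using ennreal_suminf_lessD[OF fin, of i] by simp
    then have "\<exists>f\<in>covers (A i). price f < outer (A i) + ennreal (e * (1/2) ^ Suc i)"
      using e by (intro INF_approx_ennreal) (auto simp: outer_def)
    then show ?thesis by (auto intro: less_imp_le)
  qed
  then obtain f where f: "\<And>i. f i \<in> covers (A i)"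
    and p: "\<And>i. price (f i) \<le> outer (A i) + ennreal (e * (1/2) ^ Suc i)" by metis
  define g where "g j = case_prod f (prod_decode j)" for j
  have "g \<in> covers (\<Union>i. A i)"
  proof -
    have "1 \<le> (\<Sum>j. ennreal (g j x))" if x: "x \<in> A i" for x i
    proof -
      have "1 \<le> (\<Sum>j. ennreal (f i j x))" using f[of i] x by (auto simp: covers_def)
      also have "\<dots> \<le> (\<Sum>i. \<Sum>j. ennreal (f i j x))"
        using sum_le_suminf[OF summableI, of "{i}" "\<lambda>i. \<Sum>j. ennreal (f i j x)"] by simp
      also have "\<dots> = (\<Sum>j. ennreal (g j x))"
        unfolding g_def
        by (subst suminf_ennreal_2dimen[where f="\<lambda>(i, j). ennreal (f i j x)", symmetric])
          (auto simp: case_prod_beta)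
      finally show ?thesis .
    qed
    then show ?thesis using f by (auto simp: covers_def g_def split: prod.split)
  qed
  then have "outer (\<Union>i. A i) \<le> price g" by (rule outer_le)
  also have "\<dots> = (\<Sum>i. price (f i))"
    unfolding price_def g_def
    by (subst suminf_ennreal_2dimen[where f="\<lambda>(i, j). ennreal (\<Lambda> (f i j))", symmetric])
      (auto simp: case_prod_beta)
  also have "\<dots> \<le> (\<Sum>i. outer (A i) + ennreal (e * (1/2) ^ Suc i))"
    by (intro suminf_le p) auto
  also have "\<dots> = (\<Sum>i. outer (A i)) + (\<Sum>i. ennreal (e * (1/2) ^ Suc i))"
    by (subst suminf_add[symmetric]) auto
  also have "(\<Sum>i. ennreal (e * (1/2) ^ Suc i)) = ennreal e"
    using sums_mult[OF power_half_series, of e] e by (intro sums_unique[symmetric]) simp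
  finally show "outer (\<Union>i. A i) \<le> (\<Sum>i. outer (A i)) + ennreal e" .
qed

lemma outer_measure_space_outer: "outer_measure_space (Pow UNIV) outer"
  unfolding outer_measure_space_def positive_def increasing_def countably_subadditive_def
  using outer_empty outer_mono outer_countably_subadditive by auto

text \<open>A cover of \<open>A\<close> is split by the partition of unity
  \<open>bump F N + (\<Sum>n<N. bump F n - bump F (Suc n)) = 1\<close>. The first part covers \<open>A \<inter> F\<close> for every \<open>N\<close>, and
  the second part covers \<open>A - F\<close> in the limit, because the bumps vanish off \<open>F\<close>.\<close>

lemma outer_split_closed:
  assumes F: "closed F"
  shows "outer (A \<inter> F) + outer (A - F) \<le> outer A"
proof (cases "F = {}")
  case True then show ?thesis by (simp add: outer_empty)
next
  case ne: False
  define e where "e n x = bump F n x - bump F (Suc n) x" for n x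
  have eC: "e n \<in> C" for n
  proof (rule lipschitz_C[where M="real n + real (Suc n)"])
    show "0 \<le> e n x \<and> e n x \<le> 1" for x
      using bump_antimono[of F n x] bump_nonneg[of F "Suc n" x] bump_le_1[of F n x] by (simp add: e_def)
    show "\<bar>e n x - e n y\<bar> \<le> (real n + real (Suc n)) * dist x y" for x y
      using bump_lipschitz[of F n x y] bump_lipschitz[of F "Suc n" x y]
      by (simp add: e_def algebra_simps abs_if split: if_splits)
  qed
  have e_sum: "(\<Sum>n<N. e n x) = 1 - bump F N x" for N x
    unfolding e_def by (subst sum_lessThan_telescope') simp
  have e_total: "(\<Sum>n. ennreal (e n x)) = 1" if "x \<notin> F" for x
  proof -
    have "(\<lambda>N. \<Sum>n<N. e n x) \<longlonglongrightarrow> 1 - 0"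
      unfolding e_sum by (intro tendsto_intros bump_tendsto_0 F ne that)
    then have "(\<lambda>n. e n x) sums 1" by (simp add: sums_def)
    then have "(\<lambda>n. ennreal (e n x)) sums ennreal 1" using unit[OF eC] by (subst sums_ennreal) auto
    then show ?thesis by (simp add: sums_iff)
  qed
  show ?thesis
    unfolding outer_def[of A]
  proof (rule INF_greatest)
    fix f assume f: "f \<in> covers A"
    then have fC: "f i \<in> C" for i by (simp add: covers_def)
    have feC: "(\<lambda>x. f i x * e n x) \<in> C" and fbC: "(\<lambda>x. f i x * bump F n x) \<in> C" for i n
      by (intro times_C fC eC bump_C)+
    define X where "X N = (\<Sum>n<N. \<Sum>i. ennreal (\<Lambda> (\<lambda>x. f i x * e n x)))" for N
    have split: "X N + (\<Sum>i. ennreal (\<Lambda> (\<lambda>x. f i x * bump F N x))) = price f" for N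
    proof -
      have *: "(\<Sum>n<N. \<Lambda> (\<lambda>x. f i x * e n x)) + \<Lambda> (\<lambda>x. f i x * bump F N x) = \<Lambda> (f i)" for i
      proof -
        have "(\<Sum>n<N. f i x * e n x) + f i x * bump F N x = f i x" for x
          by (subst sum_distrib_left[symmetric]) (simp add: e_sum algebra_simps)
        moreover have "(\<lambda>x. f i x * (if n < N then e n x else bump F N x)) \<in> C" for n
          using feC fbC by (cases "n < N") auto
        ultimately show ?thesis
          using linear[of "\<lambda>n x. f i x * (if n < N then e n x else bump F N x)" "f i" "Suc N" 1]
            fC[of i] by simp
      qed
      have "X N = (\<Sum>i. \<Sum>n<N. ennreal (\<Lambda> (\<lambda>x. f i x * e n x)))"
        unfolding X_def by (rule suminf_sum[symmetric]) simp
      also have "\<dots> + (\<Sum>i. ennreal (\<Lambda> (\<lambda>x. f i x * bump F N x))) =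
          (\<Sum>i. (\<Sum>n<N. ennreal (\<Lambda> (\<lambda>x. f i x * e n x))) + ennreal (\<Lambda> (\<lambda>x. f i x * bump F N x)))"
        by (rule suminf_add) auto
      also have "\<dots> = price f"
        unfolding price_def
        by (intro suminf_cong)
          (simp add: \<Lambda>_nonneg feC fbC sum_nonneg *[symmetric])
      finally show ?thesis .
    qed
    have inner: "outer (A \<inter> F) \<le> (\<Sum>i. ennreal (\<Lambda> (\<lambda>x. f i x * bump F N x)))" for N
    proof -
      have "(\<lambda>i x. f i x * bump F N x) \<in> covers (A \<inter> F)"
        using f fbC by (auto simp: covers_def bump_on)
      from outer_le[OF this] show ?thesis by (simp add: price_def)
    qed
    have "outer (A - F) \<le> (SUP N. X N)"
    proof -
      define g where "g j = (case prod_decode j of (n, i) \<Rightarrow> (\<lambda>x. f i x * e n x))" for j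
      have "g \<in> covers (A - F)"
      proof -
        have "1 \<le> (\<Sum>j. ennreal (g j x))" if x: "x \<in> A" "x \<notin> F" for x
        proof -
          have "1 \<le> (\<Sum>i. ennreal (f i x))" using f x by (auto simp: covers_def)
          also have "\<dots> = (\<Sum>n. ennreal (e n x)) * (\<Sum>i. ennreal (f i x))"
            by (simp add: e_total x)
          also have "\<dots> = (\<Sum>n. \<Sum>i. ennreal (f i x * e n x))"
            using unit[OF fC] unit[OF eC]
            by (simp add: ennreal_mult mult.commute[of "ennreal (f _ _)"] ennreal_suminf_cmult ennreal_suminf_multc)
          also have "\<dots> = (\<Sum>j. ennreal (g j x))"
            unfolding g_def
            by (subst suminf_ennreal_2dimen[where f="\<lambda>(n, i). ennreal (f i x * e n x)", symmetric])
              (auto simp: case_prod_beta)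
          finally show ?thesis .
        qed
        then show ?thesis using feC by (auto simp: covers_def g_def split: prod.split)
      qed
      then have "outer (A - F) \<le> price g" by (rule outer_le)
      also have "\<dots> = (\<Sum>n. \<Sum>i. ennreal (\<Lambda> (\<lambda>x. f i x * e n x)))"
        unfolding price_def g_def
        by (subst suminf_ennreal_2dimen[where f="\<lambda>(n, i). ennreal (\<Lambda> (\<lambda>x. f i x * e n x))", symmetric])
          (auto simp: case_prod_beta)
      also have "\<dots> = (SUP N. X N)" unfolding X_def by (rule suminf_eq_SUP)
      finally show ?thesis .
    qed
    then have "outer (A \<inter> F) + outer (A - F) \<le> (SUP N. X N) + outer (A \<inter> F)"
      by (simp add: add.commute add_mono)
    also have "\<dots> = (SUP N. X N + outer (A \<inter> F))" by (rule ennreal_SUP_add_left[symmetric]) simp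
    also have "\<dots> \<le> price f"
      by (rule SUP_least) (metis add_left_mono inner split)
    finally show "outer (A \<inter> F) + outer (A - F) \<le> price f" .
  qed
qed

text \<open>By \<open>outer_split_closed\<close> the Borel sets are Caratheodory measurable. The resulting measure
  satisfies \<open>\<mu> F \<le> \<Lambda> f\<close> whenever \<open>1 \<le> f\<close> on \<open>F\<close>, and summing over the levels of \<open>f\<close> gives
  \<open>\<integral>f \<partial>\<mu> \<le> \<Lambda> f\<close>. The same inequality for \<open>1 - f\<close> turns this into an equality.\<close>

theorem representing_measure:
  "\<exists>\<mu>. prob_space \<mu> \<and> sets \<mu> = sets borel \<and> (\<forall>f\<in>C. (\<integral>x. f x \<partial>\<mu>) = \<Lambda> f)"
proof -
  interpret Pow: sigma_algebra UNIV "Pow (UNIV :: 'a set)" by (rule sigma_algebra_Pow)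
  define L where "L = lambda_system UNIV (Pow UNIV) outer"
  have ms: "measure_space UNIV L outer"
    unfolding L_def by (rule Pow.caratheodory_lemma[OF outer_measure_space_outer])
  then have saL: "sigma_algebra UNIV L" by (simp add: measure_space_def)
  have "F \<in> L" if "closed F" for F
  proof -
    have "outer (A \<inter> F) + outer (A - F) = outer A" for A
    proof (rule antisym[OF outer_split_closed[OF that]])
      define B where "B i = (if i = 0 then A \<inter> F else if i = 1 then A - F else {})" for i :: nat
      have "outer A \<le> outer (\<Union>i. B i)"
        by (rule outer_mono) (auto simp: B_def intro: exI[of _ 0] exI[of _ 1])
      also have "\<dots> \<le> (\<Sum>i. outer (B i))" by (rule outer_countably_subadditive)
      also have "\<dots> = (\<Sum>i\<in>{0, 1}. outer (B i))"
        by (rule suminf_finite) (auto simp: B_def outer_empty)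
      finally show "outer A \<le> outer (A \<inter> F) + outer (A - F)" by (simp add: B_def)
    qed
    then show ?thesis unfolding L_def Pow.lambda_system_eq by simp
  qed
  then have sub: "sets borel \<subseteq> L"
    using sigma_algebra.sigma_sets_subset[OF saL, of "Collect closed"] by (auto simp: borel_eq_closed)
  define \<mu> where "\<mu> = measure_of UNIV (sets borel) outer"
  have sets_\<mu> [simp]: "sets \<mu> = sets borel"
    unfolding \<mu>_def using sets.sets_measure_of_eq[of "borel :: 'a measure"] by (simp only: space_borel)
  have space_\<mu> [simp]: "space \<mu> = UNIV" using sets_eq_imp_space_eq[OF sets_\<mu>] by simp
  have em: "emeasure \<mu> A = outer A" if "A \<in> sets borel" for A
    unfolding \<mu>_def
  proof (rule emeasure_measure_of_sigma)
    show "sigma_algebra UNIV (sets (borel :: 'a measure))"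
      using sets.sigma_algebra_axioms[of "borel :: 'a measure"] by simp
    show "positive (sets borel) outer" by (simp add: positive_def outer_empty)
    show "countably_additive (sets borel) outer"
      using ms sub unfolding measure_space_def countably_additive_def by blast
  qed fact
  have prob: "prob_space \<mu>" by standard (simp add: em outer_UNIV)
  interpret \<mu>: prob_space \<mu> by (rule prob)
  have mC: "f \<in> borel_measurable \<mu>" if "f \<in> C" for f
    using measurable_C[OF that] measurable_cong_sets[OF sets_\<mu> refl] by blast
  have int: "integrable \<mu> f" if "f \<in> C" for f
    using mC[OF that] unit[OF that] by (intro \<mu>.integrable_const_bound[where B=1]) auto
  have le: "(\<integral>x. f x \<partial>\<mu>) \<le> \<Lambda> f" if f: "f \<in> C" for f
  proof (rule field_le_epsilon)
    fix \<epsilon> :: real assume "0 < \<epsilon>"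
    then obtain n :: nat where n: "0 < n" "1 / real n < \<epsilon>"
      using nat_approx_posE[of \<epsilon>] by (metis zero_less_Suc)
    define c where "c k x = max 0 (min 1 (real n * f x - real k))" for k x
    define F where "F k = {x. real (Suc k) \<le> real n * f x}" for k
    have cC: "c k \<in> C" for k unfolding c_def[abs_def] by (rule clip_C[OF f])
    have [measurable]: "f \<in> borel_measurable borel" by (rule measurable_C[OF f])
    have F_sets: "F k \<in> sets borel" for k unfolding F_def by measurable
    have F_le: "measure \<mu> (F k) \<le> \<Lambda> (c k)" for k
    proof -
      have "outer (F k) \<le> ennreal (\<Lambda> (c k))"
        by (rule single_cover[OF cC]) (auto simp: F_def c_def)
      then show ?thesis
        using em[OF F_sets, of k] \<Lambda>_nonneg[OF cC[of k]]
        by (simp add: \<mu>.emeasure_eq_measure) (metis ennreal_le_iff)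
    qed
    have pt: "real n * f x \<le> 1 + (\<Sum>k<n. indicator (F k) x)" for x
    proof -
      have "max 0 (min 1 (real n * f x - 1 - real k)) \<le> indicator (F k) x" for k
        by (auto simp: F_def indicator_def)
      then have "(\<Sum>k<n. max 0 (min 1 (real n * f x - 1 - real k))) \<le> (\<Sum>k<n. indicator (F k) x)"
        by (rule sum_mono)
      moreover have "real n * f x - 1 \<le> (\<Sum>k<n. max 0 (min 1 (real n * f x - 1 - real k)))"
      proof (cases "0 \<le> real n * f x - 1")
        case True
        have "real n * f x \<le> real n" using unit[OF f, of x] by (simp add: mult_left_le)
        then show ?thesis using sum_unit_steps[OF True, of n] by simp
      next
        case False
        have "0 \<le> (\<Sum>k<n. max 0 (min 1 (real n * f x - 1 - real k)))" by (simp add: sum_nonneg)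
        then show ?thesis using False by simp
      qed
      ultimately show ?thesis by simp
    qed
    have "real n * (\<integral>x. f x \<partial>\<mu>) = (\<integral>x. real n * f x \<partial>\<mu>)" by simp
    also have "\<dots> \<le> (\<integral>x. 1 + (\<Sum>k<n. indicator (F k) x) \<partial>\<mu>)"
      using F_sets pt by (intro integral_mono Bochner_Integration.integrable_add
        Bochner_Integration.integrable_sum integrable_mult_right int[OF f])
        (auto simp: \<mu>.emeasure_eq_measure)
    also have "\<dots> = 1 + (\<Sum>k<n. measure \<mu> (F k))"
      using F_sets by (subst Bochner_Integration.integral_add)
        (auto simp: \<mu>.emeasure_eq_measure \<mu>.prob_space[simplified] intro!: Bochner_Integration.integrable_sum)
    also have "\<dots> \<le> 1 + (\<Sum>k<n. \<Lambda> (c k))" by (intro add_left_mono sum_mono F_le)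
    also have "(\<Sum>k<n. \<Lambda> (c k)) = real n * \<Lambda> f"
    proof (rule linear[OF cC f])
      show "(\<Sum>k<n. c k x) = real n * f x" for x
        using sum_unit_steps[of "real n * f x" n] unit[OF f, of x] by (simp add: c_def mult_left_le)
    qed
    finally have "real n * (\<integral>x. f x \<partial>\<mu>) \<le> 1 + real n * \<Lambda> f" .
    also have "\<dots> \<le> real n * (\<Lambda> f + \<epsilon>)" using n by (simp add: field_simps)
    finally show "(\<integral>x. f x \<partial>\<mu>) \<le> \<Lambda> f + \<epsilon>" using n by simp
  qed
  have "(\<integral>x. f x \<partial>\<mu>) = \<Lambda> f" if f: "f \<in> C" for f
  proof (rule antisym[OF le[OF f]])
    have "1 - (\<integral>x. f x \<partial>\<mu>) = (\<integral>x. 1 - f x \<partial>\<mu>)"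
      using int[OF f] by (simp add: \<mu>.prob_space[simplified])
    also have "\<dots> \<le> 1 - \<Lambda> f" using le[OF compl_C[OF f]] by (simp add: \<Lambda>_compl f)
    finally show "\<Lambda> f \<le> (\<integral>x. f x \<partial>\<mu>)" by simp
  qed
  then show ?thesis using prob sets_\<mu> by blast
qed

end

section \<open>Functions that are Lipschitz for a cost\<close>

definition unit_lip :: "('a \<Rightarrow> 'a \<Rightarrow> real) \<Rightarrow> real \<Rightarrow> ('a \<Rightarrow> real) \<Rightarrow> bool" where
  "unit_lip D M f \<longleftrightarrow>
     0 \<le> M \<and> (\<forall>x. 0 \<le> f x \<and> f x \<le> 1) \<and> (\<forall>x y. \<bar>f x - f y\<bar> \<le> M * D x y)"

text \<open>A cost replaces the metric. Its comparison with the truncated distance makes bounded Lipschitz functions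
  Lipschitz for the cost, and its vanishing at the diagonal makes functions that are Lipschitz for the cost
  continuous.\<close>

locale cost =
  fixes D :: "'a :: {complete_space, second_countable_topology} \<Rightarrow> 'a \<Rightarrow> real" and c0 :: real
  assumes dominates: "min 1 (dist x y) \<le> c0 * D x y"
    and vanishes: "(D x \<longlongrightarrow> 0) (at x)"
    and D_nonneg: "0 \<le> D x y"
    and c0_nonneg: "0 \<le> c0"
begin

lemma unit_lip_continuous:
  assumes "unit_lip D M f" shows "continuous_on UNIV f"
proof -
  have "(f \<longlongrightarrow> f x) (at x)" for x
  proof (rule Lim_transform_bound[where g="\<lambda>y. M * D x y", THEN Lim_null[THEN iffD2]])
    show "\<forall>\<^sub>F y in at x. norm (f y - f x) \<le> norm (M * D x y)"
    proof (intro always_eventually allI)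
      fix y
      have "\<bar>f x - f y\<bar> \<le> M * D x y" "0 \<le> M * D x y"
        using assms D_nonneg[of x y] by (simp_all add: unit_lip_def)
      then show "norm (f y - f x) \<le> norm (M * D x y)" by (simp add: abs_minus_commute)
    qed
    show "((\<lambda>y. M * D x y) \<longlongrightarrow> 0) (at x)"
      using tendsto_mult_left[OF vanishes, of M x] by simp
  qed
  then show ?thesis by (simp add: continuous_on_def)
qed

lemma unit_lip_measurable: "unit_lip D M f \<Longrightarrow> f \<in> borel_measurable borel"
  by (intro borel_measurable_continuous_onI unit_lip_continuous)

lemma unit_lip_lipschitz:
  assumes "\<And>x. 0 \<le> f x \<and> f x \<le> 1" "\<And>x y. \<bar>f x - f y\<bar> \<le> L * dist x y"
  shows "unit_lip D (max 1 L * c0) f"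
proof -
  have "\<bar>f x - f y\<bar> \<le> max 1 L * c0 * D x y" for x y
  proof -
    have "\<bar>f x - f y\<bar> \<le> 1" using assms(1)[of x] assms(1)[of y] by auto
    moreover have "\<bar>f x - f y\<bar> \<le> max 1 L * dist x y"
      using assms(2)[of x y] mult_right_mono[of L "max 1 L" "dist x y"] by simp
    ultimately have "\<bar>f x - f y\<bar> \<le> max 1 L * min 1 (dist x y)"
      by (cases "dist x y \<le> 1") auto
    also have "\<dots> \<le> max 1 L * (c0 * D x y)" by (intro mult_left_mono dominates) simp
    finally show ?thesis by (simp add: mult.assoc)
  qed
  then show ?thesis using assms(1) c0_nonneg by (simp add: unit_lip_def)
qed

lemma unit_lip_times:
  assumes f: "unit_lip D M f" and g: "unit_lip D N g"
  shows "unit_lip D (M + N) (\<lambda>x. f x * g x)"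
proof -
  have "\<bar>f x * g x - f y * g y\<bar> \<le> (M + N) * D x y" for x y
  proof -
    have "f x * g x - f y * g y = f x * (g x - g y) + (f x - f y) * g y" by (simp add: algebra_simps)
    also have "\<bar>\<dots>\<bar> \<le> f x * \<bar>g x - g y\<bar> + \<bar>f x - f y\<bar> * g y"
      using f g by (intro order_trans[OF abs_triangle_ineq]) (simp add: abs_mult unit_lip_def)
    also have "\<dots> \<le> 1 * \<bar>g x - g y\<bar> + \<bar>f x - f y\<bar> * 1"
      using f g by (intro add_mono mult_right_mono mult_left_mono) (auto simp: unit_lip_def)
    also have "\<dots> \<le> N * D x y + M * D x y"
      using f g unfolding unit_lip_def by (simp add: add_mono)
    finally show ?thesis by (simp add: algebra_simps)
  qed
  then show ?thesis using f g by (simp add: unit_lip_def mult_le_one)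
qed

lemma unit_lip_clip:
  assumes f: "unit_lip D M f"
  shows "unit_lip D (\<bar>a\<bar> * M) (\<lambda>x. max 0 (min 1 (a * f x - b)))"
proof -
  have "\<bar>max 0 (min 1 (a * f x - b)) - max 0 (min 1 (a * f y - b))\<bar> \<le> \<bar>a\<bar> * M * D x y" for x y
  proof -
    have "\<bar>max 0 (min 1 (a * f x - b)) - max 0 (min 1 (a * f y - b))\<bar> \<le> \<bar>a * f x - a * f y\<bar>"
      by linarith
    also have "\<dots> = \<bar>a\<bar> * \<bar>f x - f y\<bar>" by (simp add: abs_mult flip: right_diff_distrib)
    also have "\<dots> \<le> \<bar>a\<bar> * (M * D x y)"
      using f by (intro mult_left_mono) (auto simp: unit_lip_def)
    finally show ?thesis by (simp add: mult.assoc)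
  qed
  then show ?thesis using f by (simp add: unit_lip_def)
qed

lemma unit_lip_one_minus_sum:
  assumes "\<And>i. \<exists>M. unit_lip D M (s i)"
  shows "\<exists>M. unit_lip D M (\<lambda>x. max 0 (1 - (\<Sum>i<N. s i x)))"
proof -
  obtain M where M: "\<And>i. unit_lip D (M i) (s i)" using assms by metis
  have s: "0 \<le> s i x" for i x using M by (simp add: unit_lip_def)
  have "\<bar>max 0 (1 - (\<Sum>i<N. s i x)) - max 0 (1 - (\<Sum>i<N. s i y))\<bar> \<le> (\<Sum>i<N. M i) * D x y" for x y
  proof -
    have "\<bar>max 0 (1 - (\<Sum>i<N. s i x)) - max 0 (1 - (\<Sum>i<N. s i y))\<bar> \<le> \<bar>\<Sum>i<N. s i x - s i y\<bar>"
      unfolding sum_subtractf by linarith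
    also have "\<dots> \<le> (\<Sum>i<N. M i * D x y)"
      using M by (intro order_trans[OF sum_abs] sum_mono) (simp add: unit_lip_def)
    finally show ?thesis by (simp add: sum_distrib_right)
  qed
  then have "unit_lip D (\<Sum>i<N. M i) (\<lambda>x. max 0 (1 - (\<Sum>i<N. s i x)))"
    using M s by (simp add: unit_lip_def sum_nonneg)
  then show ?thesis ..
qed

end

section \<open>Limits of sequences of measures that are Cauchy for a cost\<close>

definition off :: "'a :: metric_space set \<Rightarrow> nat \<Rightarrow> 'a \<Rightarrow> real" where
  "off F k x = 1 - bump F (2 ^ k) x"

lemma off_unit: "0 \<le> off F k x" "off F k x \<le> 1"
  by (simp_all add: off_def bump_nonneg bump_le_1)

text \<open>A version of Dini's theorem in which the sum penalises the distance from finite nets at scale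
  \<open>1 / 2 ^ k\<close>. If all \<open>N\<close> failed, the points where they fail would be a totally bounded sequence, and at
  a cluster point the functions \<open>h n\<close> would not tend to zero.\<close>

lemma dini_with_finite_nets:
  fixes h :: "nat \<Rightarrow> 'a :: complete_space \<Rightarrow> real" and F :: "nat \<Rightarrow> 'a set"
  assumes cont: "\<And>n. continuous_on UNIV (h n)" and le1: "\<And>n x. h n x \<le> 1"
    and anti: "\<And>n x. h (Suc n) x \<le> h n x" and lim: "\<And>x. (\<lambda>n. h n x) \<longlonglongrightarrow> 0"
    and F: "\<And>k. finite (F k)" "\<And>k. F k \<noteq> {}" and e: "0 < e"
  shows "\<exists>N. \<forall>x. h N x \<le> e + 2 * (\<Sum>k<N. off (F k) k x)"
proof (rule ccontr)
  let ?\<phi> = "\<lambda>k x. off (F k) k x"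
  have \<phi>0: "0 \<le> ?\<phi> k x" for k x by (rule off_unit)
  assume "\<not> ?thesis"
  then have "\<forall>N. \<exists>x. e + 2 * (\<Sum>k<N. ?\<phi> k x) < h N x" by (simp add: not_le)
  then obtain x where x: "\<And>N. e + 2 * (\<Sum>k<N. ?\<phi> k (x N)) < h N (x N)" by metis
  have near: "\<exists>a\<in>F k. dist (x N) a < (1/2) ^ k" if "k < N" for k N
  proof -
    have "?\<phi> k (x N) \<le> (\<Sum>k<N. ?\<phi> k (x N))"
      using that \<phi>0 by (intro member_le_sum) auto
    then have "2 * ?\<phi> k (x N) < 1" using x[of N] le1[of N "x N"] e by linarith
    then have *: "2 ^ k * infdist (x N) (F k) < 1"
      by (simp add: off_def bump_def max_def split: if_splits)
    have "infdist (x N) (F k) < (1/2) ^ k"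
      using * by (simp add: power_one_over field_simps)
    then show ?thesis
      using F(2)[of k] by (simp add: infdist_notempty cINF_less_iff)
  qed
  have "compact (closure (range x))"
    unfolding compact_eq_totally_bounded
  proof (intro conjI allI impI)
    show "uniform_space_class.complete (closure (range x))" by (simp add: complete_eq_closed)
    fix \<delta> :: real assume "0 < \<delta>"
    then obtain k where k: "(1/2) ^ k < \<delta>" using real_arch_pow_inv[of \<delta> "1/2"] by auto
    let ?E = "F k \<union> x ` {..k}"
    have "range x \<subseteq> (\<Union>a\<in>?E. cball a ((1/2) ^ k))"
    proof safe
      fix N show "x N \<in> (\<Union>a\<in>?E. cball a ((1/2) ^ k))"
      proof (cases "k < N")
        case True then show ?thesis using near[OF True] by (force simp: dist_commute)
      next
        case False then show ?thesis by (intro UN_I[of "x N"]) auto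
      qed
    qed
    moreover have "closed (\<Union>a\<in>?E. cball a ((1/2) ^ k))" using F by (intro closed_UN) auto
    ultimately have "closure (range x) \<subseteq> (\<Union>a\<in>?E. cball a ((1/2) ^ k))" by (rule closure_minimal)
    also have "\<dots> \<subseteq> (\<Union>a\<in>?E. ball a \<delta>)" using k by force
    finally show "\<exists>E. finite E \<and> closure (range x) \<subseteq> (\<Union>a\<in>E. ball a \<delta>)"
      using F by (intro exI[of _ ?E]) auto
  qed
  then obtain l r where r: "strict_mono (r :: nat \<Rightarrow> nat)" "(x \<circ> r) \<longlonglongrightarrow> l"
    unfolding compact_def using closure_subset[of "range x"] by (metis UNIV_I image_subset_iff)
  have "e \<le> h M l" for M
  proof (rule tendsto_lowerbound)
    show "(\<lambda>j. h M ((x \<circ> r) j)) \<longlonglongrightarrow> h M l"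
      using continuous_on_tendsto_compose[OF cont[of M] r(2)] by simp
    have "e \<le> h M (x (r j))" if "j \<ge> M" for j
    proof -
      have "M \<le> r j" using that seq_suble[OF r(1), of j] by simp
      then have "h (r j) (x (r j)) \<le> h M (x (r j))"
        by (rule lift_Suc_antimono_le[of "\<lambda>n. h n (x (r j))", OF anti])
      moreover have "e \<le> h (r j) (x (r j))"
        using x[of "r j"] sum_nonneg[of "{..<r j}" "\<lambda>k. ?\<phi> k (x (r j))"] \<phi>0 by fastforce
      ultimately show ?thesis by simp
    qed
    then show "\<forall>\<^sub>F j in sequentially. e \<le> h M ((x \<circ> r) j)"
      by (auto simp: eventually_sequentially)
  qed simp
  then have "e \<le> 0" using LIMSEQ_le_const[OF lim[of l]] by auto
  then show False using e by simp
qed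

context cost
begin

text \<open>The limits of the integrals form a Daniell functional. Its smoothness is tightness: the mass off
  a small neighbourhood of a finite net is bounded for one late member of the sequence, the Cauchy property
  transfers the bound to the limit, and Dini's theorem applies near the nets.\<close>

theorem limit_measure_exists:
  fixes m :: "nat \<Rightarrow> 'a measure" and \<epsilon> :: "nat \<Rightarrow> real"
  assumes prob: "\<And>n. prob_space (m n)" and sets: "\<And>n. sets (m n) = sets borel"
    and \<epsilon>: "\<epsilon> \<longlonglongrightarrow> 0"
    and cauchy: "\<And>f M n k. unit_lip D M f \<Longrightarrow> n \<le> k \<Longrightarrow>
        \<bar>(\<integral>x. f x \<partial>m n) - (\<integral>x. f x \<partial>m k)\<bar> \<le> M * \<epsilon> n"
  shows "\<exists>\<mu>. prob_space \<mu> \<and> sets \<mu> = sets borel \<and>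
      (\<forall>f M. unit_lip D M f \<longrightarrow> (\<lambda>n. \<integral>x. f x \<partial>m n) \<longlonglongrightarrow> (\<integral>x. f x \<partial>\<mu>))"
proof -
  define C where "C = {f. \<exists>M. unit_lip D M f}"
  define \<Lambda> where "\<Lambda> f = lim (\<lambda>n. \<integral>x. f x \<partial>m n)" for f :: "'a \<Rightarrow> real"
  have CI: "unit_lip D M f \<Longrightarrow> f \<in> C" for f M by (auto simp: C_def)
  have unit: "0 \<le> f x \<and> f x \<le> 1" if "f \<in> C" for f x using that by (auto simp: C_def unit_lip_def)
  have meas: "f \<in> borel \<rightarrow>\<^sub>M (borel :: real measure)" if "f \<in> C" for f
    using that unit_lip_measurable by (auto simp: C_def)
  have int: "integrable (m n) f" if "f \<in> C" for f n
    using unit[OF that] meas[OF that] measurable_cong_sets[OF sets[of n] refl]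
    by (intro finite_measure.integrable_const_bound[where B=1] prob_space.finite_measure prob) auto
  have M\<epsilon>: "(\<lambda>n. M * \<epsilon> n) \<longlonglongrightarrow> 0" for M using tendsto_mult_left[OF \<epsilon>, of M] by simp
  have conv: "(\<lambda>n. \<integral>x. f x \<partial>m n) \<longlonglongrightarrow> \<Lambda> f" if "f \<in> C" for f
  proof -
    from that obtain M where M: "unit_lip D M f" by (auto simp: C_def)
    have "Cauchy (\<lambda>n. \<integral>x. f x \<partial>m n)"
    proof (rule CauchyI')
      fix e :: real assume "0 < e"
      then obtain N where N: "\<And>n. n \<ge> N \<Longrightarrow> M * \<epsilon> n < e"
        using order_tendstoD(2)[OF M\<epsilon>[of M]] by (auto simp: eventually_sequentially)
      show "\<exists>N. \<forall>n\<ge>N. \<forall>k>n. dist (\<integral>x. f x \<partial>m n) (\<integral>x. f x \<partial>m k) < e"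
      proof (intro exI[of _ N] allI impI)
        fix n k assume "N \<le> n" "n < k"
        then show "dist (\<integral>x. f x \<partial>m n) (\<integral>x. f x \<partial>m k) < e"
          using cauchy[OF M, of n k] N[of n] by (simp add: dist_real_def)
      qed
    qed
    then show ?thesis
      unfolding \<Lambda>_def by (simp add: Cauchy_convergent_iff convergent_LIMSEQ_iff)
  qed
  have \<Lambda>_near: "\<Lambda> f \<le> (\<integral>x. f x \<partial>m n) + M * \<epsilon> n" if M: "unit_lip D M f" for f M n
  proof (rule LIMSEQ_le_const2[OF conv[OF CI[OF M]]])
    show "\<exists>N. \<forall>k\<ge>N. (\<integral>x. f x \<partial>m k) \<le> (\<integral>x. f x \<partial>m n) + M * \<epsilon> n"
    proof (intro exI[of _ n] allI impI)
      fix k assume "n \<le> k"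
      from cauchy[OF M this] show "(\<integral>x. f x \<partial>m k) \<le> (\<integral>x. f x \<partial>m n) + M * \<epsilon> n" by linarith
    qed
  qed
  have \<phi>_lip: "unit_lip D (max 1 (real (2 ^ k)) * c0) (\<lambda>x. off F k x)" for F k
    by (rule unit_lip_lipschitz)
      (use bump_lipschitz[of F "2 ^ k"] in \<open>auto simp: off_def bump_nonneg bump_le_1 abs_minus_commute\<close>)
  have net: "\<exists>F. finite F \<and> F \<noteq> {} \<and> \<Lambda> (\<lambda>x. off F k x) \<le> \<delta>" if \<delta>: "0 < \<delta>" for k \<delta>
  proof -
    obtain X :: "'a set" where X: "countable X" "\<And>U. open U \<Longrightarrow> U \<noteq> {} \<Longrightarrow> \<exists>d\<in>X. d \<in> U"
      using countable_dense_setE[where 'a='a] by metis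
    from X(2)[of UNIV] have "X \<noteq> {}" by auto
    define d where "d = from_nat_into X"
    have range_d: "range d = X" unfolding d_def using X(1) \<open>X \<noteq> {}\<close> by (rule range_from_nat_into[rotated])
    let ?F = "\<lambda>j. d ` {..j}"
    let ?\<phi> = "\<lambda>j x. off (?F j) k x"
    obtain n where n: "max 1 (real (2 ^ k)) * c0 * \<epsilon> n < \<delta> / 2"
      using order_tendstoD(2)[OF M\<epsilon>[of "max 1 (real (2 ^ k)) * c0"], of "\<delta> / 2"] \<delta>
      by (auto simp: eventually_sequentially)
    interpret mn: prob_space "m n" by (rule prob)
    have "(\<lambda>j. ?\<phi> j x) \<longlonglongrightarrow> 0" for x
    proof (rule LIMSEQ_I)
      fix r :: real assume "0 < r"
      then have "ball x (r / 2 ^ k) \<noteq> {}" by (simp add: divide_le_0_iff not_le)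
      then obtain i where i: "d i \<in> ball x (r / 2 ^ k)"
        using X(2)[of "ball x (r / 2 ^ k)"] range_d by (metis open_ball rangeE)
      have "?\<phi> j x < r" if "j \<ge> i" for j
      proof -
        have "infdist x (?F j) \<le> dist x (d i)" using that by (intro infdist_le) auto
        also have "\<dots> < r / 2 ^ k" using i by simp
        finally have "2 ^ k * infdist x (?F j) < r" by (simp add: field_simps)
        then show ?thesis by (simp add: off_def bump_def max_def)
      qed
      then show "\<exists>N. \<forall>j\<ge>N. norm (?\<phi> j x - 0) < r"
        by (intro exI[of _ i]) (simp add: off_unit)
    qed
    then have "(\<lambda>j. \<integral>x. ?\<phi> j x \<partial>m n) \<longlonglongrightarrow> (\<integral>x. (0 :: real) \<partial>m n)"
    proof (intro integral_dominated_convergence[where w="\<lambda>_. 1"])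
      show "?\<phi> j \<in> borel_measurable (m n)" for j
        using meas[OF CI[OF \<phi>_lip]] measurable_cong_sets[OF sets[of n] refl] by blast
      show "AE x in m n. norm (?\<phi> j x) \<le> 1" for j
        by (intro AE_I2) (simp add: off_unit)
    qed simp_all
    then have "(\<lambda>j. \<integral>x. ?\<phi> j x \<partial>m n) \<longlonglongrightarrow> 0" by simp
    from order_tendstoD(2)[OF this, of "\<delta> / 2"] \<delta>
    obtain j where "(\<integral>x. ?\<phi> j x \<partial>m n) < \<delta> / 2"
      by (auto simp: eventually_sequentially)
    then have "\<Lambda> (?\<phi> j) \<le> \<delta>" using \<Lambda>_near[OF \<phi>_lip[of k "?F j"], of n] n by simp
    then show ?thesis by (intro exI[of _ "?F j"]) auto
  qed
  have "daniell_functional C \<Lambda>"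
  proof
    show "\<And>f x. f \<in> C \<Longrightarrow> 0 \<le> f x \<and> f x \<le> 1" by (rule unit)
    show "\<And>f. f \<in> C \<Longrightarrow> f \<in> borel_measurable borel" by (rule meas)
    show "\<And>f M. (\<And>x. 0 \<le> f x \<and> f x \<le> 1) \<Longrightarrow> (\<And>x y. \<bar>f x - f y\<bar> \<le> M * dist x y) \<Longrightarrow> f \<in> C"
      by (rule CI[OF unit_lip_lipschitz])
    show "\<And>f g. f \<in> C \<Longrightarrow> g \<in> C \<Longrightarrow> (\<lambda>x. f x * g x) \<in> C"
      unfolding C_def using unit_lip_times by blast
    show "\<And>f a b. f \<in> C \<Longrightarrow> (\<lambda>x. max 0 (min 1 (a * f x - b))) \<in> C"
      unfolding C_def using unit_lip_clip by blast
    show "\<Lambda> f \<le> \<Lambda> g" if "f \<in> C" "g \<in> C" "\<And>x. f x \<le> g x" for f g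
      using that by (intro LIMSEQ_le[OF conv conv]) (auto intro!: integral_mono int)
    show "(\<Sum>i<n. \<Lambda> (c i)) = a * \<Lambda> f"
      if c: "\<And>i. c i \<in> C" and f: "f \<in> C" and eq: "\<And>x. (\<Sum>i<n. c i x) = a * f x" for c f a and n :: nat
    proof (rule LIMSEQ_unique)
      show "(\<lambda>k. \<Sum>i<n. \<integral>x. c i x \<partial>m k) \<longlonglongrightarrow> (\<Sum>i<n. \<Lambda> (c i))"
        by (intro tendsto_sum conv c)
      have "(\<Sum>i<n. \<integral>x. c i x \<partial>m k) = a * (\<integral>x. f x \<partial>m k)" for k
        by (subst Bochner_Integration.integral_sum[symmetric]) (simp_all add: int c eq)
      then show "(\<lambda>k. \<Sum>i<n. \<integral>x. c i x \<partial>m k) \<longlonglongrightarrow> a * \<Lambda> f"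
        using tendsto_mult_left[OF conv[OF f], of a] by simp
    qed
    show "\<Lambda> (\<lambda>_. 1) = 1"
      unfolding \<Lambda>_def using prob_space.prob_space[OF prob] by simp
    fix s :: "nat \<Rightarrow> 'a \<Rightarrow> real"
    assume s: "\<And>i. s i \<in> C" and cover: "\<And>x. 1 \<le> (\<Sum>i. ennreal (s i x))"
    \<comment> \<open>the part of the constant one that the first \<open>N\<close> functions leave uncovered\<close>
    define h where "h N x = max 0 (1 - (\<Sum>i<N. s i x))" for N x
    have hC: "h N \<in> C" for N
      unfolding C_def h_def[abs_def] using unit_lip_one_minus_sum[of s N] s by (simp add: C_def)
    have h_lim: "(\<lambda>N. h N x) \<longlonglongrightarrow> 0" for x
    proof (rule LIMSEQ_I)
      fix r :: real assume r: "0 < r"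
      have "ennreal (1 - r) < (\<Sum>i. ennreal (s i x))"
      proof (rule less_le_trans[OF _ cover])
        show "ennreal (1 - r) < 1" using r by (simp add: ennreal_less_one_iff)
      qed
      then obtain N where "ennreal (1 - r) < (\<Sum>i<N. ennreal (s i x))"
        unfolding suminf_eq_SUP by (auto simp: less_SUP_iff)
      also have "\<dots> = ennreal (\<Sum>i<N. s i x)" using unit[OF s] by (intro sum_ennreal) auto
      finally have N: "1 - r < (\<Sum>i<N. s i x)"
      proof (cases "0 \<le> 1 - r")
        case True
        assume "ennreal (1 - r) < ennreal (\<Sum>i<N. s i x)"
        then show ?thesis using True by (simp add: ennreal_less_iff)
      next
        case False
        have "0 \<le> (\<Sum>i<N. s i x)" using unit[OF s] by (intro sum_nonneg) auto
        then show ?thesis using False by linarith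
      qed
      have "(\<Sum>i<N. s i x) \<le> (\<Sum>i<k. s i x)" if "k \<ge> N" for k
        using that unit[OF s] by (intro sum_mono2) auto
      then show "\<exists>N. \<forall>k\<ge>N. norm (h k x - 0) < r"
        using N r by (intro exI[of _ N]) (fastforce simp: h_def)
    qed
    show "1 \<le> (\<Sum>i. ennreal (\<Lambda> (s i)))"
    proof (rule ennreal_le_epsilon)
      fix e :: real assume e: "0 < e"
      obtain F where F: "\<And>k. finite (F k)" "\<And>k. F k \<noteq> {}"
        and F\<Lambda>: "\<And>k. \<Lambda> (\<lambda>x. off (F k) k x) \<le> e / 4 * (1/2) ^ Suc k"
        using net[of "e / 4 * (1/2) ^ Suc k" k for k] e by (metis divide_pos_pos half_gt_zero mult_pos_pos zero_less_numeral zero_less_power zero_less_one)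
      let ?\<phi> = "\<lambda>k x. off (F k) k x"
      have "\<exists>N. \<forall>x. h N x \<le> e / 4 + 2 * (\<Sum>k<N. ?\<phi> k x)"
      proof (rule dini_with_finite_nets)
        show "continuous_on UNIV (h n)" for n using hC[of n] unit_lip_continuous by (auto simp: C_def)
        show "h n x \<le> 1" for n x using unit[OF hC] by blast
        show "h (Suc n) x \<le> h n x" for n x
          unfolding h_def using unit[OF s, of n x] by (intro max.mono) auto
      qed (use h_lim F e in auto)
      then obtain N where N: "\<And>x. h N x \<le> e / 4 + 2 * (\<Sum>k<N. ?\<phi> k x)" by blast
      have \<phi>C: "?\<phi> k \<in> C" for k by (rule CI[OF \<phi>_lip])
      have "1 \<le> (\<Sum>i<N. \<Lambda> (s i)) + (e / 4 + 2 * (\<Sum>k<N. \<Lambda> (?\<phi> k)))"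
      proof (rule LIMSEQ_le_const)
        show "(\<lambda>n. (\<Sum>i<N. \<integral>x. s i x \<partial>m n) + (e / 4 + 2 * (\<Sum>k<N. \<integral>x. ?\<phi> k x \<partial>m n)))
            \<longlonglongrightarrow> (\<Sum>i<N. \<Lambda> (s i)) + (e / 4 + 2 * (\<Sum>k<N. \<Lambda> (?\<phi> k)))"
          by (intro tendsto_intros conv s \<phi>C)
        have "1 \<le> (\<Sum>i<N. \<integral>x. s i x \<partial>m n) + (e / 4 + 2 * (\<Sum>k<N. \<integral>x. ?\<phi> k x \<partial>m n))" for n
        proof -
          interpret mn: prob_space "m n" by (rule prob)
          have "1 = (\<integral>x. (1 :: real) \<partial>m n)" using mn.prob_space by simp
          also have "\<dots> \<le> (\<integral>x. (\<Sum>i<N. s i x) + (e / 4 + 2 * (\<Sum>k<N. ?\<phi> k x)) \<partial>m n)"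
          proof (rule integral_mono)
            show "1 \<le> (\<Sum>i<N. s i x) + (e / 4 + 2 * (\<Sum>k<N. ?\<phi> k x))" for x
              using N[of x] unfolding h_def by linarith
          qed (auto intro!: Bochner_Integration.integrable_add Bochner_Integration.integrable_sum
                integrable_mult_right int[OF s] int[OF \<phi>C])
          also have "\<dots> = (\<Sum>i<N. \<integral>x. s i x \<partial>m n) + (e / 4 + 2 * (\<Sum>k<N. \<integral>x. ?\<phi> k x \<partial>m n))"
            using mn.prob_space
            by (simp add: int s \<phi>C Bochner_Integration.integrable_add Bochner_Integration.integrable_sum integrable_mult_right
                Bochner_Integration.integral_add Bochner_Integration.integral_sum del: min_less_iff_conj)
          finally show ?thesis .
        qed
        then show "\<exists>M. \<forall>n\<ge>M. 1 \<le> (\<Sum>i<N. \<integral>x. s i x \<partial>m n) + (e / 4 + 2 * (\<Sum>k<N. \<integral>x. ?\<phi> k x \<partial>m n))"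
          by blast
      qed
      also have "(\<Sum>k<N. \<Lambda> (?\<phi> k)) \<le> (\<Sum>k<N. e / 4 * (1/2) ^ Suc k)" by (intro sum_mono F\<Lambda>)
      also have "\<dots> \<le> e / 4"
      proof -
        have *: "(\<lambda>k. e / 4 * (1/2) ^ Suc k) sums (e / 4 * 1)" by (intro sums_mult power_half_series)
        have "(\<Sum>k<N. e / 4 * (1/2) ^ Suc k) \<le> (\<Sum>k. e / 4 * (1/2) ^ Suc k)"
          using e by (intro sum_le_suminf sums_summable[OF *]) auto
        then show ?thesis using sums_unique[OF *] by simp
      qed
      finally have *: "1 \<le> (\<Sum>i<N. \<Lambda> (s i)) + e" using e by simp
      have \<Lambda>0: "0 \<le> \<Lambda> (s i)" for i
        using unit[OF s] by (intro LIMSEQ_le_const[OF conv[OF s]]) (auto intro!: integral_nonneg)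
      have "1 \<le> ennreal ((\<Sum>i<N. \<Lambda> (s i)) + e)" using * by simp
      also have "\<dots> = (\<Sum>i<N. ennreal (\<Lambda> (s i))) + ennreal e"
        using \<Lambda>0 e by (simp add: sum_nonneg)
      also have "\<dots> \<le> (\<Sum>i. ennreal (\<Lambda> (s i))) + ennreal e"
        by (intro add_right_mono sum_le_suminf) auto
      finally show "1 \<le> (\<Sum>i. ennreal (\<Lambda> (s i))) + ennreal e" .
    qed
  qed
  then obtain \<mu> where "prob_space \<mu>" "sets \<mu> = sets borel" "\<And>f. f \<in> C \<Longrightarrow> (\<integral>x. f x \<partial>\<mu>) = \<Lambda> f"
    using daniell_functional.representing_measure by metis
  then show ?thesis using conv CI by metis
qed

end

section \<open>Kernels that contract a cost\<close>

lemma invariant_prob_iff_bind: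
  fixes P :: "'a :: topological_space \<Rightarrow> 'a measure"
  assumes P: "P \<in> borel \<rightarrow>\<^sub>M prob_algebra borel"
  shows "invariant_prob P \<mu> \<longleftrightarrow>
    prob_space \<mu> \<and> sets \<mu> = sets borel \<and> bind \<mu> P = \<mu>"
proof -
  have "(\<forall>A\<in>sets borel. (\<integral>\<^sup>+u. emeasure (P u) A \<partial>\<mu>) = emeasure \<mu> A) \<longleftrightarrow> bind \<mu> P = \<mu>"
    if \<mu>: "prob_space \<mu>" "sets \<mu> = sets borel"
  proof -
    have sp: "\<mu> \<in> space (prob_algebra borel)" using \<mu> by (simp add: space_prob_algebra)
    have "emeasure (bind \<mu> P) A = (\<integral>\<^sup>+u. emeasure (P u) A \<partial>\<mu>)" if "A \<in> sets borel" for A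
      using emeasure_bind_prob_algebra[OF sp P that] .
    then show ?thesis
      using sets_bind'[OF sp P] \<mu> by (auto intro!: measure_eqI)
  qed
  then show ?thesis by (auto simp: invariant_prob_def)
qed

text \<open>The averages \<open>(T ^^ n) f\<close> are Lipschitz for the cost with constant \<open>\<alpha> ^ n * M\<close>. Hence they tend to
  a constant, the integral of \<open>f\<close> with respect to every invariant probability measure. The drift bounds
  the integrals of \<open>V\<close>, and thus of \<open>D x0\<close>, along the orbit of a point mass, which makes this orbit
  Cauchy. Its limit is invariant because \<open>T f\<close> is again Lipschitz for the cost.\<close>

theorem (in cost) contracting_kernel_unique_invariant:
  fixes P :: "'a \<Rightarrow> 'a measure" and V :: "'a \<Rightarrow> real"
  assumes P: "P \<in> borel \<rightarrow>\<^sub>M prob_algebra borel"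
    and \<alpha>: "0 \<le> \<alpha>" "\<alpha> < 1"
    and contraction: "\<And>f M x y. unit_lip D M f \<Longrightarrow>
        \<bar>(\<integral>z. f z \<partial>P x) - (\<integral>z. f z \<partial>P y)\<bar> \<le> \<alpha> * M * D x y"
    and V: "V \<in> borel_measurable borel" "\<And>x. 0 \<le> V x"
    and l: "0 \<le> l" "l < 1" and c: "0 \<le> c"
    and lyapunov: "\<And>x. (\<integral>\<^sup>+z. ennreal (V z) \<partial>P x) \<le> ennreal (l * V x + c)"
    and D_le: "\<And>x y. D x y \<le> 1 + V x + V y"
  shows "\<exists>!\<mu>. invariant_prob P \<mu>"
proof -
  have Ps: "P \<in> borel \<rightarrow>\<^sub>M subprob_algebra borel" by (rule measurable_prob_algebraD[OF P])
  have Px: "prob_space (P x)" "sets (P x) = sets borel" for x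
    using measurable_space[OF P, of x] by (auto simp: space_prob_algebra)
  define T where "T f x = (\<integral>z. f z \<partial>P x)" for f :: "'a \<Rightarrow> real" and x
  have T_unit: "0 \<le> T f x \<and> T f x \<le> 1" if "unit_lip D M f" for f M x
  proof -
    interpret Px: prob_space "P x" by (rule Px)
    have "f \<in> borel_measurable (P x)"
      using unit_lip_measurable[OF that] measurable_cong_sets[OF Px(2) refl] by blast
    then have "integrable (P x) f"
      using that by (intro Px.integrable_const_bound[where B=1]) (auto simp: unit_lip_def)
    then show ?thesis
      using that unfolding T_def unit_lip_def
      by (auto intro!: Px.integral_le_const integral_nonneg)
  qed
  have T_lip: "unit_lip D (\<alpha> * M) (T f)" if "unit_lip D M f" for f M
    using that T_unit[OF that] contraction[OF that] \<alpha> by (simp add: unit_lip_def T_def)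
  have Tn_lip: "unit_lip D (\<alpha> ^ n * M) ((T ^^ n) f)" if "unit_lip D M f" for f M n
    by (induction n) (use that T_lip in \<open>auto simp: mult.assoc\<close>)
  have bind_int: "(\<integral>x. f x \<partial>bind \<mu> P) = (\<integral>x. T f x \<partial>\<mu>)"
    if "unit_lip D M f" "prob_space \<mu>" "sets \<mu> = sets borel" for f M \<mu>
    unfolding T_def
  proof (rule integral_bind[where K=borel and B=1 and B'=1])
    show "f \<in> borel_measurable borel" by (rule unit_lip_measurable[OF that(1)])
    show "P \<in> \<mu> \<rightarrow>\<^sub>M subprob_algebra borel" using Ps measurable_cong_sets[OF that(3) refl] by blast
    show "finite_measure \<mu>" by (rule prob_space.finite_measure) fact
    show "AE x in \<mu>. emeasure (P x) (space (P x)) \<le> ennreal 1"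
      using prob_space.emeasure_space_1[OF Px(1)] by simp
  qed (use that in \<open>auto simp: unit_lip_def\<close>)
  fix x0 :: 'a
  define m where "m n = ((\<lambda>\<mu>. bind \<mu> P) ^^ n) (return borel x0)" for n
  have m_0: "m 0 = return borel x0" and m_Suc: "m (Suc n) = bind (m n) P" for n
    by (simp_all add: m_def)
  have m_space: "m n \<in> space (prob_algebra borel)" for n
  proof (induction n)
    case 0 show ?case by (simp add: m_0 space_prob_algebra prob_space_return)
  next
    case (Suc n)
    then show ?case using prob_space_bind'[OF Suc P] sets_bind'[OF Suc P]
      by (simp add: m_Suc space_prob_algebra)
  qed
  then have m_prob: "prob_space (m n)" and m_sets: "sets (m n) = sets borel" for n
    by (simp_all add: space_prob_algebra)
  have m_int: "(\<integral>x. f x \<partial>m (j + n)) = (\<integral>x. (T ^^ n) f x \<partial>m j)" if "unit_lip D M f" for f M j n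
    using that
  proof (induction n arbitrary: f M)
    case (Suc n)
    have "(\<integral>x. f x \<partial>m (j + Suc n)) = (\<integral>x. T f x \<partial>m (j + n))"
      using bind_int[OF Suc.prems m_prob m_sets] by (simp add: m_Suc)
    also have "\<dots> = (\<integral>x. (T ^^ n) (T f) x \<partial>m j)" by (rule Suc.IH[OF T_lip[OF Suc.prems]])
    finally show ?case by (simp add: funpow_swap1)
  qed simp
  define b where "b = V x0 + c / (1 - l)"
  have b: "0 \<le> b" "l * b + c \<le> b"
  proof -
    show "0 \<le> b" using V(2)[of x0] l c by (simp add: b_def)
    have "(1 - l) * b = (1 - l) * V x0 + c" using l by (simp add: b_def distrib_left)
    moreover have "0 \<le> (1 - l) * V x0" using V(2)[of x0] l by simp
    moreover have "(1 - l) * b = b - l * b" by (rule left_diff_distrib[of 1 l b, simplified])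
    ultimately show "l * b + c \<le> b" by linarith
  qed
  have m_V: "(\<integral>\<^sup>+x. ennreal (V x) \<partial>m n) \<le> ennreal b" for n
  proof (induction n)
    case 0
    have "V x0 \<le> b" using l c by (simp add: b_def)
    then show ?case using V by (simp add: m_0 nn_integral_return ennreal_leI)
  next
    case (Suc n)
    interpret mn: prob_space "m n" by (rule m_prob)
    have [measurable]: "V \<in> borel_measurable (m n)"
      using V(1) measurable_cong_sets[OF m_sets refl] by blast
    have "(\<integral>\<^sup>+x. ennreal (V x) \<partial>m (Suc n)) = (\<integral>\<^sup>+x. \<integral>\<^sup>+z. ennreal (V z) \<partial>P x \<partial>m n)"
      unfolding m_Suc using V(1) Ps measurable_cong_sets[OF m_sets refl]
      by (intro nn_integral_bind[where B=borel]) auto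
    also have "\<dots> \<le> (\<integral>\<^sup>+x. ennreal l * ennreal (V x) + ennreal c \<partial>m n)"
      using lyapunov V(2) l c by (intro nn_integral_mono) (simp add: ennreal_mult ennreal_plus)
    also have "\<dots> = ennreal l * (\<integral>\<^sup>+x. ennreal (V x) \<partial>m n) + ennreal c"
      by (simp add: nn_integral_add nn_integral_cmult mn.emeasure_space_1)
    also have "\<dots> \<le> ennreal l * ennreal b + ennreal c"
      by (intro add_right_mono mult_left_mono Suc.IH) auto
    also have "\<dots> = ennreal (l * b + c)" using l b c by (simp add: ennreal_mult)
    also have "\<dots> \<le> ennreal b" by (rule ennreal_leI[OF b(2)])
    finally show ?case .
  qed
  have V_int: "integrable (m n) V" "(\<integral>x. V x \<partial>m n) \<le> b" for n
  proof -
    have [measurable]: "V \<in> borel_measurable (m n)"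
      using V(1) measurable_cong_sets[OF m_sets refl] by blast
    show "integrable (m n) V"
      using m_V[of n] V(2) by (intro integrableI_nonneg) (auto simp: le_less_trans)
    show "(\<integral>x. V x \<partial>m n) \<le> b"
      using m_V[of n] V(2) b(1) by (subst integral_eq_nn_integral) (auto simp: enn2real_leI)
  qed
  define B where "B = 1 + V x0 + b"
  have cauchy: "\<bar>(\<integral>x. f x \<partial>m n) - (\<integral>x. f x \<partial>m k)\<bar> \<le> M * (B * \<alpha> ^ n)"
    if f: "unit_lip D M f" and nk: "n \<le> k" for f M n k
  proof -
    obtain j where k: "k = j + n" using nk by (metis le_iff_add add.commute)
    interpret mj: prob_space "m j" by (rule m_prob)
    let ?g = "(T ^^ n) f"
    have g: "unit_lip D (\<alpha> ^ n * M) ?g" by (rule Tn_lip[OF f])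
    have gm: "?g \<in> borel_measurable borel" by (rule unit_lip_measurable[OF g])
    have gi: "integrable (m j) ?g"
      using g gm measurable_cong_sets[OF m_sets[of j] refl]
      by (intro mj.integrable_const_bound[where B=1]) (auto simp: unit_lip_def)
    have "(\<integral>x. f x \<partial>m n) = ?g x0"
      using m_int[OF f, of 0 n] gm by (simp add: m_0 integral_return)
    then have "\<bar>(\<integral>x. f x \<partial>m n) - (\<integral>x. f x \<partial>m k)\<bar> = \<bar>\<integral>x. ?g x0 - ?g x \<partial>m j\<bar>"
      using m_int[OF f, of j n] gi by (simp add: k mj.prob_space)
    also have "\<dots> \<le> (\<integral>x. \<alpha> ^ n * M * (1 + V x0 + V x) \<partial>m j)"
    proof (rule order_trans[OF integral_abs_bound integral_mono])
      show "integrable (m j) (\<lambda>x. \<bar>?g x0 - ?g x\<bar>)" using gi by simp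
      show "integrable (m j) (\<lambda>x. \<alpha> ^ n * M * (1 + V x0 + V x))" using V_int(1) by simp
      fix x
      have "\<bar>?g x0 - ?g x\<bar> \<le> \<alpha> ^ n * M * D x0 x" using g by (simp add: unit_lip_def)
      also have "\<dots> \<le> \<alpha> ^ n * M * (1 + V x0 + V x)"
        using f \<alpha>(1) by (intro mult_left_mono[OF D_le]) (simp add: unit_lip_def)
      finally show "\<bar>?g x0 - ?g x\<bar> \<le> \<alpha> ^ n * M * (1 + V x0 + V x)" .
    qed
    also have "\<dots> = \<alpha> ^ n * M * (1 + V x0 + (\<integral>x. V x \<partial>m j))"
      using V_int(1)[of j] by (simp add: mj.prob_space)
    also have "\<dots> \<le> \<alpha> ^ n * M * B"
      using V_int(2)[of j] f \<alpha> unfolding B_def by (intro mult_left_mono) (simp_all add: unit_lip_def)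
    finally show ?thesis by (simp add: mult_ac)
  qed
  have \<alpha>n: "(\<lambda>n. \<alpha> ^ n) \<longlonglongrightarrow> 0" using \<alpha> by (intro LIMSEQ_realpow_zero)
  then have "(\<lambda>n. B * \<alpha> ^ n) \<longlonglongrightarrow> 0" using tendsto_mult_left[of _ 0 _ B] by simp
  from limit_measure_exists[OF m_prob m_sets this cauchy]
  obtain \<mu> where \<mu>: "prob_space \<mu>" "sets \<mu> = sets borel"
    and \<mu>_lim: "\<And>f M. unit_lip D M f \<Longrightarrow> (\<lambda>n. \<integral>x. f x \<partial>m n) \<longlonglongrightarrow> (\<integral>x. f x \<partial>\<mu>)"
    by blast
  have bump_lip: "unit_lip D (max 1 (real n) * c0) (bump F n)" for F n
    by (rule unit_lip_lipschitz[OF _ bump_lipschitz]) (simp add: bump_nonneg bump_le_1)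
  have "bind \<mu> P = \<mu>"
  proof (rule prob_measure_eqI_bump)
    have "\<mu> \<in> space (prob_algebra borel)" using \<mu> by (simp add: space_prob_algebra)
    then show "prob_space (bind \<mu> P)" "sets (bind \<mu> P) = sets borel"
      by (rule prob_space_bind'[OF _ P], rule sets_bind'[OF _ P])
    fix F :: "'a set" and n
    let ?f = "bump F n"
    have "(\<integral>x. ?f x \<partial>bind \<mu> P) = (\<integral>x. T ?f x \<partial>\<mu>)" by (rule bind_int[OF bump_lip \<mu>])
    also have "\<dots> = (\<integral>x. ?f x \<partial>\<mu>)"
    proof (rule LIMSEQ_unique[OF \<mu>_lim[OF T_lip[OF bump_lip]]])
      have "(\<integral>x. T ?f x \<partial>m n) = (\<integral>x. ?f x \<partial>m (Suc n))" for n
        using bind_int[OF bump_lip m_prob m_sets] by (simp add: m_Suc)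
      then show "(\<lambda>n. \<integral>x. T ?f x \<partial>m n) \<longlonglongrightarrow> (\<integral>x. ?f x \<partial>\<mu>)"
        using LIMSEQ_Suc[OF \<mu>_lim[OF bump_lip]] by simp
    qed
    finally show "(\<integral>x. ?f x \<partial>bind \<mu> P) = (\<integral>x. ?f x \<partial>\<mu>)" .
  qed (use \<mu> in auto)
  then have inv: "invariant_prob P \<mu>" using \<mu> by (simp add: invariant_prob_iff_bind[OF P])
  have inv_lim: "(\<lambda>n. (T ^^ n) f x0) \<longlonglongrightarrow> (\<integral>x. f x \<partial>\<nu>)"
    if \<nu>: "invariant_prob P \<nu>" and f: "unit_lip D M f" for \<nu> f M
  proof -
    have \<nu>': "prob_space \<nu>" "sets \<nu> = sets borel" "bind \<nu> P = \<nu>"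
      using \<nu> by (auto simp: invariant_prob_iff_bind[OF P])
    interpret \<nu>: prob_space \<nu> by fact
    have m: "(T ^^ n) f \<in> borel_measurable \<nu>" for n
      using unit_lip_measurable[OF Tn_lip[OF f]] measurable_cong_sets[OF \<nu>'(2) refl] by blast
    have unit: "0 \<le> (T ^^ n) f x \<and> (T ^^ n) f x \<le> 1" for n x
      using Tn_lip[OF f, of n] by (simp add: unit_lip_def)
    have const: "(\<integral>x. (T ^^ n) f x \<partial>\<nu>) = (\<integral>x. f x \<partial>\<nu>)" for n
    proof (induction n)
      case (Suc n)
      show ?case using bind_int[OF Tn_lip[OF f] \<nu>'(1,2), of n] Suc by (simp add: \<nu>'(3))
    qed simp
    have "(\<lambda>n. \<integral>x. (T ^^ n) f x - (T ^^ n) f x0 \<partial>\<nu>) \<longlonglongrightarrow> (\<integral>x. 0 \<partial>\<nu>)"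
    proof (rule integral_dominated_convergence[where w="\<lambda>_. 1"])
      show "AE x in \<nu>. (\<lambda>n. (T ^^ n) f x - (T ^^ n) f x0) \<longlonglongrightarrow> 0"
      proof (rule AE_I2)
        fix x
        have le: "norm ((T ^^ n) f x - (T ^^ n) f x0) \<le> \<alpha> ^ n * (M * D x x0)" for n
          using Tn_lip[OF f, of n] by (simp add: unit_lip_def mult.assoc)
        have "(\<lambda>n. \<alpha> ^ n * (M * D x x0)) \<longlonglongrightarrow> 0"
          using tendsto_mult_right[OF \<alpha>n, of "M * D x x0"] by simp
        then show "(\<lambda>n. (T ^^ n) f x - (T ^^ n) f x0) \<longlonglongrightarrow> 0"
          by (rule Lim_null_comparison[OF always_eventually[OF allI[OF le]]])
      qed
      show "AE x in \<nu>. norm ((T ^^ n) f x - (T ^^ n) f x0) \<le> 1" for n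
      proof (rule AE_I2)
        fix x show "norm ((T ^^ n) f x - (T ^^ n) f x0) \<le> 1"
          using unit[of n x] unit[of n x0] by (simp add: abs_le_iff)
      qed
    qed (use m in auto)
    moreover have "(\<integral>x. (T ^^ n) f x - (T ^^ n) f x0 \<partial>\<nu>) = (\<integral>x. f x \<partial>\<nu>) - (T ^^ n) f x0" for n
    proof -
      have "integrable \<nu> ((T ^^ n) f)"
        using unit m by (intro \<nu>.integrable_const_bound[where B=1]) auto
      then show ?thesis by (simp add: \<nu>.prob_space const)
    qed
    ultimately have "(\<lambda>n. (\<integral>x. f x \<partial>\<nu>) - (T ^^ n) f x0) \<longlonglongrightarrow> 0" by simp
    from tendsto_diff[OF tendsto_const[of "\<integral>x. f x \<partial>\<nu>"] this] show ?thesis by simp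
  qed
  show ?thesis
  proof (rule ex1I[where a=\<mu>])
    show "invariant_prob P \<mu>" by (rule inv)
    fix \<nu> assume \<nu>: "invariant_prob P \<nu>"
    show "\<nu> = \<mu>"
    proof (rule prob_measure_eqI_bump)
      show "(\<integral>x. bump F n x \<partial>\<nu>) = (\<integral>x. bump F n x \<partial>\<mu>)" for F :: "'a set" and n
        by (rule LIMSEQ_unique[OF inv_lim[OF \<nu> bump_lip] inv_lim[OF inv bump_lip]])
    qed (use \<nu> \<mu> in \<open>auto simp: invariant_prob_def\<close>)
  qed
qed

section \<open>One step of the algorithm\<close>

locale rcar_mh =
  fixes \<Psi> :: "'a :: {banach, second_countable_topology} \<Rightarrow> real"
    and K :: "'a \<Rightarrow> 'a measure" and lam :: "'a measure"
  assumes \<Psi>_measurable [measurable]: "\<Psi> \<in> borel_measurable borel"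
    and kernel_K: "K \<in> borel \<rightarrow>\<^sub>M prob_algebra borel"
    and prob_lam: "prob_space lam" and sets_lam [measurable_cong]: "sets lam = sets borel"
begin

abbreviation accept :: "'a \<Rightarrow> 'a \<Rightarrow> real" where "accept \<equiv> mh_accept \<Psi>"

abbreviation P :: "'a \<Rightarrow> 'a measure" where "P \<equiv> rcar_mh_kernel \<Psi> K lam"

text \<open>The conditional expectation of \<open>f\<close> at the next state, given the proposal \<open>w\<close>.\<close>

definition move :: "'a \<Rightarrow> ('a \<Rightarrow> real) \<Rightarrow> 'a \<Rightarrow> real" where
  "move u f w = accept u w * f w + (1 - accept u w) * f u"

lemma accept_unit: "0 \<le> accept u w" "accept u w \<le> 1"
  by (auto simp: mh_accept_def)

lemma accept_measurable [measurable]: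
  "(\<lambda>(u, w). accept u w) \<in> borel_measurable (borel \<Otimes>\<^sub>M borel)" "accept u \<in> borel_measurable borel"
  unfolding mh_accept_def[abs_def] by measurable

lemma accept_measurable' [measurable (raw)]:
  "f \<in> borel_measurable M \<Longrightarrow> (\<lambda>x. accept u (f x)) \<in> borel_measurable M"
  by (rule measurable_compose[OF _ accept_measurable(2)])

lemma prob_K: "prob_space (K u)" and sets_K [measurable_cong, simp]: "sets (K u) = sets borel"
  using measurable_space[OF kernel_K, of u] by (auto simp: space_prob_algebra)

lemma move_nonneg: "(\<And>x. 0 \<le> f x) \<Longrightarrow> 0 \<le> move u f w"
  using accept_unit[of u w] by (simp add: move_def)

lemma move_le_1: assumes "\<And>x. f x \<le> 1" shows "move u f w \<le> 1"
proof -
  have "move u f w \<le> accept u w * 1 + (1 - accept u w) * 1"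
    unfolding move_def using accept_unit[of u w] assms by (intro add_mono mult_left_mono) auto
  then show ?thesis by simp
qed

lemma move_measurable [measurable (raw)]:
  assumes [measurable]: "f \<in> borel_measurable borel" "g \<in> borel_measurable M"
  shows "(\<lambda>x. move u f (g x)) \<in> borel_measurable M"
  unfolding move_def by measurable

lemma kernel_proposal: "rcar_proposal K lam \<in> borel \<rightarrow>\<^sub>M prob_algebra borel"
proof -
  have "lam \<in> space (prob_algebra borel)" using prob_lam sets_lam by (simp add: space_prob_algebra)
  then have "(\<lambda>u. K u \<Otimes>\<^sub>M lam) \<in> borel \<rightarrow>\<^sub>M prob_algebra (borel \<Otimes>\<^sub>M borel)"
    by (intro measurable_pair_prob kernel_K) simp
  then have "(\<lambda>u. distr (K u \<Otimes>\<^sub>M lam) borel (\<lambda>(x, y). x + y)) \<in> borel \<rightarrow>\<^sub>M prob_algebra borel"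
    by (rule measurable_distr_prob_space2) measurable
  then show ?thesis by (simp add: rcar_proposal_def[abs_def] conv_law_def)
qed

lemma nn_integral_proposal:
  "g \<in> borel_measurable borel \<Longrightarrow>
    (\<integral>\<^sup>+w. g w \<partial>rcar_proposal K lam u) = (\<integral>\<^sup>+(z, \<xi>). g (z + \<xi>) \<partial>(K u \<Otimes>\<^sub>M lam))"
  unfolding rcar_proposal_def conv_law_def
  by (subst nn_integral_distr) (auto simp: case_prod_unfold)

lemma kernel_P: "P \<in> borel \<rightarrow>\<^sub>M prob_algebra borel"
proof (rule measurable_prob_algebraI)
  show "prob_space (P u)" for u
    by (rule prob_space_rcar_mh_kernel) (auto simp: markov_kernel_def kernel_K prob_lam sets_lam)
  note Q [measurable] = measurable_prob_algebraD[OF kernel_proposal]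
  show "P \<in> borel \<rightarrow>\<^sub>M subprob_algebra borel"
  proof (rule measurable_subprob_algebra)
    show "subprob_space (P u)" for u
      using \<open>prob_space (P u)\<close> by (rule prob_space_imp_subprob_space)
    fix A :: "'a set" assume A [measurable]: "A \<in> sets borel"
    show "(\<lambda>u. emeasure (P u) A) \<in> borel_measurable borel"
      unfolding emeasure_rcar_mh_kernel[OF \<Psi>_measurable A]
    proof (intro borel_measurable_add borel_measurable_times_ennreal)
      show "(\<lambda>u. \<integral>\<^sup>+v. ennreal (accept u v) * indicator A v \<partial>rcar_proposal K lam u) \<in> borel_measurable borel"
        by (rule nn_integral_measurable_subprob_algebra2[OF _ Q]) measurable
      show "(\<lambda>u. \<integral>\<^sup>+v. ennreal (1 - accept u v) \<partial>rcar_proposal K lam u) \<in> borel_measurable borel"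
        by (rule nn_integral_measurable_subprob_algebra2[OF _ Q]) measurable
    qed measurable
  qed simp
qed

lemma nn_integral_P:
  assumes "g \<in> borel_measurable borel"
  shows "(\<integral>\<^sup>+w. g w \<partial>P u) = (\<integral>\<^sup>+w. ennreal (accept u w) * g w + ennreal (1 - accept u w) * g u \<partial>rcar_proposal K lam u)"
proof -
  let ?Q = "rcar_proposal K lam u"
  let ?c = "\<integral>\<^sup>+w. ennreal (1 - accept u w) \<partial>?Q"
  have [measurable_cong]: "sets (P u) = sets borel" by simp
  have "(\<integral>\<^sup>+w. g w \<partial>P u) = (\<integral>\<^sup>+w. ennreal (accept u w) * g w \<partial>?Q) + ?c * g u"
    using assms
  proof (induction rule: borel_measurable_induct)
    case (cong f g)
    then have "f = g" by (simp add: fun_eq_iff)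
    with cong show ?case by simp
  next
    case (set A)
    then show ?case
      by (simp add: emeasure_rcar_mh_kernel[OF \<Psi>_measurable] mult.commute)
  next
    case (mult f c)
    note [measurable] = mult.hyps(2)
    have "(\<integral>\<^sup>+w. c * f w \<partial>P u) = c * (\<integral>\<^sup>+w. f w \<partial>P u)" by (rule nn_integral_cmult) simp
    also have "\<dots> = c * (\<integral>\<^sup>+w. ennreal (accept u w) * f w \<partial>?Q) + ?c * (c * f u)"
      by (simp add: mult.IH distrib_left mult_ac)
    also have "c * (\<integral>\<^sup>+w. ennreal (accept u w) * f w \<partial>?Q) = (\<integral>\<^sup>+w. ennreal (accept u w) * (c * f w) \<partial>?Q)"
      by (subst nn_integral_cmult[symmetric]) (simp_all add: mult_ac)
    finally show ?case .
  next
    case (add f g)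
    note [measurable] = add.hyps(1,3)
    show ?case using add.IH by (simp add: nn_integral_add distrib_left add_ac)
  next
    case (seq U)
    note [measurable] = seq.hyps(1)
    have "(\<integral>\<^sup>+w. (SUP i. U i) w \<partial>P u) = (SUP i. \<integral>\<^sup>+w. U i w \<partial>P u)"
      unfolding SUP_apply using seq.hyps(3) by (intro nn_integral_monotone_convergence_SUP) auto
    also have "\<dots> = (SUP i. (\<integral>\<^sup>+w. ennreal (accept u w) * U i w \<partial>?Q) + ?c * U i u)"
      by (simp add: seq.IH)
    also have "\<dots> = (SUP i. \<integral>\<^sup>+w. ennreal (accept u w) * U i w \<partial>?Q) + (SUP i. ?c * U i u)"
      using seq.hyps(3)
      by (intro ennreal_SUP_add) (auto simp: incseq_def le_fun_def intro!: nn_integral_mono mult_left_mono)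
    also have "(SUP i. \<integral>\<^sup>+w. ennreal (accept u w) * U i w \<partial>?Q) = (\<integral>\<^sup>+w. (SUP i. ennreal (accept u w) * U i w) \<partial>?Q)"
      using seq.hyps(3)
      by (intro nn_integral_monotone_convergence_SUP[symmetric]) (auto simp: incseq_def le_fun_def intro!: mult_left_mono)
    finally show ?case by (simp add: SUP_mult_left_ennreal image_comp)
  qed
  also have "\<dots> = (\<integral>\<^sup>+w. ennreal (accept u w) * g w + ennreal (1 - accept u w) * g u \<partial>?Q)"
    using assms by (subst nn_integral_add) (auto simp: nn_integral_multc)
  finally show ?thesis .
qed

lemma nn_integral_P_move:
  assumes [measurable]: "f \<in> borel_measurable borel" and f: "\<And>x. 0 \<le> f x"
  shows "(\<integral>\<^sup>+w. ennreal (f w) \<partial>P u) = (\<integral>\<^sup>+(z, \<xi>). ennreal (move u f (z + \<xi>)) \<partial>(K u \<Otimes>\<^sub>M lam))"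
proof -
  have "ennreal (accept u w) * ennreal (f w) + ennreal (1 - accept u w) * ennreal (f u) = ennreal (move u f w)" for w
    using accept_unit[of u w] f by (simp add: move_def ennreal_mult[symmetric] ennreal_plus[symmetric] del: ennreal_plus)
  then show ?thesis by (simp add: nn_integral_P nn_integral_proposal)
qed

text \<open>The two chains are realised on triples \<open>((z, z'), \<xi>)\<close> of a coupled pair of contractions and one
  innovation, which both chains share.\<close>

definition proposal1 :: "('a \<times> 'a) \<times> 'a \<Rightarrow> 'a" where "proposal1 w = fst (fst w) + snd w"

definition proposal2 :: "('a \<times> 'a) \<times> 'a \<Rightarrow> 'a" where "proposal2 w = snd (fst w) + snd w"

lemma proposal_measurable:
  "proposal1 \<in> (borel \<Otimes>\<^sub>M borel) \<Otimes>\<^sub>M borel \<rightarrow>\<^sub>M borel" "proposal2 \<in> (borel \<Otimes>\<^sub>M borel) \<Otimes>\<^sub>M borel \<rightarrow>\<^sub>M borel"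
  unfolding proposal1_def[abs_def] proposal2_def[abs_def] by measurable

lemma coupling_sets: "is_coupling W (K u) (K v) \<Longrightarrow> sets (W \<Otimes>\<^sub>M lam) = sets ((borel \<Otimes>\<^sub>M borel) \<Otimes>\<^sub>M borel)"
  by (intro sets_pair_measure_cong sets_lam) (simp add: is_coupling_def)

lemma coupling_prob: "is_coupling W (K u) (K v) \<Longrightarrow> prob_space W"
  using prob_K[of u] by (intro prob_space_distrD[of fst W borel])
    (auto simp: is_coupling_def cong: measurable_cong_sets)

lemma prob_space_coupled: "is_coupling W (K u) (K v) \<Longrightarrow> prob_space (W \<Otimes>\<^sub>M lam)"
  by (intro prob_space_pair coupling_prob prob_lam)

lemma nn_integral_coupled:
  assumes W: "is_coupling W (K u) (K v)" and [measurable]: "h \<in> borel_measurable (borel \<Otimes>\<^sub>M borel)"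
  shows "(\<integral>\<^sup>+w. h w \<partial>(K u \<Otimes>\<^sub>M lam)) = (\<integral>\<^sup>+w. h (fst (fst w), snd w) \<partial>(W \<Otimes>\<^sub>M lam))"
    and "(\<integral>\<^sup>+w. h w \<partial>(K v \<Otimes>\<^sub>M lam)) = (\<integral>\<^sup>+w. h (snd (fst w), snd w) \<partial>(W \<Otimes>\<^sub>M lam))"
proof -
  interpret lam: prob_space lam by (rule prob_lam)
  have sW [measurable_cong]: "sets W = sets (borel \<Otimes>\<^sub>M borel)" using W by (simp add: is_coupling_def)
  have d: "distr lam borel (\<lambda>x. x) = lam" by (rule distr_id2[OF sets_lam[symmetric]])
  have *: "distr W borel g \<Otimes>\<^sub>M lam = distr (W \<Otimes>\<^sub>M lam) (borel \<Otimes>\<^sub>M borel) (\<lambda>(w, \<xi>). (g w, \<xi>))"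
    if "g \<in> borel \<Otimes>\<^sub>M borel \<rightarrow>\<^sub>M borel" for g
    using pair_measure_distr[of g W borel "\<lambda>x. x" lam borel] that sW
    by (simp add: d lam.sigma_finite_measure_axioms measurable_cong_sets[OF sW refl])
  have "K u = distr W borel fst" "K v = distr W borel snd" using W by (auto simp: is_coupling_def)
  then show "(\<integral>\<^sup>+w. h w \<partial>(K u \<Otimes>\<^sub>M lam)) = (\<integral>\<^sup>+w. h (fst (fst w), snd w) \<partial>(W \<Otimes>\<^sub>M lam))"
    "(\<integral>\<^sup>+w. h w \<partial>(K v \<Otimes>\<^sub>M lam)) = (\<integral>\<^sup>+w. h (snd (fst w), snd w) \<partial>(W \<Otimes>\<^sub>M lam))"
    by (simp_all add: * nn_integral_distr case_prod_unfold)
qed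

lemma nn_integral_P_coupled:
  assumes W: "is_coupling W (K u) (K v)"
    and [measurable]: "f \<in> borel_measurable borel" and f: "\<And>x. 0 \<le> f x"
  shows "(\<integral>\<^sup>+x. ennreal (f x) \<partial>P u) = (\<integral>\<^sup>+w. ennreal (move u f (proposal1 w)) \<partial>(W \<Otimes>\<^sub>M lam))"
    and "(\<integral>\<^sup>+x. ennreal (f x) \<partial>P v) = (\<integral>\<^sup>+w. ennreal (move v f (proposal2 w)) \<partial>(W \<Otimes>\<^sub>M lam))"
  using nn_integral_coupled(1)[OF W, of "\<lambda>w. ennreal (move u f (fst w + snd w))"]
    nn_integral_coupled(2)[OF W, of "\<lambda>w. ennreal (move v f (fst w + snd w))"] f
  by (simp_all add: nn_integral_P_move case_prod_unfold proposal1_def proposal2_def)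

text \<open>The conditional expectation of the cost after one step from \<open>(u, v)\<close>, given the proposals
  \<open>a, b\<close>, when both chains compare the same uniform variable with their acceptance probabilities. The
  four terms belong to joint acceptance, joint rejection and the two kinds of disagreement.\<close>

definition coupled_cost :: "('a \<Rightarrow> 'a \<Rightarrow> real) \<Rightarrow> 'a \<Rightarrow> 'a \<Rightarrow> 'a \<Rightarrow> 'a \<Rightarrow> real" where
  "coupled_cost G u v a b = min (accept u a) (accept v b) * G a b + (1 - max (accept u a) (accept v b)) * G u v
     + max 0 (accept u a - accept v b) * G a v + max 0 (accept v b - accept u a) * G u b"

lemma coupled_cost_linear: "coupled_cost (\<lambda>x y. s * G x y + t * H x y) u v a b = s * coupled_cost G u v a b + t * coupled_cost H u v a b"
  by (simp add: coupled_cost_def algebra_simps)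

lemma move_diff_le_coupled_cost:
  assumes G: "\<And>x y. \<bar>f x - f y\<bar> \<le> G x y"
  shows "\<bar>move u f a - move v f b\<bar> \<le> coupled_cost G u v a b"
proof -
  have le: "\<bar>move u f a - move v f b\<bar> \<le> coupled_cost G u v a b"
    if acc: "accept u a \<le> accept v b" and G: "\<And>x y. \<bar>f x - f y\<bar> \<le> G x y" for G u v a b
  proof -
    have "move u f a - move v f b = accept u a * (f a - f b) + (1 - accept v b) * (f u - f v)
        + (accept v b - accept u a) * (f u - f b)"
      by (simp add: move_def algebra_simps)
    also have "\<bar>\<dots>\<bar> \<le> accept u a * \<bar>f a - f b\<bar> + (1 - accept v b) * \<bar>f u - f v\<bar>
        + (accept v b - accept u a) * \<bar>f u - f b\<bar>"
      using acc accept_unit[of u a] accept_unit[of v b]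
      by (intro order_trans[OF abs_triangle_ineq] add_mono order_trans[OF abs_triangle_ineq])
        (simp_all add: abs_mult)
    also have "\<dots> \<le> accept u a * G a b + (1 - accept v b) * G u v + (accept v b - accept u a) * G u b"
      using acc accept_unit[of u a] accept_unit[of v b] G by (intro add_mono mult_left_mono) auto
    also have "\<dots> = coupled_cost G u v a b" using acc by (simp add: coupled_cost_def max_def min_def)
    finally show ?thesis .
  qed
  show ?thesis
  proof (cases "accept u a \<le> accept v b")
    case True
    then show ?thesis using G by (rule le)
  next
    case False
    have "\<bar>move v f b - move u f a\<bar> \<le> coupled_cost (\<lambda>x y. G y x) v u b a"
      using False by (intro le) (simp, subst abs_minus_commute, rule G)
    then show ?thesis by (simp add: coupled_cost_def min.commute max.commute abs_minus_commute)
  qed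
qed

lemma coupled_cost_additive: "coupled_cost (\<lambda>x y. f x + f y) u v a b = move u f a + move v f b"
  by (cases "accept u a \<le> accept v b") (simp_all add: coupled_cost_def move_def max_def min_def algebra_simps)

lemma coupled_cost_measurable:
  assumes [measurable]: "(\<lambda>(x, y). G x y) \<in> borel_measurable (borel \<Otimes>\<^sub>M borel)"
    "a \<in> borel_measurable M" "b \<in> borel_measurable M"
  shows "(\<lambda>x. coupled_cost G u v (a x) (b x)) \<in> borel_measurable M"
  unfolding coupled_cost_def by measurable

text \<open>The coupling inequality in dual form: the difference of two expectations is an integral over the common
  space of the proposals.\<close>

lemma coupled_difference_le:
  assumes W: "is_coupling W (K u) (K v)"
    and f_meas [measurable]: "f \<in> borel_measurable borel" and f: "\<And>x. 0 \<le> f x \<and> f x \<le> 1"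
    and lip: "\<And>x y. \<bar>f x - f y\<bar> \<le> G x y"
    and int: "integrable (W \<Otimes>\<^sub>M lam) (\<lambda>w. coupled_cost G u v (proposal1 w) (proposal2 w))"
  shows "\<bar>(\<integral>x. f x \<partial>P u) - (\<integral>x. f x \<partial>P v)\<bar> \<le> (\<integral>w. coupled_cost G u v (proposal1 w) (proposal2 w) \<partial>(W \<Otimes>\<^sub>M lam))"
proof -
  let ?\<Omega> = "W \<Otimes>\<^sub>M lam"
  interpret \<Omega>: prob_space ?\<Omega> by (rule prob_space_coupled[OF W])
  note [measurable_cong] = coupling_sets[OF W]
  note [measurable] = proposal_measurable
  have sP [measurable_cong]: "sets (P w) = sets borel" for w by simp
  have eq: "(\<integral>w. f w \<partial>P x) = enn2real (\<integral>\<^sup>+w. ennreal (f w) \<partial>P x)" for x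
    using f by (intro integral_eq_nn_integral) auto
  have mv: "0 \<le> move x f w" "move x f w \<le> 1" for x w
    using f move_nonneg[of f] move_le_1[of f] by auto
  have 1: "(\<integral>x. f x \<partial>P u) = (\<integral>w. move u f (proposal1 w) \<partial>?\<Omega>)"
    unfolding eq nn_integral_P_coupled(1)[OF W f_meas f[THEN conjunct1]]
    using mv by (intro integral_eq_nn_integral[symmetric]) auto
  have 2: "(\<integral>x. f x \<partial>P v) = (\<integral>w. move v f (proposal2 w) \<partial>?\<Omega>)"
    unfolding eq nn_integral_P_coupled(2)[OF W f_meas f[THEN conjunct1]]
    using mv by (intro integral_eq_nn_integral[symmetric]) auto
  have i: "integrable ?\<Omega> (\<lambda>w. move u f (proposal1 w))" "integrable ?\<Omega> (\<lambda>w. move v f (proposal2 w))"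
    using mv by (intro \<Omega>.integrable_const_bound[where B=1]; auto)+
  have "\<bar>(\<integral>x. f x \<partial>P u) - (\<integral>x. f x \<partial>P v)\<bar> = \<bar>\<integral>w. move u f (proposal1 w) - move v f (proposal2 w) \<partial>?\<Omega>\<bar>"
    unfolding 1 2 by (subst Bochner_Integration.integral_diff[OF i]) simp
  also have "\<dots> \<le> (\<integral>w. coupled_cost G u v (proposal1 w) (proposal2 w) \<partial>?\<Omega>)"
    by (rule order_trans[OF integral_abs_bound integral_mono[OF _ int]])
      (auto intro!: integrable_abs Bochner_Integration.integrable_diff i move_diff_le_coupled_cost[OF lip])
  finally show ?thesis .
qed

end

section \<open>The drift condition\<close>

text \<open>Either \<open>b\<close> is small compared to \<open>a\<close>, and the first term suffices, or \<open>a\<close> is at most a multiple of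
  \<open>b\<close>. The factor \<open>1 + \<delta>\<close> is close enough to one to be absorbed by a contraction.\<close>

lemma power_add_le:
  fixes p :: nat and \<delta> :: real
  assumes "0 < \<delta>"
  shows "\<exists>c\<ge>0. \<forall>a\<ge>0. \<forall>b\<ge>0. (a + b) ^ p \<le> (1 + \<delta>) * a ^ p + c * b ^ p"
proof -
  have "((\<lambda>\<eta>::real. (1 + \<eta>) ^ p) \<longlongrightarrow> (1 + 0) ^ p) (at_right 0)"
    by (intro tendsto_intros)
  then have "\<forall>\<^sub>F \<eta> in at_right (0::real). (1 + \<eta>) ^ p < 1 + \<delta>"
    using assms by (intro order_tendstoD) auto
  moreover have "\<forall>\<^sub>F \<eta> in at_right (0::real). 0 < \<eta>" by (rule eventually_at_right_less)
  ultimately have "\<forall>\<^sub>F \<eta> in at_right (0::real). (1 + \<eta>) ^ p < 1 + \<delta> \<and> 0 < \<eta>" by eventually_elim simp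
  then obtain \<eta> :: real where \<eta>: "(1 + \<eta>) ^ p < 1 + \<delta>" "0 < \<eta>"
    using eventually_happens trivial_limit_at_right_real by blast
  have "(a + b) ^ p \<le> (1 + \<delta>) * a ^ p + (1 / \<eta> + 1) ^ p * b ^ p" if ab: "0 \<le> a" "0 \<le> b" for a b :: real
  proof (cases "b \<le> \<eta> * a")
    case True
    then have "(a + b) ^ p \<le> ((1 + \<eta>) * a) ^ p" using ab by (intro power_mono) (auto simp: algebra_simps)
    also have "\<dots> \<le> (1 + \<delta>) * a ^ p" using \<eta> ab by (simp add: power_mult_distrib mult_right_mono)
    finally show ?thesis using ab \<eta> by (simp add: add_increasing2)
  next
    case False
    then have "a \<le> 1 / \<eta> * b" using \<eta> by (simp add: field_simps)
    then have "(a + b) ^ p \<le> ((1 / \<eta> + 1) * b) ^ p" using ab by (intro power_mono) (auto simp: algebra_simps)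
    then show ?thesis using ab assms by (simp add: power_mult_distrib add_increasing)
  qed
  then show ?thesis using \<eta> by (intro exI[of _ "(1 / \<eta> + 1) ^ p"]) simp
qed

lemma cball_positive_measure:
  fixes M :: "'a :: real_normed_vector measure"
  assumes "prob_space M" and sets: "sets M = sets borel"
  shows "\<exists>r>0. 0 < measure M {\<xi>. norm \<xi> \<le> r}"
proof -
  interpret prob_space M by fact
  have m: "{\<xi>. norm \<xi> \<le> r} \<in> events" for r unfolding sets by simp
  have "(\<lambda>n. prob {\<xi>. norm \<xi> \<le> real n}) \<longlonglongrightarrow> prob (\<Union>n. {\<xi>. norm \<xi> \<le> real n})"
    using m by (intro finite_Lim_measure_incseq) (auto simp: incseq_def)
  also have "(\<Union>n. {\<xi>. norm \<xi> \<le> real n}) = space M"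
    using sets_eq_imp_space_eq[OF sets] real_arch_simple by auto
  finally have "(\<lambda>n. prob {\<xi>. norm \<xi> \<le> real n}) \<longlonglongrightarrow> 1" by (simp add: prob_space)
  from order_tendstoD(1)[OF this, of 0] obtain N where "\<forall>n\<ge>N. 0 < prob {\<xi>. norm \<xi> \<le> real n}"
    by (auto simp: eventually_sequentially)
  then have "0 < prob {\<xi>. norm \<xi> \<le> real (Suc N)}" by (metis le_SucI order_refl)
  then show ?thesis by (intro exI[of _ "real (Suc N)"]) auto
qed

locale rcar_moment = rcar_mh +
  fixes p :: nat
  assumes p_ge_1: "1 \<le> p"
    and moment: "integrable lam (\<lambda>\<xi>. norm \<xi> ^ p)"
    and shrink: "AE z in K u. norm z \<le> norm u"
begin

definition V :: "'a \<Rightarrow> real" where "V u = norm u ^ p"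

definition mom :: real where "mom = (\<integral>\<xi>. norm \<xi> ^ p \<partial>lam)"

lemma space_K [simp]: "space (K u) = UNIV"
  using sets_eq_imp_space_eq[OF sets_K] by simp

lemma V_nonneg [simp]: "0 \<le> V u" by (simp add: V_def)

lemma mom_nonneg [simp]: "0 \<le> mom" by (simp add: mom_def)

lemma V_measurable [measurable]: "V \<in> borel_measurable borel" unfolding V_def[abs_def] by measurable

lemma distr_pair_snd_lam: "prob_space N \<Longrightarrow> distr (N \<Otimes>\<^sub>M lam) lam snd = lam"
proof -
  assume N: "prob_space N"
  interpret lam: prob_space lam by (rule prob_lam)
  show ?thesis
  proof (rule measure_eqI)
    fix A assume A: "A \<in> sets (distr (N \<Otimes>\<^sub>M lam) lam snd)"
    have "emeasure (distr (N \<Otimes>\<^sub>M lam) lam snd) A = emeasure (N \<Otimes>\<^sub>M lam) (space N \<times> A)"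
      using A sets.sets_into_space[of A lam]
      by (subst emeasure_distr) (auto simp: space_pair_measure intro!: arg_cong2[where f=emeasure])
    also have "\<dots> = emeasure lam A"
      using A prob_space.emeasure_space_1[OF N] by (subst lam.emeasure_pair_measure_Times) auto
    finally show "emeasure (distr (N \<Otimes>\<^sub>M lam) lam snd) A = emeasure lam A" .
  qed simp
qed

lemma moment_pair:
  assumes N: "prob_space N"
  shows "integrable (N \<Otimes>\<^sub>M lam) (\<lambda>w. norm (snd w) ^ p)" "(\<integral>w. norm (snd w) ^ p \<partial>(N \<Otimes>\<^sub>M lam)) = mom"
  using moment integrable_distr_eq[of snd "N \<Otimes>\<^sub>M lam" lam "\<lambda>\<xi>. norm \<xi> ^ p"]
    integral_distr[of snd "N \<Otimes>\<^sub>M lam" lam "\<lambda>\<xi>. norm \<xi> ^ p"]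
  by (simp_all add: distr_pair_snd_lam[OF N] mom_def)

lemma norm_le_of_V_le:
  assumes "V u \<le> S" shows "norm u \<le> max 1 S"
proof (cases "norm u \<le> 1")
  case False
  then have "norm u \<le> norm u ^ p" using p_ge_1 by (intro self_le_power) auto
  then show ?thesis using assms by (simp add: V_def)
qed simp

lemma move_V_le:
  assumes "norm w \<le> norm u + s" "0 \<le> s"
  shows "move u V w \<le> (norm u + s) ^ p"
proof -
  have "move u V w \<le> accept u w * (norm u + s) ^ p + (1 - accept u w) * (norm u + s) ^ p"
    unfolding move_def V_def using accept_unit[of u w] assms
    by (intro add_mono mult_left_mono power_mono) auto
  then show ?thesis by (simp add: algebra_simps)
qed

text \<open>In all cases the norm grows by at most \<open>\<parallel>\<xi>\<parallel>\<close>. If the contraction hits the ball about \<open>\<beta> u\<close> and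
  the innovation is small, the proposal is shorter by a factor \<open>\<theta> < 1\<close> and is accepted with a probability
  bounded below. This happens with positive probability, and \<open>\<delta>\<close> is half of the resulting relative gain,
  so that a loss of \<open>\<delta>\<close> from \<open>power_add_le\<close> leaves a net factor of \<open>1 - \<delta>\<close>.\<close>

theorem drift:
  assumes \<beta>: "0 < \<beta>" "\<beta> < 1" and b: "0 < b" "b < 1" and \<epsilon>: "0 < \<epsilon>"
    and good: "\<And>u. \<epsilon> \<le> measure (K u) {z. norm (z - \<beta> *\<^sub>R u) \<le> b * (1 - \<beta>) * norm u}"
    and acc: "\<And>b. 0 < b \<Longrightarrow> b < 1 \<Longrightarrow> \<exists>R>0. \<exists>M>0. \<forall>u. norm u > R \<longrightarrow>
        (INF v\<in>cball (\<beta> *\<^sub>R u) (b * (1 - \<beta>) * norm u). exp (\<Psi> u - \<Psi> v)) \<ge> M"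
  shows "\<exists>l c. 0 \<le> l \<and> l < 1 \<and> 0 \<le> c \<and> (\<forall>u. (\<integral>\<^sup>+w. ennreal (V w) \<partial>P u) \<le> ennreal (l * V u + c))"
proof -
  interpret lam: prob_space lam by (rule prob_lam)
  obtain r where r: "0 < r" "0 < lam.prob {\<xi>. norm \<xi> \<le> r}"
    using cball_positive_measure[OF prob_lam sets_lam] by blast
  \<comment> \<open>a slightly larger ball leaves room for the innovation\<close>
  define b' where "b' = (1 + b) / 2"
  have b': "b < b'" "b' < 1" using b by (auto simp: b'_def)
  obtain R M where R: "0 < R" and M: "0 < M"
    and INF: "\<And>u. norm u > R \<Longrightarrow>
      M \<le> (INF v\<in>cball (\<beta> *\<^sub>R u) (b' * (1 - \<beta>) * norm u). exp (\<Psi> u - \<Psi> v))"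
    using acc[of b'] b b' by auto
  define \<theta> where "\<theta> = \<beta> + b' * (1 - \<beta>)"
  have "b' * (1 - \<beta>) < 1 - \<beta>" using mult_strict_right_mono[of b' 1 "1 - \<beta>"] b' \<beta> by simp
  moreover have "0 < b' * (1 - \<beta>)" using \<beta> b b' by simp
  ultimately have \<theta>: "0 < \<theta>" "\<theta> < 1" using \<beta> unfolding \<theta>_def by linarith+
  have \<theta>p: "0 \<le> \<theta> ^ p" "\<theta> ^ p < 1" using \<theta> p_ge_1 by (auto simp: power_less_one_iff)
  define \<kappa> where "\<kappa> = min 1 M * (1 - \<theta> ^ p)"
  have \<kappa>: "0 < \<kappa>" "\<kappa> \<le> 1" using M \<theta>p by (auto simp: \<kappa>_def intro!: mult_le_one)
  define \<delta> where "\<delta> = \<kappa> * (\<epsilon> * lam.prob {\<xi>. norm \<xi> \<le> r}) / 2"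
  have \<epsilon>1: "\<epsilon> \<le> 1" using good[of 0] prob_space.prob_le_1[OF prob_K] by (rule order_trans)
  have \<delta>: "0 < \<delta>" using \<kappa> \<epsilon> r by (simp add: \<delta>_def)
  have "\<kappa> * (\<epsilon> * lam.prob {\<xi>. norm \<xi> \<le> r}) \<le> 1"
    using \<kappa> \<epsilon> \<epsilon>1 by (intro mult_le_one) auto
  then have \<delta>1: "\<delta> \<le> 1 / 2" by (simp add: \<delta>_def)
  obtain c where c: "0 \<le> c" and pow: "\<And>x y. 0 \<le> x \<Longrightarrow> 0 \<le> y \<Longrightarrow> (x + y) ^ p \<le> (1 + \<delta>) * x ^ p + c * y ^ p"
    using power_add_le[OF \<delta>, of p] by blast
  \<comment> \<open>beyond \<open>R1\<close> an innovation of norm \<open>r\<close> fits between the balls for \<open>b\<close> and \<open>b'\<close>\<close>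
  define R1 where "R1 = max R (r / ((b' - b) * (1 - \<beta>)))"
  have main: "(\<integral>\<^sup>+w. ennreal (V w) \<partial>P u) \<le> ennreal ((1 - \<delta>) * V u + (2 * \<delta> * R1 ^ p + c * mom))" for u
  proof -
    let ?\<Omega> = "K u \<Otimes>\<^sub>M lam"
    define G :: "('a \<times> 'a) set" where "G = (if norm u > R1 then {z. norm (z - \<beta> *\<^sub>R u) \<le> b * (1 - \<beta>) * norm u} \<times> {\<xi>. norm \<xi> \<le> r} else {})"
    define H where "H w = (1 + \<delta>) * V u + c * norm (snd w) ^ p - \<kappa> * V u * indicator G w" for w
    interpret \<Omega>: prob_space ?\<Omega> by (rule prob_space_pair[OF prob_K prob_lam])
    have GS [measurable]: "G \<in> sets ?\<Omega>"
    proof -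
      have "closed {z. norm (z - \<beta> *\<^sub>R u) \<le> b * (1 - \<beta>) * norm u}" "closed {\<xi> :: 'a. norm \<xi> \<le> r}"
        by (intro closed_Collect_le continuous_intros)+
      then show ?thesis by (auto simp: G_def sets_lam intro!: pair_measureI)
    qed
    have G_int: "integrable ?\<Omega> (indicator G :: _ \<Rightarrow> real)"
      using GS by (intro \<Omega>.integrable_const_bound[where B=1]) auto
    have ae: "AE w in ?\<Omega>. norm (fst w) \<le> norm u"
    proof -
      have "AE z in distr ?\<Omega> (K u) fst. norm z \<le> norm u"
        unfolding lam.distr_pair_fst using shrink .
      then show ?thesis by (subst (asm) AE_distr_iff) auto
    qed
    have le_H: "AE w in ?\<Omega>. move u V (fst w + snd w) \<le> H w"
      using ae
    proof eventually_elim
      fix w :: "'a \<times> 'a" assume w: "norm (fst w) \<le> norm u"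
      obtain z \<xi> where w_eq: "w = (z, \<xi>)" by force
      show "move u V (fst w + snd w) \<le> H w"
      proof (cases "w \<in> G")
        case False
        have "norm (z + \<xi>) \<le> norm u + norm \<xi>" using w norm_triangle_ineq[of z \<xi>] by (simp add: w_eq)
        then have "move u V (z + \<xi>) \<le> (norm u + norm \<xi>) ^ p" by (rule move_V_le) simp
        also have "\<dots> \<le> (1 + \<delta>) * norm u ^ p + c * norm \<xi> ^ p" by (rule pow) auto
        finally show ?thesis using False by (simp add: H_def w_eq V_def)
      next
        case True
        then have u: "norm u > R1" and z: "norm (z - \<beta> *\<^sub>R u) \<le> b * (1 - \<beta>) * norm u" and \<xi>: "norm \<xi> \<le> r"
          by (auto simp: G_def w_eq split: if_splits)
        have "r / ((b' - b) * (1 - \<beta>)) < norm u" using u by (simp add: R1_def)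
        then have "r < norm u * ((b' - b) * (1 - \<beta>))" using b' \<beta> by (simp add: pos_divide_less_eq)
        then have r': "norm \<xi> \<le> (b' - b) * (1 - \<beta>) * norm u" using \<xi> by (simp add: mult.commute)
        have "z + \<xi> - \<beta> *\<^sub>R u = (z - \<beta> *\<^sub>R u) + \<xi>" by simp
        then have "norm (z + \<xi> - \<beta> *\<^sub>R u) \<le> norm (z - \<beta> *\<^sub>R u) + norm \<xi>" by (metis norm_triangle_ineq)
        also have "\<dots> \<le> b * (1 - \<beta>) * norm u + (b' - b) * (1 - \<beta>) * norm u" using z r' by (rule add_mono)
        also have "\<dots> = b' * (1 - \<beta>) * norm u" by (simp add: algebra_simps)
        finally have near: "norm (z + \<xi> - \<beta> *\<^sub>R u) \<le> b' * (1 - \<beta>) * norm u" .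
        then have "z + \<xi> \<in> cball (\<beta> *\<^sub>R u) (b' * (1 - \<beta>) * norm u)" by (simp add: dist_norm norm_minus_commute)
        then have "(INF v\<in>cball (\<beta> *\<^sub>R u) (b' * (1 - \<beta>) * norm u). exp (\<Psi> u - \<Psi> v)) \<le> exp (\<Psi> u - \<Psi> (z + \<xi>))"
          by (intro cINF_lower bdd_belowI2[where m=0]) auto
        then have acc: "min 1 M \<le> accept u (z + \<xi>)"
          using INF[of u] u by (auto simp: mh_accept_def R1_def)
        have "norm (z + \<xi>) \<le> norm (z + \<xi> - \<beta> *\<^sub>R u) + norm (\<beta> *\<^sub>R u)" using norm_triangle_ineq[of "z + \<xi> - \<beta> *\<^sub>R u" "\<beta> *\<^sub>R u"] by simp
        also have "\<dots> \<le> \<theta> * norm u" using near \<beta> by (simp add: \<theta>_def algebra_simps)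
        finally have "V (z + \<xi>) \<le> \<theta> ^ p * V u" unfolding V_def power_mult_distrib[symmetric] by (intro power_mono) auto
        then have "move u V (z + \<xi>) \<le> accept u (z + \<xi>) * (\<theta> ^ p * V u) + (1 - accept u (z + \<xi>)) * V u"
          unfolding move_def using accept_unit[of u "z + \<xi>"] by (intro add_mono mult_left_mono) auto
        also have "\<dots> = V u - accept u (z + \<xi>) * ((1 - \<theta> ^ p) * V u)" by (simp add: algebra_simps)
        also have "\<dots> \<le> V u - min 1 M * ((1 - \<theta> ^ p) * V u)"
          using acc \<theta>p by (intro diff_left_mono mult_right_mono) auto
        also have "\<dots> = V u - \<kappa> * V u" by (simp add: \<kappa>_def)
        also have "\<dots> \<le> (1 + \<delta>) * V u + c * norm \<xi> ^ p - \<kappa> * V u"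
          using \<delta> c by (simp add: algebra_simps)
        finally show ?thesis using True by (simp add: H_def w_eq)
      qed
    qed
    note mom_int = moment_pair[OF prob_K[of u]]
    have H_int: "integrable ?\<Omega> H"
      unfolding H_def using mom_int(1) G_int
      by (intro Bochner_Integration.integrable_diff Bochner_Integration.integrable_add integrable_mult_right)
        (auto simp: \<Omega>.emeasure_eq_measure)
    have H_eq: "(\<integral>w. H w \<partial>?\<Omega>) = (1 + \<delta>) * V u + c * mom - \<kappa> * V u * measure ?\<Omega> G"
      unfolding H_def using mom_int GS G_int
      by (subst Bochner_Integration.integral_diff)
        (auto simp: \<Omega>.prob_space \<Omega>.emeasure_eq_measure intro!: Bochner_Integration.integrable_add integrable_mult_right)
    have "(\<integral>\<^sup>+w. ennreal (V w) \<partial>P u) = (\<integral>\<^sup>+w. ennreal (move u V (fst w + snd w)) \<partial>?\<Omega>)"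
      by (subst nn_integral_P_move) (auto simp: case_prod_unfold)
    also have "\<dots> \<le> (\<integral>\<^sup>+w. ennreal (H w) \<partial>?\<Omega>)"
      using le_H by (intro nn_integral_mono_AE) (auto elim!: eventually_mono intro: ennreal_leI)
    also have "\<dots> = ennreal (\<integral>w. H w \<partial>?\<Omega>)"
    proof (rule nn_integral_eq_integral[OF H_int])
      show "AE w in ?\<Omega>. 0 \<le> H w"
        using le_H
      proof eventually_elim
        fix w assume "move u V (fst w + snd w) \<le> H w"
        then show "0 \<le> H w" using move_nonneg[of V u "fst w + snd w"] by simp
      qed
    qed
    also have "\<dots> \<le> ennreal ((1 - \<delta>) * V u + (2 * \<delta> * R1 ^ p + c * mom))"
    proof (rule ennreal_leI, cases "norm u > R1")
      case True
      have "measure ?\<Omega> G = measure (K u) {z. norm (z - \<beta> *\<^sub>R u) \<le> b * (1 - \<beta>) * norm u} * lam.prob {\<xi>. norm \<xi> \<le> r}"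
        using True by (simp add: G_def measure_def lam.emeasure_pair_measure_Times enn2real_mult)
      also have "\<dots> \<ge> \<epsilon> * lam.prob {\<xi>. norm \<xi> \<le> r}" using good by (intro mult_right_mono) auto
      finally have "\<kappa> * V u * (\<epsilon> * lam.prob {\<xi>. norm \<xi> \<le> r}) \<le> \<kappa> * V u * measure ?\<Omega> G"
        using \<kappa> by (intro mult_left_mono) auto
      then have "2 * \<delta> * V u \<le> \<kappa> * V u * measure ?\<Omega> G" by (simp add: \<delta>_def mult_ac)
      moreover have "0 \<le> 2 * \<delta> * R1 ^ p" using \<delta> R by (simp add: R1_def)
      ultimately show "(\<integral>w. H w \<partial>?\<Omega>) \<le> (1 - \<delta>) * V u + (2 * \<delta> * R1 ^ p + c * mom)"
        unfolding H_eq by (simp add: algebra_simps)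
    next
      case False
      then have "V u \<le> R1 ^ p" by (simp add: V_def power_mono)
      then have "2 * \<delta> * V u \<le> 2 * \<delta> * R1 ^ p" using \<delta> by (intro mult_left_mono) auto
      moreover have "0 \<le> \<kappa> * V u * measure ?\<Omega> G" using \<kappa> by simp
      ultimately show "(\<integral>w. H w \<partial>?\<Omega>) \<le> (1 - \<delta>) * V u + (2 * \<delta> * R1 ^ p + c * mom)"
        unfolding H_eq by (simp add: algebra_simps)
    qed
    finally show ?thesis .
  qed
  have "0 \<le> 2 * \<delta> * R1 ^ p + c * mom" using \<delta> R c by (simp add: R1_def)
  then show ?thesis using main \<delta> \<delta>1 by (intro exI[of _ "1 - \<delta>"] exI[of _ "2 * \<delta> * R1 ^ p + c * mom"]) auto
qed

end

section \<open>One step of two coupled chains\<close>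

lemma integral_le_of_AE_bounds:
  fixes f g :: "'b \<Rightarrow> real"
  assumes "f \<in> borel_measurable M" "integrable M g" "AE w in M. 0 \<le> f w" "AE w in M. f w \<le> g w"
  shows "integrable M f" "(\<integral>w. f w \<partial>M) \<le> (\<integral>w. g w \<partial>M)"
proof -
  show i: "integrable M f"
    by (rule Bochner_Integration.integrable_bound[OF assms(2,1)]) (use assms(3,4) in eventually_elim, simp)
  show "(\<integral>w. f w \<partial>M) \<le> (\<integral>w. g w \<partial>M)" by (rule integral_mono_AE[OF i assms(2,4)])
qed

text \<open>Transfers Lipschitz bounds from \<open>\<Psi>\<close> to the acceptance probability.\<close>

lemma min_1_exp_lipschitz: "\<bar>min 1 (exp x) - min 1 (exp y)\<bar> \<le> \<bar>x - y\<bar>" for x y :: real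
proof -
  have *: "min 1 (exp x) - min 1 (exp y) \<le> x - y" if "y \<le> x" for x y :: real
  proof (cases "0 \<le> y")
    case True
    then show ?thesis using that by simp
  next
    case False
    define x' where "x' = min x 0"
    have "1 + (y - x') \<le> exp (y - x')" by (rule exp_ge_add_one_self)
    then have "exp x' * (1 + (y - x')) \<le> exp x' * exp (y - x')" by (rule mult_left_mono) simp
    then have "exp x' - exp y \<le> exp x' * (x' - y)" by (simp add: exp_add[symmetric] algebra_simps)
    also have "\<dots> \<le> 1 * (x' - y)" using that False by (intro mult_right_mono) (auto simp: x'_def)
    also have "\<dots> \<le> x - y" by (simp add: x'_def)
    finally show ?thesis using False by (auto simp: x'_def min_def split: if_splits)
  qed
  have mono: "min 1 (exp y) \<le> min 1 (exp x)" if "y \<le> x" for x y :: real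
    using that by (intro min.mono) auto
  show ?thesis
  proof (cases "y \<le> x")
    case True
    then show ?thesis using *[of y x] mono[of y x] by linarith
  next
    case False
    then show ?thesis using *[of x y] mono[of x y] by linarith
  qed
qed

locale rcar_coupled = rcar_moment +
  fixes W :: "('a \<times> 'a) measure" and u v :: 'a and \<beta>c :: real
  assumes coupling: "is_coupling W (K u) (K v)"
    and neq: "u \<noteq> v"
    and nonexpansive: "AE w in W. norm (fst w - snd w) \<le> norm (u - v)"
    and contractive: "(\<integral>\<^sup>+w. ennreal (norm (fst w - snd w)) \<partial>W) \<le> ennreal (\<beta>c * norm (u - v))"
    and \<beta>c: "0 < \<beta>c" "\<beta>c < 1"
begin

definition \<Omega> :: "(('a \<times> 'a) \<times> 'a) measure" where "\<Omega> = W \<Otimes>\<^sub>M lam"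

definition \<rho> :: "'a \<times> 'a \<Rightarrow> real" where "\<rho> w = norm (fst w - snd w) / norm (u - v)"

definition innovation_mass :: "real \<Rightarrow> real" where "innovation_mass r = measure lam {\<xi>. norm \<xi> \<le> r}"

lemma sets_W [measurable_cong]: "sets W = sets (borel \<Otimes>\<^sub>M borel)"
  using coupling by (simp add: is_coupling_def)

lemma sets_\<Omega> [measurable_cong]: "sets \<Omega> = sets ((borel \<Otimes>\<^sub>M borel) \<Otimes>\<^sub>M borel)"
  unfolding \<Omega>_def by (rule coupling_sets[OF coupling])

lemmas prob_W = coupling_prob[OF coupling]

lemma prob_\<Omega>: "prob_space \<Omega>" unfolding \<Omega>_def by (rule prob_space_coupled[OF coupling])

declare proposal_measurable [measurable]

lemma \<rho>_measurable [measurable]: "\<rho> \<in> borel_measurable (borel \<Otimes>\<^sub>M borel)"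
  unfolding \<rho>_def[abs_def] by measurable

lemma \<rho>_nonneg [simp]: "0 \<le> \<rho> w" by (simp add: \<rho>_def)

lemma proposal_diff: "norm (proposal1 w - proposal2 w) = norm (u - v) * \<rho> (fst w)"
  using neq by (simp add: \<rho>_def proposal1_def proposal2_def)

lemma AE_fst: assumes "AE w in W. Q w" shows "AE w in \<Omega>. Q (fst w)"
proof -
  interpret lam: prob_space lam by (rule prob_lam)
  have "fst \<in> \<Omega> \<rightarrow>\<^sub>M W" unfolding \<Omega>_def by simp
  moreover have "AE w in distr \<Omega> W fst. Q w" 
    using assms unfolding \<Omega>_def lam.distr_pair_fst .
  ultimately show ?thesis by (rule AE_distrD)
qed

lemma AE_\<rho>: "AE w in \<Omega>. \<rho> (fst w) \<le> 1"
  using nonexpansive neq by (intro AE_fst) (simp add: \<rho>_def)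

lemma AE_proposal_norm: "AE w in \<Omega>. norm (proposal1 w) \<le> norm u + norm (snd w) \<and> norm (proposal2 w) \<le> norm v + norm (snd w)"
proof -
  have d: "distr W borel fst = K u" "distr W borel snd = K v" using coupling by (auto simp: is_coupling_def)
  have "AE w in distr W borel fst. norm w \<le> norm u" "AE w in distr W borel snd. norm w \<le> norm v"
    unfolding d by (rule shrink)+
  then have "AE w in W. norm (fst w) \<le> norm u" "AE w in W. norm (snd w) \<le> norm v"
    by (auto dest!: AE_distrD[rotated] cong: measurable_cong_sets simp: sets_W)
  then have "AE w in \<Omega>. norm (fst (fst w)) \<le> norm u" "AE w in \<Omega>. norm (snd (fst w)) \<le> norm v"
    by (auto dest: AE_fst)
  then show ?thesis
  proof eventually_elim
    fix w :: "('a \<times> 'a) \<times> 'a" assume "norm (fst (fst w)) \<le> norm u" "norm (snd (fst w)) \<le> norm v"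
    then show "norm (proposal1 w) \<le> norm u + norm (snd w) \<and> norm (proposal2 w) \<le> norm v + norm (snd w)"
      using norm_triangle_ineq[of "fst (fst w)" "snd w"] norm_triangle_ineq[of "snd (fst w)" "snd w"]
      by (simp add: proposal1_def proposal2_def)
  qed
qed

lemma \<rho>_mean: "integrable W \<rho>" "(\<integral>w. \<rho> w \<partial>W) \<le> \<beta>c"
proof -
  have "(\<integral>\<^sup>+w. ennreal (\<rho> w) \<partial>W) = (\<integral>\<^sup>+w. ennreal (norm (fst w - snd w)) * ennreal (1 / norm (u - v)) \<partial>W)"
    by (intro nn_integral_cong) (simp add: \<rho>_def ennreal_mult[symmetric])
  also have "\<dots> = (\<integral>\<^sup>+w. ennreal (norm (fst w - snd w)) \<partial>W) * ennreal (1 / norm (u - v))"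
    by (rule nn_integral_multc) measurable
  also have "\<dots> \<le> ennreal (\<beta>c * norm (u - v)) * ennreal (1 / norm (u - v))"
    by (intro mult_right_mono contractive) simp
  also have "\<dots> = ennreal \<beta>c" using neq \<beta>c by (simp add: ennreal_mult[symmetric])
  finally have *: "(\<integral>\<^sup>+w. ennreal (\<rho> w) \<partial>W) \<le> ennreal \<beta>c" .
  show "integrable W \<rho>" using * by (intro integrableI_nonneg) (auto simp: le_less_trans)
  show "(\<integral>w. \<rho> w \<partial>W) \<le> \<beta>c"
    using * \<beta>c by (subst integral_eq_nn_integral) (auto intro: enn2real_leI)
qed

text \<open>The contraction and the innovation are independent.\<close>

lemma product_integral:
  assumes h: "integrable W h"
  shows "integrable \<Omega> (\<lambda>w. h (fst w) * indicator {\<xi>. norm \<xi> \<le> r} (snd w))"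
    and "(\<integral>w. h (fst w) * indicator {\<xi>. norm \<xi> \<le> r} (snd w) \<partial>\<Omega>) = (\<integral>w. h w \<partial>W) * innovation_mass r"
proof -
  interpret WL: pair_prob_space W lam
    using prob_W prob_lam by (simp add: pair_prob_space_def pair_sigma_finite_def prob_space_imp_sigma_finite)
  interpret lam: prob_space lam by (rule prob_lam)
  have d: "distr \<Omega> W fst = W" unfolding \<Omega>_def by (rule prob_space.distr_pair_fst[OF prob_lam])
  let ?f = "\<lambda>w. h (fst w) * indicator {\<xi>. norm \<xi> \<le> r} (snd w) :: real"
  have [measurable]: "h \<in> borel_measurable W" using h by simp
  have [measurable]: "{\<xi> :: 'a. norm \<xi> \<le> r} \<in> sets borel" by simp
  have "integrable \<Omega> (\<lambda>w. h (fst w))"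
    using h integrable_distr_eq[of fst \<Omega> W h] unfolding d by (simp add: \<Omega>_def)
  then show i: "integrable \<Omega> ?f"
    unfolding \<Omega>_def by (rule Bochner_Integration.integrable_bound) (auto split: split_indicator)
  have "(\<integral>w. ?f w \<partial>\<Omega>) = (\<integral>x. (\<integral>\<xi>. ?f (x, \<xi>) \<partial>lam) \<partial>W)"
    using WL.integral_fst'[of ?f] i unfolding \<Omega>_def by simp
  then show "(\<integral>w. ?f w \<partial>\<Omega>) = (\<integral>w. h w \<partial>W) * innovation_mass r"
    by (simp add: innovation_mass_def sets_lam)
qed

lemma V_proposal:
  assumes c: "0 \<le> c" "\<forall>x\<ge>0. \<forall>y\<ge>0. (x + y) ^ p \<le> 2 * x ^ p + c * y ^ p"
  shows "integrable \<Omega> (\<lambda>w. V (proposal1 w))" "(\<integral>w. V (proposal1 w) \<partial>\<Omega>) \<le> 2 * V u + c * mom"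
    and "integrable \<Omega> (\<lambda>w. V (proposal2 w))" "(\<integral>w. V (proposal2 w) \<partial>\<Omega>) \<le> 2 * V v + c * mom"
proof -
  interpret \<Omega>: prob_space \<Omega> by (rule prob_\<Omega>)
  note m = moment_pair[OF prob_W, folded \<Omega>_def]
  have g: "integrable \<Omega> (\<lambda>w. 2 * V x + c * norm (snd w) ^ p)"
    "(\<integral>w. 2 * V x + c * norm (snd w) ^ p \<partial>\<Omega>) = 2 * V x + c * mom" for x
    using m by (auto simp: \<Omega>.prob_space)
  have b: "V y \<le> 2 * V x + c * norm \<xi> ^ p" if "norm y \<le> norm x + norm \<xi>" for x y \<xi> :: 'a
  proof -
    have "V y \<le> (norm x + norm \<xi>) ^ p" unfolding V_def using that by (intro power_mono) auto
    also have "\<dots> \<le> 2 * V x + c * norm \<xi> ^ p" unfolding V_def using c(2) by simp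
    finally show ?thesis .
  qed
  have 1: "AE w in \<Omega>. V (proposal1 w) \<le> 2 * V u + c * norm (snd w) ^ p"
    and 2: "AE w in \<Omega>. V (proposal2 w) \<le> 2 * V v + c * norm (snd w) ^ p"
    using AE_proposal_norm by (eventually_elim; use b in blast)+
  show "integrable \<Omega> (\<lambda>w. V (proposal1 w))" "(\<integral>w. V (proposal1 w) \<partial>\<Omega>) \<le> 2 * V u + c * mom"
    using integral_le_of_AE_bounds[OF _ g(1)[of u] _ 1] unfolding g(2) by simp_all
  show "integrable \<Omega> (\<lambda>w. V (proposal2 w))" "(\<integral>w. V (proposal2 w) \<partial>\<Omega>) \<le> 2 * V v + c * mom"
    using integral_le_of_AE_bounds[OF _ g(1)[of v] _ 2] unfolding g(2) by simp_all
qed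

lemma move_V_proposal:
  assumes drift: "\<And>u. (\<integral>\<^sup>+w. ennreal (V w) \<partial>P u) \<le> ennreal (l * V u + c)" and l: "0 \<le> l" "0 \<le> c"
  shows "integrable \<Omega> (\<lambda>w. move u V (proposal1 w))" "(\<integral>w. move u V (proposal1 w) \<partial>\<Omega>) \<le> l * V u + c"
    and "integrable \<Omega> (\<lambda>w. move v V (proposal2 w))" "(\<integral>w. move v V (proposal2 w) \<partial>\<Omega>) \<le> l * V v + c"
proof -
  have pos: "0 \<le> l * V x + c" for x using l by simp
  have mv: "0 \<le> move x V w" for x w by (rule move_nonneg) simp
  have 1: "(\<integral>\<^sup>+w. ennreal (move u V (proposal1 w)) \<partial>\<Omega>) \<le> ennreal (l * V u + c)"
    using drift[of u] nn_integral_P_coupled(1)[OF coupling V_measurable] by (simp add: \<Omega>_def)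
  have 2: "(\<integral>\<^sup>+w. ennreal (move v V (proposal2 w)) \<partial>\<Omega>) \<le> ennreal (l * V v + c)"
    using drift[of v] nn_integral_P_coupled(2)[OF coupling V_measurable] by (simp add: \<Omega>_def)
  show "integrable \<Omega> (\<lambda>w. move u V (proposal1 w))"
    using 1 mv by (intro integrableI_nonneg) (auto simp: le_less_trans)
  show "integrable \<Omega> (\<lambda>w. move v V (proposal2 w))"
    using 2 mv by (intro integrableI_nonneg) (auto simp: le_less_trans)
  show "(\<integral>w. move u V (proposal1 w) \<partial>\<Omega>) \<le> l * V u + c"
    using 1 mv pos by (subst integral_eq_nn_integral) (auto intro: enn2real_leI)
  show "(\<integral>w. move v V (proposal2 w) \<partial>\<Omega>) \<le> l * V v + c"
    using 2 mv pos by (subst integral_eq_nn_integral) (auto intro: enn2real_leI)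
qed

text \<open>The conditional probabilities that both chains accept and that at least one of them does. Their
  difference is the probability of disagreement.\<close>

definition both_accept :: "('a \<times> 'a) \<times> 'a \<Rightarrow> real" where
  "both_accept w = min (accept u (proposal1 w)) (accept v (proposal2 w))"

definition some_accept :: "('a \<times> 'a) \<times> 'a \<Rightarrow> real" where
  "some_accept w = max (accept u (proposal1 w)) (accept v (proposal2 w))"

lemma acceptance_bounds: "0 \<le> both_accept w" "both_accept w \<le> some_accept w" "some_accept w \<le> 1"
  "both_accept w \<le> accept u (proposal1 w)" "both_accept w \<le> accept v (proposal2 w)"
  "accept u (proposal1 w) \<le> some_accept w" "accept v (proposal2 w) \<le> some_accept w"
  using accept_unit[of u "proposal1 w"] accept_unit[of v "proposal2 w"] by (auto simp: both_accept_def some_accept_def)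

lemma both_accept_measurable [measurable]: "both_accept \<in> borel_measurable ((borel \<Otimes>\<^sub>M borel) \<Otimes>\<^sub>M borel)"
  and some_accept_measurable [measurable]: "some_accept \<in> borel_measurable ((borel \<Otimes>\<^sub>M borel) \<Otimes>\<^sub>M borel)"
  unfolding both_accept_def[abs_def] some_accept_def[abs_def] by measurable

text \<open>The conditional expectation of \<open>\<parallel>x - y\<parallel> * (\<kappa> + V x + V y)\<close> after one step, restricted to the event
  that the chains agree and divided by \<open>\<parallel>u - v\<parallel>\<close>.\<close>

definition rescaled_cost :: "real \<Rightarrow> ('a \<times> 'a) \<times> 'a \<Rightarrow> real" where
  "rescaled_cost \<kappa> w = both_accept w * (\<rho> (fst w) * (\<kappa> + V (proposal1 w) + V (proposal2 w))) + (1 - some_accept w) * (\<kappa> + V u + V v)"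

lemma rescaled_cost_measurable [measurable]: "rescaled_cost \<kappa> \<in> borel_measurable ((borel \<Otimes>\<^sub>M borel) \<Otimes>\<^sub>M borel)"
  unfolding rescaled_cost_def[abs_def] by measurable

lemma rescaled_cost_nonneg: "0 \<le> \<kappa> \<Longrightarrow> 0 \<le> rescaled_cost \<kappa> w"
  unfolding rescaled_cost_def using acceptance_bounds[of w] by simp

text \<open>Only \<open>\<rho> \<le> 1\<close> is used here. The bound lies below \<open>\<kappa> + V u + V v\<close> when \<open>V u + V v\<close> is large.\<close>

lemma rescaled_cost_far:
  assumes drift: "\<And>u. (\<integral>\<^sup>+w. ennreal (V w) \<partial>P u) \<le> ennreal (l * V u + c)" and l: "0 \<le> l" "0 \<le> c"
    and \<kappa>: "0 \<le> \<kappa>"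
  shows "integrable \<Omega> (rescaled_cost \<kappa>)" "(\<integral>w. rescaled_cost \<kappa> w \<partial>\<Omega>) \<le> \<kappa> + l * (V u + V v) + 2 * c"
proof -
  interpret \<Omega>: prob_space \<Omega> by (rule prob_\<Omega>)
  note mv = move_V_proposal[OF drift l]
  let ?g = "\<lambda>w. \<kappa> + move u V (proposal1 w) + move v V (proposal2 w)"
  have g: "integrable \<Omega> ?g" using mv by simp
  have le: "AE w in \<Omega>. rescaled_cost \<kappa> w \<le> ?g w"
    using AE_\<rho>
  proof eventually_elim
    fix w :: "('a \<times> 'a) \<times> 'a" assume \<rho>: "\<rho> (fst w) \<le> 1"
    have "both_accept w * (\<rho> (fst w) * (\<kappa> + V (proposal1 w) + V (proposal2 w))) \<le> both_accept w * (\<kappa> + V (proposal1 w) + V (proposal2 w))"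
      using \<rho> \<kappa> acceptance_bounds[of w] by (intro mult_left_mono mult_left_le_one_le) auto
    then have "rescaled_cost \<kappa> w \<le> both_accept w * (\<kappa> + V (proposal1 w) + V (proposal2 w)) + (1 - some_accept w) * (\<kappa> + V u + V v)"
      by (simp add: rescaled_cost_def)
    also have "\<dots> = (both_accept w + (1 - some_accept w)) * \<kappa> + (both_accept w * V (proposal1 w) + (1 - some_accept w) * V u) + (both_accept w * V (proposal2 w) + (1 - some_accept w) * V v)"
      by (simp add: algebra_simps)
    also have "\<dots> \<le> 1 * \<kappa> + (accept u (proposal1 w) * V (proposal1 w) + (1 - accept u (proposal1 w)) * V u)
        + (accept v (proposal2 w) * V (proposal2 w) + (1 - accept v (proposal2 w)) * V v)"
      using acceptance_bounds[of w] \<kappa> by (intro add_mono mult_right_mono) auto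
    finally show "rescaled_cost \<kappa> w \<le> ?g w" by (simp add: move_def)
  qed
  show "integrable \<Omega> (rescaled_cost \<kappa>)"
    by (rule integral_le_of_AE_bounds(1)[OF _ g _ le]) (auto simp: rescaled_cost_nonneg \<kappa>)
  have "(\<integral>w. rescaled_cost \<kappa> w \<partial>\<Omega>) \<le> (\<integral>w. ?g w \<partial>\<Omega>)"
    by (rule integral_le_of_AE_bounds(2)[OF _ g _ le]) (auto simp: rescaled_cost_nonneg \<kappa>)
  also have "\<dots> = \<kappa> + (\<integral>w. move u V (proposal1 w) \<partial>\<Omega>) + (\<integral>w. move v V (proposal2 w) \<partial>\<Omega>)"
    using mv by (simp add: \<Omega>.prob_space)
  also have "\<dots> \<le> \<kappa> + (l * V u + c) + (l * V v + c)" using mv by (intro add_mono) auto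
  finally show "(\<integral>w. rescaled_cost \<kappa> w \<partial>\<Omega>) \<le> \<kappa> + l * (V u + V v) + 2 * c" by (simp add: algebra_simps)
qed

lemma both_accept_ge:
  assumes "\<forall>w. norm w \<le> norm u + r \<longrightarrow> a \<le> accept u w" "\<forall>w. norm w \<le> norm v + r \<longrightarrow> a \<le> accept v w" "0 \<le> a"
  shows "AE w in \<Omega>. a * indicator {\<xi>. norm \<xi> \<le> r} (snd w) \<le> both_accept w"
  using AE_proposal_norm
proof eventually_elim
  fix w :: "('a \<times> 'a) \<times> 'a"
  assume w: "norm (proposal1 w) \<le> norm u + norm (snd w) \<and> norm (proposal2 w) \<le> norm v + norm (snd w)"
  show "a * indicator {\<xi>. norm \<xi> \<le> r} (snd w) \<le> both_accept w"
  proof (cases "norm (snd w) \<le> r")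
    case True
    then show ?thesis using w assms(1)[rule_format, of "proposal1 w"] assms(2)[rule_format, of "proposal2 w"] by (simp add: both_accept_def)
  next
    case False
    then show ?thesis using acceptance_bounds[of w] by simp
  qed
qed

text \<open>The mean contraction, accepted with probability at least \<open>a\<close> for small innovations, yields a factor
  below one. The weights may grow, but only by an amount that does not depend on \<open>\<kappa>\<close>.\<close>

lemma rescaled_cost_near:
  assumes a: "\<forall>w. norm w \<le> norm u + r \<longrightarrow> a \<le> accept u w" "\<forall>w. norm w \<le> norm v + r \<longrightarrow> a \<le> accept v w" "0 \<le> a"
    and c: "0 \<le> c" "\<forall>x\<ge>0. \<forall>y\<ge>0. (x + y) ^ p \<le> 2 * x ^ p + c * y ^ p"
    and \<kappa>: "0 \<le> \<kappa>"
  shows "(\<integral>w. rescaled_cost \<kappa> w \<partial>\<Omega>) \<le> (\<kappa> + V u + V v) * (1 - a * (innovation_mass r * (1 - \<beta>c))) + (2 * (V u + V v) + 2 * (c * mom))"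
proof -
  interpret \<Omega>: prob_space \<Omega> by (rule prob_\<Omega>)
  interpret W: prob_space W by (rule prob_W)
  note vp = V_proposal[OF c]
  have h: "integrable W (\<lambda>w. 1 - \<rho> w)" using \<rho>_mean(1) by simp
  note pi = product_integral[OF h, of r]
  let ?i = "\<lambda>w. (1 - \<rho> (fst w)) * indicator {\<xi>. norm \<xi> \<le> r} (snd w) :: real"
  let ?N = "\<kappa> + V u + V v"
  let ?g = "\<lambda>w. ?N * (1 - a * ?i w) + (V (proposal1 w) + V (proposal2 w))"
  have g: "integrable \<Omega> ?g" using vp pi by simp
  have le: "AE w in \<Omega>. rescaled_cost \<kappa> w \<le> ?g w"
    using AE_\<rho> both_accept_ge[OF a]
  proof eventually_elim
    fix w :: "('a \<times> 'a) \<times> 'a"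
    assume \<rho>: "\<rho> (fst w) \<le> 1" and bo: "a * indicator {\<xi>. norm \<xi> \<le> r} (snd w) \<le> both_accept w"
    have br: "both_accept w * \<rho> (fst w) \<le> 1" using acceptance_bounds[of w] \<rho> by (intro mult_le_one) auto
    have "rescaled_cost \<kappa> w = both_accept w * \<rho> (fst w) * (\<kappa> + V (proposal1 w) + V (proposal2 w)) + (1 - some_accept w) * ?N"
      by (simp add: rescaled_cost_def mult.assoc)
    also have "\<dots> \<le> both_accept w * \<rho> (fst w) * (?N + (V (proposal1 w) + V (proposal2 w))) + (1 - both_accept w) * ?N"
    proof (rule add_mono)
      show "both_accept w * \<rho> (fst w) * (\<kappa> + V (proposal1 w) + V (proposal2 w)) \<le> both_accept w * \<rho> (fst w) * (?N + (V (proposal1 w) + V (proposal2 w)))"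
        using acceptance_bounds[of w] by (intro mult_left_mono) auto
      show "(1 - some_accept w) * ?N \<le> (1 - both_accept w) * ?N"
        using acceptance_bounds[of w] \<kappa> by (intro mult_right_mono) auto
    qed
    also have "\<dots> = ?N * (1 - both_accept w * (1 - \<rho> (fst w))) + both_accept w * \<rho> (fst w) * (V (proposal1 w) + V (proposal2 w))"
      by (simp add: algebra_simps)
    also have "\<dots> \<le> ?N * (1 - a * indicator {\<xi>. norm \<xi> \<le> r} (snd w) * (1 - \<rho> (fst w))) + 1 * (V (proposal1 w) + V (proposal2 w))"
      using \<rho> \<kappa> br by (intro add_mono mult_left_mono diff_left_mono mult_right_mono bo) auto
    finally show "rescaled_cost \<kappa> w \<le> ?g w" by (simp add: mult_ac)
  qed
  have "(\<integral>w. rescaled_cost \<kappa> w \<partial>\<Omega>) \<le> (\<integral>w. ?g w \<partial>\<Omega>)"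
    by (rule integral_le_of_AE_bounds(2)[OF _ g _ le]) (auto simp: rescaled_cost_nonneg \<kappa>)
  also have "\<dots> = ?N * (1 - a * (\<integral>w. ?i w \<partial>\<Omega>)) + ((\<integral>w. V (proposal1 w) \<partial>\<Omega>) + (\<integral>w. V (proposal2 w) \<partial>\<Omega>))"
    using vp pi by (simp add: \<Omega>.prob_space)
  also have "(\<integral>w. ?i w \<partial>\<Omega>) = (1 - (\<integral>w. \<rho> w \<partial>W)) * innovation_mass r"
    unfolding pi(2) using \<rho>_mean(1) by (simp add: W.prob_space)
  also have "?N * (1 - a * ((1 - (\<integral>w. \<rho> w \<partial>W)) * innovation_mass r)) + ((\<integral>w. V (proposal1 w) \<partial>\<Omega>) + (\<integral>w. V (proposal2 w) \<partial>\<Omega>))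
      \<le> ?N * (1 - a * (innovation_mass r * (1 - \<beta>c))) + ((2 * V u + c * mom) + (2 * V v + c * mom))"
  proof (intro add_mono mult_left_mono diff_left_mono)
    show "innovation_mass r * (1 - \<beta>c) \<le> (1 - (\<integral>w. \<rho> w \<partial>W)) * innovation_mass r"
      using \<rho>_mean(2) by (subst mult.commute) (intro mult_right_mono, auto simp: innovation_mass_def)
  qed (use vp a \<kappa> in auto)
  finally show ?thesis by (simp add: algebra_simps)
qed

text \<open>The Lipschitz constant of \<open>\<Psi>\<close> has the same weight \<open>1 + V u + V v\<close> as the scaled distance, so
  disagreement is controlled by that distance.\<close>

lemma mismatch:
  assumes L: "0 \<le> L" "\<And>a b. \<bar>\<Psi> a - \<Psi> b\<bar> \<le> L * (1 + V a + V b) * norm (a - b)"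
    and c: "0 \<le> c" "\<forall>x\<ge>0. \<forall>y\<ge>0. (x + y) ^ p \<le> 2 * x ^ p + c * y ^ p"
  shows "integrable \<Omega> (\<lambda>w. some_accept w - both_accept w)"
    and "(\<integral>w. some_accept w - both_accept w \<partial>\<Omega>) \<le> L * norm (u - v) * (2 + 3 * (V u + V v) + 2 * (c * mom))"
proof -
  interpret \<Omega>: prob_space \<Omega> by (rule prob_\<Omega>)
  note vp = V_proposal[OF c]
  let ?t = "norm (u - v)"
  let ?g = "\<lambda>w. L * ?t * (2 + (V u + V v) + (V (proposal1 w) + V (proposal2 w)))"
  have g: "integrable \<Omega> ?g" using vp by simp
  have le: "AE w in \<Omega>. some_accept w - both_accept w \<le> ?g w"
    using AE_\<rho>
  proof eventually_elim
    fix w :: "('a \<times> 'a) \<times> 'a" assume \<rho>: "\<rho> (fst w) \<le> 1"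
    let ?a = "proposal1 w" and ?b = "proposal2 w"
    have "some_accept w - both_accept w = \<bar>accept u ?a - accept v ?b\<bar>" by (simp add: some_accept_def both_accept_def)
    also have "\<dots> \<le> \<bar>(\<Psi> u - \<Psi> ?a) - (\<Psi> v - \<Psi> ?b)\<bar>"
      unfolding mh_accept_def by (rule min_1_exp_lipschitz)
    also have "\<dots> \<le> \<bar>\<Psi> u - \<Psi> v\<bar> + \<bar>\<Psi> ?a - \<Psi> ?b\<bar>" by linarith
    also have "\<dots> \<le> L * (1 + V u + V v) * ?t + L * (1 + V ?a + V ?b) * norm (?a - ?b)"
      by (intro add_mono L)
    also have "norm (?a - ?b) \<le> ?t" unfolding proposal_diff using \<rho> by (intro mult_left_le) auto
    finally have "some_accept w - both_accept w \<le> L * (1 + V u + V v) * ?t + L * (1 + V ?a + V ?b) * ?t"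
      using L by (simp add: mult_left_mono)
    then show "some_accept w - both_accept w \<le> ?g w" by (simp add: algebra_simps)
  qed
  have pos: "AE w in \<Omega>. 0 \<le> some_accept w - both_accept w" using acceptance_bounds(2) by auto
  show "integrable \<Omega> (\<lambda>w. some_accept w - both_accept w)"
    by (rule integral_le_of_AE_bounds(1)[OF _ g pos le]) measurable
  have "(\<integral>w. some_accept w - both_accept w \<partial>\<Omega>) \<le> (\<integral>w. ?g w \<partial>\<Omega>)"
    by (rule integral_le_of_AE_bounds(2)[OF _ g pos le]) measurable
  also have "\<dots> = L * ?t * (2 + (V u + V v) + ((\<integral>w. V (proposal1 w) \<partial>\<Omega>) + (\<integral>w. V (proposal2 w) \<partial>\<Omega>)))"
    using vp by (simp add: \<Omega>.prob_space)
  also have "\<dots> \<le> L * ?t * (2 + (V u + V v) + ((2 * V u + c * mom) + (2 * V v + c * mom)))"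
    using vp L by (intro mult_left_mono add_left_mono add_mono) auto
  finally show "(\<integral>w. some_accept w - both_accept w \<partial>\<Omega>) \<le> L * ?t * (2 + 3 * (V u + V v) + 2 * (c * mom))"
    by (simp add: algebra_simps)
qed

text \<open>Markov's inequality for \<open>\<rho>\<close>.\<close>

lemma close_proposals:
  assumes s: "\<beta>c < s"
  shows "1 - \<beta>c / s \<le> (\<integral>w. indicator {w. \<rho> w \<le> s} w \<partial>W)" "integrable W (indicator {w. \<rho> w \<le> s} :: _ \<Rightarrow> real)"
proof -
  interpret W: prob_space W by (rule prob_W)
  have s0: "0 < s" using s \<beta>c by simp
  have S: "{w. \<rho> w \<le> s} \<in> sets W"
  proof -
    have "{w \<in> space (borel \<Otimes>\<^sub>M borel :: ('a \<times> 'a) measure). \<rho> w \<le> s} \<in> sets (borel \<Otimes>\<^sub>M borel)" by measurable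
    then show ?thesis by (simp add: sets_W space_pair_measure)
  qed
  show i: "integrable W (indicator {w. \<rho> w \<le> s} :: _ \<Rightarrow> real)"
    using S by (intro W.integrable_const_bound[where B=1]) auto
  have "1 - \<beta>c / s \<le> (\<integral>w. 1 - \<rho> w / s \<partial>W)"
    using \<rho>_mean s0 by (simp add: W.prob_space divide_right_mono)
  also have "\<dots> \<le> (\<integral>w. indicator {w. \<rho> w \<le> s} w \<partial>W)"
  proof (rule integral_mono[OF _ i])
    show "1 - \<rho> w / s \<le> indicator {w. \<rho> w \<le> s} w" for w
      using s0 by (auto simp: indicator_def field_simps)
  qed (use \<rho>_mean in simp)
  finally show "1 - \<beta>c / s \<le> (\<integral>w. indicator {w. \<rho> w \<le> s} w \<partial>W)" .
qed

text \<open>With a probability bounded below, both chains accept and arrive at a pair that is closer by the factor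
  \<open>s\<close> and has norms larger by at most \<open>r\<close>.\<close>

lemma meeting_step:
  assumes a: "\<forall>w. norm w \<le> norm u + r \<longrightarrow> a \<le> accept u w" "\<forall>w. norm w \<le> norm v + r \<longrightarrow> a \<le> accept v w" "0 \<le> a"
    and s: "\<beta>c < s"
    and g [measurable]: "(\<lambda>(x, y). g x y) \<in> borel_measurable (borel \<Otimes>\<^sub>M borel)"
    and g_unit: "\<And>x y. 0 \<le> g x y \<and> g x y \<le> 1"
    and \<gamma>: "0 \<le> \<gamma>" "\<And>x y. norm x \<le> norm u + r \<Longrightarrow> norm y \<le> norm v + r \<Longrightarrow> norm (x - y) \<le> s * norm (u - v) \<Longrightarrow> \<gamma> \<le> g x y"
  shows "integrable \<Omega> (\<lambda>w. 1 - both_accept w * g (proposal1 w) (proposal2 w))"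
    and "(\<integral>w. 1 - both_accept w * g (proposal1 w) (proposal2 w) \<partial>\<Omega>) \<le> 1 - a * \<gamma> * ((1 - \<beta>c / s) * innovation_mass r)"
proof -
  interpret \<Omega>: prob_space \<Omega> by (rule prob_\<Omega>)
  note cp = close_proposals[OF s]
  note pi = product_integral[OF cp(2), of r]
  let ?i = "\<lambda>w. indicator {w. \<rho> w \<le> s} (fst w) * indicator {\<xi>. norm \<xi> \<le> r} (snd w) :: real"
  let ?f = "\<lambda>w. 1 - both_accept w * g (proposal1 w) (proposal2 w)"
  have bg: "0 \<le> both_accept w * g (proposal1 w) (proposal2 w)" "both_accept w * g (proposal1 w) (proposal2 w) \<le> 1" for w
    using acceptance_bounds[of w] g_unit[of "proposal1 w" "proposal2 w"] by (auto intro!: mult_le_one)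
  have G: "integrable \<Omega> (\<lambda>w. 1 - a * \<gamma> * ?i w)" using pi(1) by simp
  have le: "AE w in \<Omega>. ?f w \<le> 1 - a * \<gamma> * ?i w"
    using AE_proposal_norm both_accept_ge[OF a]
  proof eventually_elim
    fix w :: "('a \<times> 'a) \<times> 'a"
    assume w: "norm (proposal1 w) \<le> norm u + norm (snd w) \<and> norm (proposal2 w) \<le> norm v + norm (snd w)"
      and bo: "a * indicator {\<xi>. norm \<xi> \<le> r} (snd w) \<le> both_accept w"
    show "?f w \<le> 1 - a * \<gamma> * ?i w"
    proof (cases "\<rho> (fst w) \<le> s \<and> norm (snd w) \<le> r")
      case True
      have "norm (proposal1 w - proposal2 w) \<le> s * norm (u - v)"
        unfolding proposal_diff using True by (subst mult.commute) (intro mult_right_mono, auto)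
      then have "\<gamma> \<le> g (proposal1 w) (proposal2 w)" using True w by (intro \<gamma>(2)) auto
      then have "a * \<gamma> \<le> both_accept w * g (proposal1 w) (proposal2 w)"
        using True bo a \<gamma> acceptance_bounds[of w] by (intro mult_mono) auto
      then show ?thesis using True by simp
    next
      case False
      then have i0: "?i w = 0" by (auto simp: indicator_def)
      show ?thesis unfolding i0 using bg(1)[of w] by simp
    qed
  qed
  have pos: "AE w in \<Omega>. 0 \<le> ?f w" using bg(2) by auto
  have [measurable]: "(\<lambda>w. g (proposal1 w) (proposal2 w)) \<in> borel_measurable \<Omega>" by measurable
  show "integrable \<Omega> ?f" by (rule integral_le_of_AE_bounds(1)[OF _ G pos le]) measurable
  have "(\<integral>w. ?f w \<partial>\<Omega>) \<le> (\<integral>w. 1 - a * \<gamma> * ?i w \<partial>\<Omega>)"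
    by (rule integral_le_of_AE_bounds(2)[OF _ G pos le]) measurable
  also have "\<dots> = 1 - a * \<gamma> * ((\<integral>w. indicator {w. \<rho> w \<le> s} w \<partial>W) * innovation_mass r)"
    using pi by (simp add: \<Omega>.prob_space)
  also have "\<dots> \<le> 1 - a * \<gamma> * ((1 - \<beta>c / s) * innovation_mass r)"
    using cp(1) a \<gamma> by (intro diff_left_mono mult_left_mono mult_right_mono) (auto simp: innovation_mass_def)
  finally show "(\<integral>w. ?f w \<partial>\<Omega>) \<le> 1 - a * \<gamma> * ((1 - \<beta>c / s) * innovation_mass r)" .
qed

end

section \<open>A contracting cost\<close>

lemma exponential_beats_power:
  fixes s :: real
  assumes s: "0 < s" "s < 1" and p: "1 \<le> p"
  shows "(\<lambda>n. (A + B * real n) ^ p * s ^ n) \<longlonglongrightarrow> 0"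
proof -
  define \<sigma> where "\<sigma> = root p s"
  have \<sigma>p: "\<sigma> ^ p = s" using s p by (simp add: \<sigma>_def)
  have \<sigma>: "0 < \<sigma>" "\<sigma> < 1" using s p by (auto simp: \<sigma>_def)
  have "(\<lambda>n. A * \<sigma> ^ n + B * (real n * \<sigma> ^ n)) \<longlonglongrightarrow> A * 0 + B * 0"
    using \<sigma> by (intro tendsto_intros LIMSEQ_realpow_zero powser_times_n_limit_0) auto
  then have "(\<lambda>n. (A * \<sigma> ^ n + B * (real n * \<sigma> ^ n)) ^ p) \<longlonglongrightarrow> (A * 0 + B * 0) ^ p"
    by (rule tendsto_power)
  moreover have "(A * \<sigma> ^ n + B * (real n * \<sigma> ^ n)) ^ p = (A + B * real n) ^ p * s ^ n" for n
  proof -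
    have "A * \<sigma> ^ n + B * (real n * \<sigma> ^ n) = (A + B * real n) * \<sigma> ^ n" by (simp add: algebra_simps)
    then show ?thesis by (simp add: power_mult_distrib \<sigma>p[symmetric] power_mult[symmetric] mult.commute)
  qed
  moreover have "(0 :: real) ^ p = 0" using p by (simp add: power_0_left)
  ultimately show ?thesis by simp
qed

context rcar_coupled
begin

lemma coupled_cost_le_parts:
  assumes "\<And>x y. d x y \<le> 1"
  shows "coupled_cost d u v (proposal1 w) (proposal2 w) \<le> both_accept w * d (proposal1 w) (proposal2 w) + (1 - some_accept w) * d u v + (some_accept w - both_accept w)"
proof -
  let ?a = "accept u (proposal1 w)" and ?b = "accept v (proposal2 w)"
  have "max 0 (?a - ?b) * d (proposal1 w) v + max 0 (?b - ?a) * d u (proposal2 w) \<le> max 0 (?a - ?b) * 1 + max 0 (?b - ?a) * 1"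
    using assms by (intro add_mono mult_left_mono) auto
  also have "\<dots> = some_accept w - both_accept w" by (auto simp: some_accept_def both_accept_def)
  finally show ?thesis by (simp add: coupled_cost_def both_accept_def some_accept_def)
qed

text \<open>Suited to small distances, where disagreement may cost as much as one.\<close>

lemma coupled_cost_le_rescaled:
  assumes d: "\<And>x y. d x y \<le> 1" "\<And>x y. d x y \<le> norm (x - y) * (\<kappa> + V x + V y) / \<epsilon>" and \<epsilon>: "0 < \<epsilon>"
  shows "coupled_cost d u v (proposal1 w) (proposal2 w) \<le> norm (u - v) / \<epsilon> * rescaled_cost \<kappa> w + (some_accept w - both_accept w)"
proof -
  have "both_accept w * d (proposal1 w) (proposal2 w) + (1 - some_accept w) * d u v
      \<le> both_accept w * (norm (proposal1 w - proposal2 w) * (\<kappa> + V (proposal1 w) + V (proposal2 w)) / \<epsilon>)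
        + (1 - some_accept w) * (norm (u - v) * (\<kappa> + V u + V v) / \<epsilon>)"
    using acceptance_bounds[of w] by (intro add_mono mult_left_mono d) auto
  also have "\<dots> = norm (u - v) / \<epsilon> * rescaled_cost \<kappa> w"
    unfolding proposal_diff using \<epsilon> by (simp add: rescaled_cost_def field_simps)
  finally show ?thesis using coupled_cost_le_parts[of d w, OF d(1)] by linarith
qed

text \<open>Suited to large distances, where only a chance to come close is exploited.\<close>

lemma coupled_cost_le_overlap:
  assumes d: "\<And>x y. d x y \<le> 1 - g x y" and g: "\<And>x y. 0 \<le> g x y"
  shows "coupled_cost d u v (proposal1 w) (proposal2 w) \<le> 1 - both_accept w * g (proposal1 w) (proposal2 w)"
proof -
  have d1: "d x y \<le> 1" for x y using d[of x y] g[of x y] by linarith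
  have "both_accept w * d (proposal1 w) (proposal2 w) + (1 - some_accept w) * d u v \<le> both_accept w * (1 - g (proposal1 w) (proposal2 w)) + (1 - some_accept w) * 1"
    using acceptance_bounds[of w] by (intro add_mono mult_left_mono d d1) auto
  then show ?thesis using coupled_cost_le_parts[of d w, OF d1] by (simp add: algebra_simps)
qed

lemma coupled_cost_integrable:
  assumes [measurable]: "(\<lambda>(x, y). d x y) \<in> borel_measurable (borel \<Otimes>\<^sub>M borel)"
    and d: "\<And>x y. 0 \<le> d x y \<and> d x y \<le> 1"
  shows "integrable \<Omega> (\<lambda>w. coupled_cost d u v (proposal1 w) (proposal2 w))" "(\<integral>w. coupled_cost d u v (proposal1 w) (proposal2 w) \<partial>\<Omega>) \<le> 1"
proof -
  interpret \<Omega>: prob_space \<Omega> by (rule prob_\<Omega>)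
  have pos: "0 \<le> coupled_cost d u v (proposal1 w) (proposal2 w)" for w
    unfolding coupled_cost_def using d accept_unit[of u "proposal1 w"] accept_unit[of v "proposal2 w"]
    by (intro add_nonneg_nonneg mult_nonneg_nonneg) auto
  have le: "coupled_cost d u v (proposal1 w) (proposal2 w) \<le> 1" for w
    using coupled_cost_le_overlap[of d "\<lambda>_ _. 0" w] d by simp
  have m: "(\<lambda>w. coupled_cost d u v (proposal1 w) (proposal2 w)) \<in> borel_measurable \<Omega>"
    by (rule coupled_cost_measurable) measurable
  show i: "integrable \<Omega> (\<lambda>w. coupled_cost d u v (proposal1 w) (proposal2 w))"
    using m pos le by (intro \<Omega>.integrable_const_bound[where B=1]) auto
  show "(\<integral>w. coupled_cost d u v (proposal1 w) (proposal2 w) \<partial>\<Omega>) \<le> 1"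
    using i le by (intro \<Omega>.integral_le_const) auto
qed

end

text \<open>The form of the assumptions on \<open>\<Psi>\<close> and \<open>K\<close> in which they enter the contraction argument: the
  Lipschitz weight is expressed by \<open>V\<close>, and the drift and a local lower bound for the acceptance
  probability have been extracted.\<close>

locale rcar_ergodic = rcar_moment +
  fixes L l c \<beta>c :: real and W :: "'a \<Rightarrow> 'a \<Rightarrow> ('a \<times> 'a) measure"
  assumes L: "0 \<le> L" and \<Psi>_lipschitz: "\<bar>\<Psi> a - \<Psi> b\<bar> \<le> L * (1 + V a + V b) * norm (a - b)"
    and l: "0 \<le> l" "l < 1" and c: "0 \<le> c"
    and drift_P: "(\<integral>\<^sup>+w. ennreal (V w) \<partial>P u) \<le> ennreal (l * V u + c)"
    and accept_below: "\<exists>a>0. \<forall>u w. norm u \<le> R \<longrightarrow> norm w \<le> R \<longrightarrow> a \<le> accept u w"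
    and \<beta>c: "0 < \<beta>c" "\<beta>c < 1"
    and coupling_W: "is_coupling (W u v) (K u) (K v)"
    and nonexpansive_W: "u \<noteq> v \<Longrightarrow> AE w in W u v. norm (fst w - snd w) \<le> norm (u - v)"
    and contractive_W: "u \<noteq> v \<Longrightarrow>
      (\<integral>\<^sup>+w. ennreal (norm (fst w - snd w)) \<partial>W u v) \<le> ennreal (\<beta>c * norm (u - v))"
begin

lemma coupled: "u \<noteq> v \<Longrightarrow> rcar_coupled \<Psi> K lam p (W u v) u v \<beta>c"
  by unfold_locales (auto intro: coupling_W nonexpansive_W contractive_W \<beta>c)

abbreviation step_cost :: "('a \<Rightarrow> 'a \<Rightarrow> real) \<Rightarrow> 'a \<Rightarrow> 'a \<Rightarrow> real" where
  "step_cost d u v \<equiv> (\<integral>w. coupled_cost d u v (proposal1 w) (proposal2 w) \<partial>(W u v \<Otimes>\<^sub>M lam))"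

text \<open>A large \<open>\<kappa>\<close> makes the growth of the weights in a bounded region negligible against the contraction
  there, and afterwards a small \<open>\<epsilon>\<close> does the same for the disagreement. The bound on \<open>d\<close> is the scaled
  distance itself, so the estimate applies to every truncation of it.\<close>

lemma small_scale_contraction:
  assumes S: "0 < S" and l2: "\<And>N. S \<le> N \<Longrightarrow> l * N + 2 * c \<le> (1 + l) / 2 * N"
  shows "\<exists>\<kappa> \<epsilon> \<alpha>. 1 \<le> \<kappa> \<and> 0 < \<epsilon> \<and> \<epsilon> \<le> 1 \<and> 0 \<le> \<alpha> \<and> \<alpha> < 1 \<and>
    (\<forall>d u v. (\<lambda>(x, y). d x y) \<in> borel_measurable (borel \<Otimes>\<^sub>M borel) \<longrightarrow>
      (\<forall>x y. 0 \<le> d x y \<and> d x y \<le> 1 \<and> d x y \<le> norm (x - y) * (\<kappa> + V x + V y) / \<epsilon>) \<longrightarrow> u \<noteq> v \<longrightarrow>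
      step_cost d u v \<le> \<alpha> * (norm (u - v) * (\<kappa> + V u + V v) / \<epsilon>))"
proof -
  obtain c2 :: real where c2: "0 \<le> c2" "\<forall>x\<ge>0. \<forall>y\<ge>0. (x + y) ^ p \<le> 2 * x ^ p + c2 * y ^ p"
    using power_add_le[of 1 p] by auto
  obtain r where r: "0 < r" "0 < measure lam {\<xi>. norm \<xi> \<le> r}"
    using cball_positive_measure[OF prob_lam sets_lam] by blast
  define \<phi> where "\<phi> = measure lam {\<xi>. norm \<xi> \<le> r}"
  define R where "R = max 1 S"
  obtain a where a: "0 < a" "\<And>u w. norm u \<le> R + r \<Longrightarrow> norm w \<le> R + r \<Longrightarrow> a \<le> accept u w"
    using accept_below[of "R + r"] by blast
  define c3 where "c3 = a * (\<phi> * (1 - \<beta>c))"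
  have c3: "0 < c3" using a r \<beta>c by (simp add: c3_def \<phi>_def)
  define \<kappa> where "\<kappa> = max 1 ((4 * S + 4 * (c2 * mom)) / c3)"
  have \<kappa>: "1 \<le> \<kappa>" by (simp add: \<kappa>_def)
  have "(4 * S + 4 * (c2 * mom)) / c3 \<le> \<kappa>" by (simp add: \<kappa>_def)
  then have \<kappa>3: "2 * S + 2 * (c2 * mom) \<le> \<kappa> * c3 / 2" using c3 by (simp add: field_simps)
  define l2' where "l2' = (1 + l) / 2"
  have l2': "0 \<le> l2'" "l2' < 1" using l by (auto simp: l2'_def)
  define q1 where "q1 = (\<kappa> + l2' * S) / (\<kappa> + S)"
  have q1: "0 \<le> q1" "q1 < 1"
    using \<kappa> S l2' by (auto simp: q1_def divide_less_eq)
  define q where "q = max q1 (1 - c3 / 2)"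
  have q: "0 \<le> q" "q < 1" using q1 c3 by (auto simp: q_def)
  define D2 where "D2 = 3 + 2 * (c2 * mom)"
  have D2: "0 < D2" using c2 by (auto simp: D2_def intro!: add_pos_nonneg)
  define \<epsilon> where "\<epsilon> = min 1 ((1 - q) / (2 * (L * D2 + 1)))"
  have LD: "0 < L * D2 + 1" using L D2 by (intro add_nonneg_pos) auto
  have \<epsilon>: "0 < \<epsilon>" "\<epsilon> \<le> 1" using q LD by (auto simp: \<epsilon>_def)
  have half: "x / (2 * y) * y = x / 2" if "0 < y" for x y :: real using that by simp
  have "\<epsilon> * (L * D2 + 1) \<le> (1 - q) / (2 * (L * D2 + 1)) * (L * D2 + 1)"
    using LD by (intro mult_right_mono) (auto simp: \<epsilon>_def)
  also have "\<dots> = (1 - q) / 2" by (rule half[OF LD])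
  finally have \<epsilon>q: "q + \<epsilon> * (L * D2) \<le> (1 + q) / 2" using \<epsilon> by (simp add: algebra_simps)
  have "step_cost d u v \<le> (1 + q) / 2 * (norm (u - v) * (\<kappa> + V u + V v) / \<epsilon>)"
    if dm: "(\<lambda>(x, y). d x y) \<in> borel_measurable (borel \<Otimes>\<^sub>M borel)"
      and d: "\<forall>x y. 0 \<le> d x y \<and> d x y \<le> 1 \<and> d x y \<le> norm (x - y) * (\<kappa> + V x + V y) / \<epsilon>"
      and uv: "u \<noteq> v" for d u v
  proof -
    interpret c: rcar_coupled \<Psi> K lam p "W u v" u v \<beta>c by (rule coupled[OF uv])
    have innovation_mass: "c.innovation_mass r = \<phi>" by (simp add: c.innovation_mass_def \<phi>_def)
    let ?N = "V u + V v" and ?t = "norm (u - v)"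
    have \<kappa>0: "0 \<le> \<kappa>" using \<kappa> by simp
    note far = c.rescaled_cost_far[OF drift_P l(1) c \<kappa>0]
    have rescaled_cost: "(\<integral>w. c.rescaled_cost \<kappa> w \<partial>c.\<Omega>) \<le> q * (\<kappa> + ?N)"
    proof (cases "S \<le> ?N")
      case True
      have "(\<integral>w. c.rescaled_cost \<kappa> w \<partial>c.\<Omega>) \<le> \<kappa> + l2' * ?N"
        using far(2) l2[OF True] by (simp add: l2'_def)
      also have "\<dots> \<le> q1 * (\<kappa> + ?N)"
      proof -
        have "0 \<le> \<kappa> * (1 - l2') * (?N - S)" using \<kappa> l2' True by (intro mult_nonneg_nonneg) auto
        then have "(\<kappa> + l2' * ?N) * (\<kappa> + S) \<le> (\<kappa> + l2' * S) * (\<kappa> + ?N)" by (simp add: algebra_simps)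
        then show ?thesis using \<kappa> S by (simp add: q1_def pos_le_divide_eq)
      qed
      also have "\<dots> \<le> q * (\<kappa> + ?N)" using \<kappa> by (intro mult_right_mono) (auto simp: q_def)
      finally show ?thesis .
    next
      case False
      then have "V u \<le> S" "V v \<le> S" using V_nonneg[of u] V_nonneg[of v] by linarith+
      then have uR: "norm u \<le> R" "norm v \<le> R" using norm_le_of_V_le by (auto simp: R_def)
      have A: "\<forall>w. norm w \<le> norm u + r \<longrightarrow> a \<le> accept u w" "\<forall>w. norm w \<le> norm v + r \<longrightarrow> a \<le> accept v w"
        using uR r a(2) by auto
      have "(\<integral>w. c.rescaled_cost \<kappa> w \<partial>c.\<Omega>) \<le> (\<kappa> + V u + V v) * (1 - a * (\<phi> * (1 - \<beta>c))) + (2 * ?N + 2 * (c2 * mom))"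
        using c.rescaled_cost_near[OF A _ c2 \<kappa>0] a(1) unfolding innovation_mass by simp
      also have "\<dots> = (\<kappa> + ?N) * (1 - c3) + (2 * ?N + 2 * (c2 * mom))" by (simp add: c3_def add.assoc)
      also have "\<dots> \<le> (\<kappa> + ?N) * (1 - c3) + \<kappa> * c3 / 2" using False \<kappa>3 by simp
      also have "\<dots> \<le> (\<kappa> + ?N) * (1 - c3) + (\<kappa> + ?N) * (c3 / 2)" using c3 by (simp add: mult_right_mono)
      also have "\<dots> = (\<kappa> + ?N) * (1 - c3 / 2)" by (simp add: algebra_simps)
      also have "\<dots> \<le> (\<kappa> + ?N) * q" using \<kappa> by (intro mult_left_mono) (auto simp: q_def)
      finally show ?thesis by (simp add: mult.commute)
    qed
    note mm = c.mismatch[OF L \<Psi>_lipschitz c2]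
    have "2 + 3 * ?N + 2 * (c2 * mom) \<le> D2 * (\<kappa> + ?N)"
    proof -
      have "2 + 3 * ?N + 2 * (c2 * mom) \<le> D2 * (1 + ?N)"
        using c2 V_nonneg[of u] V_nonneg[of v] by (simp add: D2_def algebra_simps)
      also have "\<dots> \<le> D2 * (\<kappa> + ?N)" using \<kappa> D2 by (intro mult_left_mono) auto
      finally show ?thesis .
    qed
    then have mm': "(\<integral>w. c.some_accept w - c.both_accept w \<partial>c.\<Omega>) \<le> L * ?t * (D2 * (\<kappa> + ?N))"
      using L by (intro order_trans[OF mm(2)] mult_left_mono) auto
    have "step_cost d u v \<le> (\<integral>w. ?t / \<epsilon> * c.rescaled_cost \<kappa> w + (c.some_accept w - c.both_accept w) \<partial>c.\<Omega>)"
      unfolding c.\<Omega>_def[symmetric]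
      using c.coupled_cost_integrable(1)[OF dm] d far(1) mm(1) c.coupled_cost_le_rescaled[of d \<kappa> \<epsilon>] \<epsilon>
      by (intro integral_mono) auto
    also have "\<dots> = ?t / \<epsilon> * (\<integral>w. c.rescaled_cost \<kappa> w \<partial>c.\<Omega>) + (\<integral>w. c.some_accept w - c.both_accept w \<partial>c.\<Omega>)"
      using far(1) mm(1) by (subst Bochner_Integration.integral_add) auto
    also have "\<dots> \<le> ?t / \<epsilon> * (q * (\<kappa> + ?N)) + L * ?t * (D2 * (\<kappa> + ?N))"
      using rescaled_cost mm' \<epsilon> by (intro add_mono mult_left_mono) auto
    also have "\<dots> = (q + \<epsilon> * (L * D2)) * (?t * (\<kappa> + ?N) / \<epsilon>)" using \<epsilon> by (simp add: field_simps)
    also have "\<dots> \<le> (1 + q) / 2 * (?t * (\<kappa> + ?N) / \<epsilon>)"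
      using \<epsilon>q \<epsilon> \<kappa> by (intro mult_right_mono) auto
    finally show ?thesis by (simp add: add.assoc)
  qed
  then show ?thesis
    using \<kappa> \<epsilon> q by (intro exI[of _ \<kappa>] exI[of _ \<epsilon>] exI[of _ "(1 + q) / 2"]) auto
qed

end

lemma geometric_indicator_sum:
  fixes e :: real
  assumes e: "0 < e" "e \<le> 1 / 4" and Q: "\<And>j. j < k \<Longrightarrow> \<not> Q j"
  shows "(\<Sum>j\<le>n. if Q j then e ^ j else 0) \<le> 4 / 3 * e ^ k"
proof -
  have "(\<Sum>j\<le>n. if Q j then e ^ j else 0) \<le> (\<Sum>j\<in>{k..n}. e ^ j)"
  proof -
    have "(\<Sum>j\<le>n. if Q j then e ^ j else 0) = (\<Sum>j\<in>{..n} \<inter> {j. Q j}. e ^ j)"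
      by (simp add: sum.inter_restrict)
    also have "\<dots> \<le> (\<Sum>j\<in>{k..n}. e ^ j)"
      using e Q by (intro sum_mono2) (auto simp: not_less[symmetric])
    finally show ?thesis .
  qed
  also have "(\<Sum>j\<in>{k..n}. e ^ j) \<le> 4 / 3 * e ^ k"
  proof (cases "k \<le> n")
    case True
    have "3 / 4 * (\<Sum>j\<in>{k..n}. e ^ j) \<le> (1 - e) * (\<Sum>j\<in>{k..n}. e ^ j)"
      using e by (intro mult_right_mono sum_nonneg) auto
    also have "\<dots> = e ^ k - e ^ Suc n" by (rule sum_gp_multiplied[OF True])
    also have "\<dots> \<le> e ^ k" using e by simp
    finally show ?thesis by simp
  next
    case False then show ?thesis using e by simp
  qed
  finally show ?thesis .
qed

context rcar_ergodic
begin

text \<open>The scaled distance \<open>x\<close> is truncated at \<open>1 - g\<close>, where \<open>g u v\<close> has the order \<open>e ^ k\<close> if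
  \<open>k\<close> good steps bring the pair to \<open>x \<le> 1 / 2\<close>. A good step occurs with probability at least \<open>4 * e\<close>
  and raises \<open>g\<close> from at most \<open>e ^ k / 3\<close> to at least \<open>e ^ (k - 1) / 4\<close>, so \<open>1 - g\<close> decreases in mean.
  Pairs that no number of steps up to \<open>n\<close> brings close satisfy \<open>S \<le> V u + V v\<close>.\<close>

lemma contracting_cost_exists:
  assumes S: "0 < S" and l2: "\<And>N. S \<le> N \<Longrightarrow> l * N + 2 * c \<le> (1 + l) / 2 * N"
  shows "\<exists>d \<alpha> \<kappa> \<epsilon>. (\<lambda>(x, y). d x y) \<in> borel_measurable (borel \<Otimes>\<^sub>M borel) \<and>
    (\<forall>x y. 0 \<le> d x y \<and> d x y \<le> 1) \<and> (\<forall>x y. min 1 (norm (x - y)) \<le> 2 * d x y) \<and>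
    (\<forall>x y. d x y \<le> norm (x - y) * (\<kappa> + V x + V y) / \<epsilon>) \<and> 0 < \<alpha> \<and> \<alpha> < 1 \<and>
    (\<forall>u v. u \<noteq> v \<longrightarrow> step_cost d u v \<le> \<alpha> * d u v \<or> (d u v = 1 \<and> S \<le> V u + V v))"
proof -
  obtain \<kappa> \<epsilon> \<alpha>1 where \<kappa>: "1 \<le> \<kappa>" and \<epsilon>: "0 < \<epsilon>" "\<epsilon> \<le> 1" and \<alpha>1: "0 \<le> \<alpha>1" "\<alpha>1 < 1"
    and small: "\<And>d u v. (\<lambda>(x, y). d x y) \<in> borel_measurable (borel \<Otimes>\<^sub>M borel) \<Longrightarrow>
      (\<forall>x y. 0 \<le> d x y \<and> d x y \<le> 1 \<and> d x y \<le> norm (x - y) * (\<kappa> + V x + V y) / \<epsilon>) \<Longrightarrow> u \<noteq> v \<Longrightarrow>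
      step_cost d u v \<le> \<alpha>1 * (norm (u - v) * (\<kappa> + V u + V v) / \<epsilon>)"
    using small_scale_contraction[OF S l2] by blast
  obtain r where r: "0 < r" "0 < measure lam {\<xi>. norm \<xi> \<le> r}"
    using cball_positive_measure[OF prob_lam sets_lam] by blast
  define \<phi> where "\<phi> = measure lam {\<xi>. norm \<xi> \<le> r}"
  have \<phi>: "0 < \<phi>" "\<phi> \<le> 1" using r prob_space.prob_le_1[OF prob_lam] by (auto simp: \<phi>_def)
  define R where "R = max 1 S"
  have R: "1 \<le> R" by (simp add: R_def)
  define s where "s = (1 + \<beta>c) / 2"
  have s: "\<beta>c < s" "0 < s" "s < 1" using \<beta>c by (auto simp: s_def)
  \<comment> \<open>\<open>n\<close> good steps reduce the distance \<open>2 * R\<close> below \<open>\<tau>\<close>, although \<open>\<tau>\<close> depends on \<open>n\<close>: each step may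
    increase the norms by \<open>r\<close> and thus the weights polynomially\<close>
  obtain n where n: "2 * R * s ^ n * (2 * (\<kappa> + 2 * (R + r * real n) ^ p)) < \<epsilon>"
  proof -
    have "(\<lambda>n. 4 * R * \<kappa> * s ^ n + 8 * R * ((R + r * real n) ^ p * s ^ n)) \<longlonglongrightarrow> 4 * R * \<kappa> * 0 + 8 * R * 0"
      using s p_ge_1 by (intro tendsto_intros exponential_beats_power LIMSEQ_realpow_zero) auto
    then have "(\<lambda>n. 2 * R * s ^ n * (2 * (\<kappa> + 2 * (R + r * real n) ^ p))) \<longlonglongrightarrow> 0"
      by (simp add: algebra_simps)
    from order_tendstoD(2)[OF this \<epsilon>(1)] show ?thesis using that by (auto simp: eventually_sequentially)
  qed
  have half: "x / (2 * y) * y = x / 2" if "0 < y" for x y :: real using that by simp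
  define \<tau> where "\<tau> = \<epsilon> / (2 * (\<kappa> + 2 * (R + r * real n) ^ p))"
  have pp: "0 < \<kappa> + 2 * (R + r * real n) ^ p" using \<kappa> R r by (intro add_pos_nonneg) auto
  have \<tau>: "2 * R * s ^ n \<le> \<tau>" "0 < \<tau>" using n pp \<epsilon> by (auto simp: \<tau>_def pos_le_divide_eq)
  obtain a where a: "0 < a" "\<And>u w. norm u \<le> R + r * (real n + 1) \<Longrightarrow> norm w \<le> R + r * (real n + 1) \<Longrightarrow> a \<le> accept u w"
    using accept_below[of "R + r * (real n + 1)"] by blast
  have a1: "a \<le> 1" using a(2)[of 0 0] accept_unit[of 0 0] R r by (simp add: add_nonneg_nonneg)
  have bs: "0 < 1 - \<beta>c / s" "1 - \<beta>c / s \<le> 1" using s \<beta>c by auto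
  define c4 where "c4 = a * ((1 - \<beta>c / s) * \<phi>)"
  have c4: "0 < c4" "c4 \<le> 1"
  proof -
    show "0 < c4" using a bs \<phi> by (simp add: c4_def)
    show "c4 \<le> 1" unfolding c4_def using a a1 bs \<phi> by (intro mult_le_one) auto
  qed
  define e where "e = c4 / 4"
  have e: "0 < e" "e \<le> 1 / 4" using c4 by (auto simp: e_def)
  \<comment> \<open>pairs that \<open>k\<close> good steps bring to distance at most \<open>\<tau>\<close>, with norms at most \<open>R + r * n\<close> throughout\<close>
  define Z where "Z k x y \<longleftrightarrow> norm x \<le> R + r * (real n - real k) \<and> norm y \<le> R + r * (real n - real k) \<and>
      norm (x - y) * s ^ k \<le> \<tau>" for k and x y :: 'a
  define g where "g x y = (\<Sum>k\<le>n. if Z k x y then e ^ k else 0) / 4" for x y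
  define x where "x u v = norm (u - v) * (\<kappa> + V u + V v) / \<epsilon>" for u v
  define d where "d u v = min (x u v) (1 - g u v)" for u v
  have g0: "0 \<le> g u v" for u v unfolding g_def using e by (intro divide_nonneg_pos sum_nonneg) auto
  have g_le: "g u v \<le> e ^ k / 3" if "\<And>j. j < k \<Longrightarrow> \<not> Z j u v" for k u v
    using geometric_indicator_sum[OF e, of k "\<lambda>j. Z j u v" n] that by (simp add: g_def)
  have g13: "g u v \<le> 1 / 3" for u v using g_le[of 0 u v] by simp
  have g_ge: "e ^ k / 4 \<le> g u v" if "Z k u v" "k \<le> n" for k u v
  proof -
    have "(if Z k u v then e ^ k else 0) \<le> (\<Sum>k\<le>n. if Z k u v then e ^ k else 0)"
      using that e by (intro member_le_sum) auto
    then show ?thesis using that by (simp add: g_def)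
  qed
  have gm: "(\<lambda>(x, y). g x y) \<in> borel_measurable (borel \<Otimes>\<^sub>M borel)"
    unfolding g_def Z_def by measurable
  have dm: "(\<lambda>(x, y). d x y) \<in> borel_measurable (borel \<Otimes>\<^sub>M borel)"
    using gm unfolding d_def x_def by measurable
  have xt: "norm (u - v) \<le> x u v" for u v
  proof -
    have "norm (u - v) * \<epsilon> \<le> norm (u - v) * (\<kappa> + V u + V v)"
      using \<epsilon> \<kappa> V_nonneg[of u] V_nonneg[of v] by (intro mult_left_mono) (linarith, simp)
    then show ?thesis using \<epsilon> by (simp add: x_def pos_le_divide_eq)
  qed
  have x0: "0 \<le> x u v" for u v using order_trans[OF norm_ge_zero xt] .
  have d0: "0 \<le> d u v \<and> d u v \<le> 1 \<and> d u v \<le> x u v" for u v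
    using g0[of u v] g13[of u v] x0[of u v] unfolding d_def by linarith
  have dt: "min 1 (norm (u - v)) \<le> 2 * d u v" for u v
  proof -
    have "min 1 (norm (u - v)) \<le> 2 * x u v" 
      using x0[of u v] xt[of u v] min.cobounded2[of 1 "norm (u - v)"] by linarith
    moreover have "min 1 (norm (u - v)) \<le> 2 * (1 - g u v)"
    proof (rule order_trans[OF min.cobounded1])
      show "1 \<le> 2 * (1 - g u v)" using g13[of u v] by simp
    qed
    ultimately show ?thesis unfolding d_def by (cases "x u v \<le> 1 - g u v") simp_all
  qed
  define \<alpha> where "\<alpha> = max \<alpha>1 (1 - e ^ n / 2)"
  have "e ^ n \<le> 1" using e by (intro power_le_one) auto
  then have \<alpha>: "0 < \<alpha>" "\<alpha> < 1" using \<alpha>1 e by (auto simp: \<alpha>_def less_max_iff_disj)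
  have main: "step_cost d u v \<le> \<alpha> * d u v \<or> (d u v = 1 \<and> S \<le> V u + V v)" if uv: "u \<noteq> v" for u v
  proof (cases "x u v \<le> 1 - g u v")
    case True
    have "step_cost d u v \<le> \<alpha>1 * x u v"
      unfolding x_def using d0 by (intro small dm uv) (auto simp: x_def)
    also have "\<dots> \<le> \<alpha> * d u v"
      using True d0[of u v] by (auto simp: d_def \<alpha>_def intro!: mult_right_mono)
    finally show ?thesis ..
  next
    case False
    then have dg: "d u v = 1 - g u v" by (simp add: d_def)
    show ?thesis
    proof (cases "\<exists>k\<le>n. Z k u v")
      case True
      define k where "k = (LEAST k. Z k u v)"
      have Zk: "Z k u v" "k \<le> n" and less: "\<And>j. j < k \<Longrightarrow> \<not> Z j u v"
        using True by (auto simp: k_def intro: LeastI dest: not_less_Least intro: order_trans[OF Least_le])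
      have "k \<noteq> 0"
      proof
        assume "k = 0"
        then have Z0: "norm u \<le> R + r * real n" "norm v \<le> R + r * real n" "norm (u - v) \<le> \<tau>"
          using Zk by (auto simp: Z_def)
        have "V u \<le> (R + r * real n) ^ p" "V v \<le> (R + r * real n) ^ p"
          using Z0 by (auto simp: V_def intro: power_mono)
        then have "norm (u - v) * (\<kappa> + V u + V v) \<le> \<tau> * (\<kappa> + 2 * (R + r * real n) ^ p)"
          using Z0 \<tau> \<kappa> by (intro mult_mono) auto
        also have "\<dots> = \<epsilon> / 2" unfolding \<tau>_def by (rule half[OF pp])
        finally have "x u v \<le> 1 / 2" using \<epsilon> by (simp add: x_def divide_le_eq)
        then show False using False g13[of u v] by simp
      qed
      then obtain k' where k': "k = Suc k'" by (cases k) auto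
      interpret c: rcar_coupled \<Psi> K lam p "W u v" u v \<beta>c by (rule coupled[OF uv])
      have rn: "R + r * (real n - real k) + r \<le> R + r * (real n + 1)" using r by (simp add: algebra_simps)
      have Zu: "norm u \<le> R + r * (real n - real k)" "norm v \<le> R + r * (real n - real k)"
        "norm (u - v) * s ^ k \<le> \<tau>" using Zk by (auto simp: Z_def)
      have A: "\<forall>w. norm w \<le> norm u + r \<longrightarrow> a \<le> accept u w" "\<forall>w. norm w \<le> norm v + r \<longrightarrow> a \<le> accept v w"
        using Zu rn r by (auto intro!: a(2))
      have step: "e ^ k' / 4 \<le> g y z"
        if "norm y \<le> norm u + r" "norm z \<le> norm v + r" "norm (y - z) \<le> s * norm (u - v)" for y z
      proof (rule g_ge)
        have "norm (y - z) * s ^ k' \<le> (s * norm (u - v)) * s ^ k'"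
          using that s by (intro mult_right_mono) auto
        also have "\<dots> = norm (u - v) * s ^ k" by (simp add: k')
        finally have "norm (y - z) * s ^ k' \<le> \<tau>" using Zu by simp
        then show "Z k' y z" using that Zu by (simp add: Z_def k' algebra_simps)
        show "k' \<le> n" using Zk k' by simp
      qed
      have g1: "0 \<le> g y z \<and> g y z \<le> 1" for y z using g0[of y z] g13[of y z] by simp
      have \<gamma>: "0 \<le> e ^ k' / 4" using e by simp
      note ms = c.meeting_step[OF A less_imp_le[OF a(1)] s(1) gm g1 \<gamma> step]
      have "step_cost d u v \<le> (\<integral>w. 1 - c.both_accept w * g (proposal1 w) (proposal2 w) \<partial>c.\<Omega>)"
        unfolding c.\<Omega>_def[symmetric]
      proof (rule integral_mono)
        show "integrable c.\<Omega> (\<lambda>w. coupled_cost d u v (proposal1 w) (proposal2 w))"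
          using d0 by (intro c.coupled_cost_integrable(1)[OF dm]) blast
        show "integrable c.\<Omega> (\<lambda>w. 1 - c.both_accept w * g (proposal1 w) (proposal2 w))" by (rule ms(1))
        show "coupled_cost d u v (proposal1 w) (proposal2 w) \<le> 1 - c.both_accept w * g (proposal1 w) (proposal2 w)" for w
          by (rule c.coupled_cost_le_overlap) (simp_all add: d_def g0)
      qed
      also have "\<dots> \<le> 1 - a * (e ^ k' / 4) * ((1 - \<beta>c / s) * \<phi>)"
        using ms(2) by (simp add: c.innovation_mass_def \<phi>_def)
      also have "a * (e ^ k' / 4) * ((1 - \<beta>c / s) * \<phi>) = e ^ k" by (simp add: k' e_def c4_def)
      also have "1 - e ^ k \<le> (1 - e ^ n / 2) * (1 - g u v)"
      proof -
        have "e ^ n \<le> e ^ k" using e Zk by (intro power_decreasing) auto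
        moreover have "g u v \<le> e ^ k / 3" by (rule g_le[OF less])
        moreover have "0 \<le> e ^ n / 2 * g u v" using e g0 by simp
        moreover have "0 < e ^ k" using e by simp
        ultimately have "1 - e ^ k \<le> 1 - e ^ n / 2 - g u v + e ^ n / 2 * g u v" by linarith
        also have "\<dots> = (1 - e ^ n / 2) * (1 - g u v)" by (simp only: left_diff_distrib right_diff_distrib)
        finally show ?thesis .
      qed
      also have "\<dots> \<le> \<alpha> * d u v"
        unfolding dg using g1[of u v] by (intro mult_right_mono) (auto simp: \<alpha>_def)
      finally show ?thesis ..
    next
      case noZ: False
      then have "g u v = 0" by (simp add: g_def)
      moreover have "S \<le> V u + V v"
      proof (rule ccontr)
        assume "\<not> S \<le> V u + V v"
        then have "V u \<le> S" "V v \<le> S" using V_nonneg[of u] V_nonneg[of v] by linarith+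
        then have uR: "norm u \<le> R" "norm v \<le> R" using norm_le_of_V_le by (auto simp: R_def)
        then have "norm (u - v) \<le> 2 * R" using norm_triangle_ineq4[of u v] by linarith
        then have "norm (u - v) * s ^ n \<le> 2 * R * s ^ n" using s by (intro mult_right_mono) auto
        then have "Z n u v" using uR \<tau>(1) by (simp add: Z_def)
        then show False using noZ by auto
      qed
      ultimately show ?thesis by (simp add: dg)
    qed
  qed
  show ?thesis
    using dm d0 dt \<alpha> main by (intro exI[of _ d] exI[of _ \<alpha>] exI[of _ \<kappa>] exI[of _ \<epsilon>]) (auto simp: x_def)
qed

text \<open>The Cauchy-Schwarz inequality for \<open>sqrt (d * w)\<close>, in the linear form
  \<open>2 * sqrt (d * w) \<le> \<sigma> * d + w / \<sigma>\<close>. The optimal \<open>\<sigma>\<close> depends on \<open>(u, v)\<close>, which is harmless because the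
  inequality is used for one pair at a time.\<close>

lemma tilted_cost_contraction:
  assumes uv: "u \<noteq> v" and dm: "(\<lambda>(x, y). d x y) \<in> borel_measurable (borel \<Otimes>\<^sub>M borel)"
    and d: "\<And>x y. 0 \<le> d x y \<and> d x y \<le> 1" and \<gamma>: "0 < \<gamma>"
    and A: "0 < A" "step_cost d u v \<le> A"
    and f: "unit_lip (\<lambda>x y. sqrt (d x y * (1 + \<gamma> * (V x + V y)))) M f" and f_meas: "f \<in> borel_measurable borel"
  shows "\<bar>(\<integral>z. f z \<partial>P u) - (\<integral>z. f z \<partial>P v)\<bar> \<le> M * sqrt (A * (1 + \<gamma> * (l * (V u + V v) + 2 * c)))"
proof -
  interpret c: rcar_coupled \<Psi> K lam p "W u v" u v \<beta>c by (rule coupled[OF uv])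
  interpret \<Omega>: prob_space c.\<Omega> by (rule c.prob_\<Omega>)
  let ?B = "1 + \<gamma> * (l * (V u + V v) + 2 * c)"
  let ?w = "\<lambda>x y. (1 / 2 + \<gamma> * V x) + (1 / 2 + \<gamma> * V y)"
  have "0 \<le> \<gamma> * (l * (V u + V v) + 2 * c)" using \<gamma> l c by simp
  then have B: "0 < ?B" by linarith
  have M: "0 \<le> M" using f by (simp add: unit_lip_def)
  define \<sigma> where "\<sigma> = sqrt (?B / A)"
  have \<sigma>: "0 < \<sigma>" using A B by (simp add: \<sigma>_def)
  let ?G = "\<lambda>x y. (M * \<sigma> / 2) * d x y + (M / (2 * \<sigma>)) * ?w x y"
  have lip: "\<bar>f x - f y\<bar> \<le> ?G x y" for x y
  proof -
    have w: "0 \<le> ?w x y" using \<gamma> by simp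
    have "\<bar>f x - f y\<bar> \<le> M * sqrt (d x y * (1 + \<gamma> * (V x + V y)))" using f by (simp add: unit_lip_def)
    also have "\<dots> \<le> M * ((\<sigma> * d x y + ?w x y / \<sigma>) / 2)"
    proof (rule mult_left_mono[OF _ M])
      have "d x y * (1 + \<gamma> * (V x + V y)) = (\<sigma> * d x y) * (?w x y / \<sigma>)" using \<sigma> by (simp add: field_simps)
      also have "sqrt \<dots> \<le> (\<sigma> * d x y + ?w x y / \<sigma>) / 2"
        using d[of x y] w \<sigma> by (intro arith_geo_mean_sqrt) auto
      finally show "sqrt (d x y * (1 + \<gamma> * (V x + V y))) \<le> (\<sigma> * d x y + ?w x y / \<sigma>) / 2" .
    qed
    also have "\<dots> = ?G x y" using \<sigma> by (simp add: field_simps)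
    finally show ?thesis .
  qed
  have move_w: "move y (\<lambda>x. 1 / 2 + \<gamma> * V x) z = 1 / 2 + \<gamma> * move y V z" for y z
    by (simp add: move_def algebra_simps)
  have Jw: "coupled_cost ?w u v (proposal1 w) (proposal2 w) = 1 + \<gamma> * (move u V (proposal1 w) + move v V (proposal2 w))" for w
    unfolding coupled_cost_additive[of "\<lambda>x. 1 / 2 + \<gamma> * V x"] move_w by (simp add: algebra_simps)
  note mv = c.move_V_proposal[OF drift_P l(1) c]
  have w_int: "integrable c.\<Omega> (\<lambda>w. coupled_cost ?w u v (proposal1 w) (proposal2 w))" unfolding Jw using mv by simp
  have w_le: "(\<integral>w. coupled_cost ?w u v (proposal1 w) (proposal2 w) \<partial>c.\<Omega>) \<le> ?B"
  proof -
    have "(\<integral>w. coupled_cost ?w u v (proposal1 w) (proposal2 w) \<partial>c.\<Omega>)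
        = 1 + \<gamma> * ((\<integral>w. move u V (proposal1 w) \<partial>c.\<Omega>) + (\<integral>w. move v V (proposal2 w) \<partial>c.\<Omega>))"
      unfolding Jw using mv by (simp add: \<Omega>.prob_space)
    also have "\<dots> \<le> 1 + \<gamma> * ((l * V u + c) + (l * V v + c))"
      using mv \<gamma> by (intro add_left_mono mult_left_mono add_mono) auto
    finally show ?thesis by (simp add: algebra_simps)
  qed
  note d_int = c.coupled_cost_integrable(1)[OF dm d]
  have "\<bar>(\<integral>z. f z \<partial>P u) - (\<integral>z. f z \<partial>P v)\<bar> \<le> (\<integral>w. coupled_cost ?G u v (proposal1 w) (proposal2 w) \<partial>c.\<Omega>)"
    unfolding c.\<Omega>_def
  proof (rule coupled_difference_le[OF coupling_W f_meas _ lip])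
    show "0 \<le> f x \<and> f x \<le> 1" for x using f by (simp add: unit_lip_def)
    show "integrable (W u v \<Otimes>\<^sub>M lam) (\<lambda>w. coupled_cost ?G u v (proposal1 w) (proposal2 w))"
      unfolding coupled_cost_linear c.\<Omega>_def[symmetric] using d_int w_int by simp
  qed
  also have "\<dots> = (M * \<sigma> / 2) * step_cost d u v + (M / (2 * \<sigma>)) * (\<integral>w. coupled_cost ?w u v (proposal1 w) (proposal2 w) \<partial>c.\<Omega>)"
    unfolding coupled_cost_linear c.\<Omega>_def[symmetric] using d_int w_int
    by (subst Bochner_Integration.integral_add) auto
  also have "\<dots> \<le> (M * \<sigma> / 2) * A + (M / (2 * \<sigma>)) * ?B"
    using A w_le M \<sigma> by (intro add_mono mult_left_mono) auto
  also have "\<dots> = M * ((\<sigma> * A + ?B / \<sigma>) / 2)" using \<sigma> by (simp add: field_simps)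
  also have "(\<sigma> * A + ?B / \<sigma>) / 2 = sqrt (A * ?B)"
  proof -
    have balance: "b / a * (a * a) = b * a" "b * b / (b / a) = b * a" if "0 < a" "0 < b" for a b :: real
      using that by auto
    have "0 < sqrt A" "0 < sqrt ?B" using A B by (simp_all only: real_sqrt_gt_0_iff)
    from balance[OF this] have "\<sigma> * A = sqrt ?B * sqrt A" "?B / \<sigma> = sqrt ?B * sqrt A"
      using A B by (simp_all only: \<sigma>_def real_sqrt_divide real_sqrt_mult_self abs_of_pos)
    then show ?thesis by (simp add: real_sqrt_mult)
  qed
  finally show ?thesis .
qed

text \<open>If \<open>d\<close> contracts, the weight \<open>1 + \<gamma> * (V u + V v)\<close> grows at most by \<open>1 + 2 * \<gamma> * c\<close>, and \<open>\<gamma>\<close> is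
  chosen such that this does not spoil the contraction. Otherwise \<open>d = 1\<close> and \<open>S \<le> V u + V v\<close>, and the
  weight contracts by the factor \<open>k3\<close>.\<close>

theorem unique_invariant: "\<exists>!\<mu>. invariant_prob P \<mu>"
proof -
  define S where "S = 4 * c / (1 - l) + 1"
  have S: "0 < S" using l c by (simp add: S_def add_nonneg_pos)
  have l2: "l * N + 2 * c \<le> (1 + l) / 2 * N" if "S \<le> N" for N
  proof -
    have "4 * c / (1 - l) \<le> N" using that by (simp add: S_def)
    then have "4 * c \<le> N * (1 - l)" using l by (simp add: pos_divide_le_eq)
    then show ?thesis by (simp add: algebra_simps)
  qed
  obtain d \<alpha> \<kappa> \<epsilon> where dm: "(\<lambda>(x, y). d x y) \<in> borel_measurable (borel \<Otimes>\<^sub>M borel)"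
    and d: "\<And>x y. 0 \<le> d x y \<and> d x y \<le> 1" and dt: "\<And>x y. min 1 (norm (x - y)) \<le> 2 * d x y"
    and dx: "\<And>x y. d x y \<le> norm (x - y) * (\<kappa> + V x + V y) / \<epsilon>" and \<alpha>: "0 < \<alpha>" "\<alpha> < 1"
    and main: "\<And>u v. u \<noteq> v \<Longrightarrow> step_cost d u v \<le> \<alpha> * d u v \<or> (d u v = 1 \<and> S \<le> V u + V v)"
    using contracting_cost_exists[OF S l2] by blast
  \<comment> \<open>the sum \<open>c + 1\<close> avoids a division by zero\<close>
  define \<gamma> where "\<gamma> = (1 - \<alpha>) / (4 * (c + 1))"
  have \<gamma>: "0 < \<gamma>" using \<alpha> c by (simp add: \<gamma>_def)
  have \<gamma>c: "2 * \<gamma> * c \<le> (1 - \<alpha>) / 2"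
    using \<alpha> c by (simp add: \<gamma>_def field_simps)
  define k3 where "k3 = (1 + \<gamma> * ((1 + l) / 2 * S)) / (1 + \<gamma> * S)"
  have \<gamma>S: "0 < \<gamma> * S" using \<gamma> S by simp
  have k3: "0 \<le> k3" "k3 < 1"
  proof -
    have "(1 + l) / 2 * S < 1 * S" using l S by (intro mult_strict_right_mono) auto
    then have "\<gamma> * ((1 + l) / 2 * S) < \<gamma> * S" using \<gamma> by simp
    then show "k3 < 1" using \<gamma>S by (simp add: k3_def divide_less_eq)
    show "0 \<le> k3" using \<gamma> S l by (simp add: k3_def)
  qed
  define \<alpha>' where "\<alpha>' = max ((1 + \<alpha>) / 2) k3"
  have \<alpha>': "0 \<le> \<alpha>'" "\<alpha>' < 1" using \<alpha> k3 by (auto simp: \<alpha>'_def)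
  define w where "w x y = 1 + \<gamma> * (V x + V y)" for x y
  have w1: "1 \<le> w x y" for x y using \<gamma> by (simp add: w_def)
  define D where "D x y = sqrt (d x y * w x y)" for x y
  have Dd: "d x y \<le> D x y" for x y
  proof -
    have "d x y * d x y \<le> d x y * w x y" using d[of x y] w1[of x y] by (intro mult_left_mono) auto
    then show ?thesis unfolding D_def using d[of x y] by (intro real_le_rsqrt) (simp add: power2_eq_square)
  qed
  interpret D: cost D 2
  proof
    show "min 1 (dist x y) \<le> 2 * D x y" for x y using dt[of x y] Dd[of x y] by (simp add: dist_norm)
    show "0 \<le> D x y" for x y using d[of x y] w1[of x y] by (simp add: D_def)
    show "(D x \<longlongrightarrow> 0) (at x)" for x
    proof (rule tendsto_sandwich[OF _ _ tendsto_const])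
      let ?h = "\<lambda>y. sqrt (norm (x - y) * (\<kappa> + norm x ^ p + norm y ^ p) / \<epsilon> * (1 + \<gamma> * (norm x ^ p + norm y ^ p)))"
      have "?h \<midarrow>x\<rightarrow> sqrt (norm (x - x) * (\<kappa> + norm x ^ p + norm x ^ p) / \<epsilon> * (1 + \<gamma> * (norm x ^ p + norm x ^ p)))"
        unfolding divide_inverse by (intro tendsto_intros)
      then show "?h \<midarrow>x\<rightarrow> 0" by simp
      show "\<forall>\<^sub>F y in at x. 0 \<le> D x y" using d w1 by (intro always_eventually) (simp add: D_def less_imp_le order_trans[OF zero_le_one])
      show "\<forall>\<^sub>F y in at x. D x y \<le> ?h y"
      proof (intro always_eventually allI)
        fix y
        have "d x y * w x y \<le> norm (x - y) * (\<kappa> + V x + V y) / \<epsilon> * w x y"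
          using w1[of x y] by (intro mult_right_mono dx) auto
        then show "D x y \<le> ?h y" by (simp add: D_def w_def V_def)
      qed
    qed
  qed simp
  show ?thesis
  proof (rule D.contracting_kernel_unique_invariant[OF kernel_P, of "sqrt \<alpha>'" "\<lambda>x. \<gamma> * V x" l "\<gamma> * c"])
    show "0 \<le> sqrt \<alpha>'" "sqrt \<alpha>' < 1" using \<alpha>' by auto
    show "(\<lambda>x. \<gamma> * V x) \<in> borel_measurable borel" by measurable
    show "0 \<le> \<gamma> * V x" for x using \<gamma> by simp
    show "0 \<le> l" "l < 1" by (rule l)+
    show "0 \<le> \<gamma> * c" using \<gamma> c by simp
    show "(\<integral>\<^sup>+z. ennreal (\<gamma> * V z) \<partial>P x) \<le> ennreal (l * (\<gamma> * V x) + \<gamma> * c)" for x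
    proof -
      have [measurable_cong]: "sets (P x) = sets borel" by simp
      have "(\<integral>\<^sup>+z. ennreal (\<gamma> * V z) \<partial>P x) = ennreal \<gamma> * (\<integral>\<^sup>+z. ennreal (V z) \<partial>P x)"
        using \<gamma> by (subst nn_integral_cmult[symmetric]) (auto simp: ennreal_mult)
      also have "\<dots> \<le> ennreal \<gamma> * ennreal (l * V x + c)" by (intro mult_left_mono drift_P) simp
      also have "\<dots> = ennreal (\<gamma> * (l * V x + c))" using \<gamma> l c by (intro ennreal_mult[symmetric]) auto
      finally show ?thesis by (simp add: algebra_simps)
    qed
    show "D x y \<le> 1 + \<gamma> * V x + \<gamma> * V y" for x y
    proof -
      have "D x y \<le> sqrt (w x y * w x y)"
        unfolding D_def using d[of x y] w1[of x y] by (intro real_sqrt_le_mono mult_right_mono) auto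
      also have "\<dots> = w x y" using w1[of x y] by simp
      also have "\<dots> = 1 + \<gamma> * V x + \<gamma> * V y" by (simp add: w_def distrib_left)
      finally show ?thesis .
    qed
    fix f M and u v :: 'a assume f: "unit_lip D M f"
    have M: "0 \<le> M" using f by (simp add: unit_lip_def)
    show "\<bar>(\<integral>z. f z \<partial>P u) - (\<integral>z. f z \<partial>P v)\<bar> \<le> sqrt \<alpha>' * M * D u v"
    proof (cases "u = v")
      case True
      have "0 \<le> sqrt \<alpha>' * M * D v v" using M \<alpha>' D.D_nonneg by (intro mult_nonneg_nonneg) auto
      then show ?thesis using True by simp
    next
      case uv: False
      let ?N = "V u + V v"
      let ?B = "1 + \<gamma> * (l * ?N + 2 * c)"
      have "0 < min 1 (norm (u - v))" using uv by simp
      then have "0 < 2 * d u v" using dt[of u v] by (rule less_le_trans)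
      then have d_pos: "0 < d u v" by simp
      have key: "\<exists>A. 0 < A \<and> step_cost d u v \<le> A \<and> A * ?B \<le> \<alpha>' * (d u v * w u v)"
        using main[OF uv]
      proof
        assume *: "step_cost d u v \<le> \<alpha> * d u v"
        have "?B \<le> (1 + 2 * \<gamma> * c) * w u v"
        proof -
          have "\<gamma> * (l * ?N) \<le> \<gamma> * ?N" using \<gamma> l by (intro mult_left_mono mult_left_le_one_le) auto
          moreover have "0 \<le> 2 * \<gamma> * c * (\<gamma> * ?N)" using \<gamma> c by simp
          ultimately show ?thesis by (simp add: w_def algebra_simps)
        qed
        then have "\<alpha> * d u v * ?B \<le> \<alpha> * d u v * ((1 + 2 * \<gamma> * c) * w u v)"
          using \<alpha> d by (intro mult_left_mono) auto
        also have "\<dots> = \<alpha> * (1 + 2 * \<gamma> * c) * (d u v * w u v)" by (simp add: mult_ac)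
        also have "\<dots> \<le> \<alpha>' * (d u v * w u v)"
        proof (rule mult_right_mono)
          have "\<alpha> * (1 + 2 * \<gamma> * c) \<le> \<alpha> + 1 * (2 * \<gamma> * c)"
            using \<alpha> \<gamma> c by (simp add: distrib_left mult_left_le_one_le)
          also have "\<dots> \<le> (1 + \<alpha>) / 2" using \<gamma>c by (simp add: field_simps)
          also have "\<dots> \<le> \<alpha>'" unfolding \<alpha>'_def by (rule max.cobounded1)
          finally show "\<alpha> * (1 + 2 * \<gamma> * c) \<le> \<alpha>'" .
          show "0 \<le> d u v * w u v" using d[of u v] w1[of u v] by simp
        qed
        finally show ?thesis using * \<alpha> d_pos by (intro exI[of _ "\<alpha> * d u v"]) simp
      next
        assume *: "d u v = 1 \<and> S \<le> V u + V v"
        interpret c: rcar_coupled \<Psi> K lam p "W u v" u v \<beta>c by (rule coupled[OF uv])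
        have "step_cost d u v \<le> 1" using c.coupled_cost_integrable(2)[OF dm d] by (simp add: c.\<Omega>_def)
        moreover have "?B \<le> \<alpha>' * w u v"
        proof -
          have "?B \<le> 1 + \<gamma> * ((1 + l) / 2 * ?N)" using * l2 \<gamma> by (intro add_left_mono mult_left_mono) auto
          also have "\<dots> \<le> k3 * w u v"
          proof -
            have "0 \<le> (1 - (1 + l) / 2) * \<gamma> * (?N - S)" using l \<gamma> * by (intro mult_nonneg_nonneg) auto
            moreover have "(1 + \<gamma> * (t * x)) * (1 + \<gamma> * y) + (1 - t) * \<gamma> * (x - y)
                = (1 + \<gamma> * (t * y)) * (1 + \<gamma> * x)" for t x y
              by (simp add: algebra_simps)
            ultimately have "(1 + \<gamma> * ((1 + l) / 2 * ?N)) * (1 + \<gamma> * S) \<le> (1 + \<gamma> * ((1 + l) / 2 * S)) * (1 + \<gamma> * ?N)"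
              by (metis le_add_same_cancel1)
            then show ?thesis using \<gamma>S by (simp add: k3_def w_def pos_le_divide_eq)
          qed
          also have "\<dots> \<le> \<alpha>' * w u v" using w1[of u v] by (intro mult_right_mono) (auto simp: \<alpha>'_def)
          finally show ?thesis .
        qed
        ultimately show ?thesis using * by (intro exI[of _ 1]) simp
      qed
      then obtain A where A: "0 < A" "step_cost d u v \<le> A" and AB: "A * ?B \<le> \<alpha>' * (d u v * w u v)" by blast
      have "\<bar>(\<integral>z. f z \<partial>P u) - (\<integral>z. f z \<partial>P v)\<bar> \<le> M * sqrt (A * ?B)"
        using f D.unit_lip_measurable[OF f] unfolding D_def[abs_def] w_def
        by (intro tilted_cost_contraction[OF uv dm d \<gamma> A])
      also have "\<dots> \<le> M * sqrt (\<alpha>' * (d u v * w u v))" using M AB by (intro mult_left_mono real_sqrt_le_mono) auto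
      also have "\<dots> = sqrt \<alpha>' * M * D u v" by (simp add: D_def real_sqrt_mult)
      finally show ?thesis .
    qed
  qed
qed

end

section \<open>The invariant measure of the RCAR-MH kernel\<close>

text \<open>Makes \<open>1 + V\<close> a weight for the Lipschitz bound and the logarithmic lower bound on \<open>\<Psi>\<close>.\<close>

lemma norm_pow_le:
  fixes u :: "'a :: real_normed_vector"
  assumes "0 \<le> q" "q \<le> real p"
  shows "norm_pow q u \<le> max 1 (norm u ^ p)"
proof (cases "norm u \<le> 1")
  case True
  then have "norm u powr q \<le> 1" using assms by (intro powr_le1) auto
  then show ?thesis by (auto simp: norm_pow_def le_max_iff_disj)
next
  case False
  then have "norm u powr q \<le> norm u powr real p" using assms by (intro powr_mono) auto
  also have "\<dots> = norm u ^ p" using False by (intro powr_realpow) auto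
  finally show ?thesis by (simp add: norm_pow_def le_max_iff_disj)
qed

theorem corollary1:
  fixes \<Psi> :: "'a :: {banach, second_countable_topology} \<Rightarrow> real"
    and K :: "'a \<Rightarrow> 'a measure"
    and lam :: "'a measure"
    and q :: real
    and p :: nat
  assumes Psi_meas: "\<Psi> \<in> borel_measurable borel"
    and K_kernel: "markov_kernel K"
    and lam_radon: "radon_prob lam"
    and q_nonneg: "0 \<le> q"
    and A1a: "\<forall>R>0. \<exists>M1\<ge>0. \<forall>u\<in>cball 0 R. \<Psi> u \<le> M1"
    and A1b: "\<exists>M2\<ge>0. \<exists>M3\<ge>0. \<forall>u. \<Psi> u \<ge> M3 - M2 * ln (1 + norm_pow q u)"
    and A1c: "\<forall>\<beta>\<in>{0<..<1}. \<forall>b\<in>{0<..<1}. \<exists>R0>0. \<exists>M4>0. \<forall>u. norm u > R0 \<longrightarrow>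
                (INF v\<in>cball (\<beta> *\<^sub>R u) (b * (1 - \<beta>) * norm u). exp (\<Psi> u - \<Psi> v)) \<ge> M4"
    and A1d: "\<exists>L>0. \<forall>u v. \<bar>\<Psi> u - \<Psi> v\<bar> \<le>
                L * max 1 (max (norm_pow q u) (norm_pow q v)) * norm (u - v)"
    and A2a: "\<forall>u. u \<noteq> 0 \<longrightarrow> (AE z in K u. norm z < norm u)"
             "AE z in K 0. z = 0"
    and A2b: "\<exists>b0 \<beta>0 \<epsilon>0. 0 < b0 \<and> b0 < \<beta>0 \<and> \<beta>0 < 1 \<and> 0 < \<epsilon>0 \<and>
                (\<forall>u. measure (K u) {z. norm (z - \<beta>0 *\<^sub>R u) \<le> b0 * (1 - \<beta>0) * norm u} \<ge> \<epsilon>0)"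
    and A2c: "\<exists>W :: 'a \<Rightarrow> 'a \<Rightarrow> ('a \<times> 'a) measure.
                (\<forall>u v. is_coupling (W u v) (K u) (K v)) \<and>
                (\<forall>u v. u \<noteq> v \<longrightarrow> (AE (x, y) in W u v. norm (x - y) < norm (u - v))) \<and>
                (\<forall>u. AE (x, y) in W u u. x = y) \<and>
                (\<exists>\<beta>c. 0 < \<beta>c \<and> \<beta>c < 1 \<and>
                  (SUP (u, v)\<in>{(u, v). u \<noteq> v}.
                     ennreal (inverse (norm (u - v))) * (\<integral>\<^sup>+(x, y). ennreal (norm (x - y)) \<partial>W u v))
                    \<le> ennreal \<beta>c)"
    and p_bound: "int p \<ge> max 1 \<lceil>q\<rceil>"
    and lam_moment: "(\<integral>\<^sup>+\<xi>. ennreal (norm \<xi> ^ p) \<partial>lam) < \<infinity>"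
  shows "\<exists>!\<mu>. invariant_prob (rcar_mh_kernel \<Psi> K lam) \<mu>"
proof -
  have lam: "prob_space lam" "sets lam = sets borel" using lam_radon by (auto simp: radon_prob_def)
  have p1: "1 \<le> p" and qp: "q \<le> real p"
  proof -
    show "1 \<le> p" using p_bound by simp
    have "real_of_int \<lceil>q\<rceil> \<le> real_of_int (int p)" using p_bound by (intro of_int_le_iff[THEN iffD2]) simp
    then have "real_of_int \<lceil>q\<rceil> \<le> real p" by simp
    with le_of_int_ceiling[of q] show "q \<le> real p" by (rule order_trans)
  qed
  have [measurable_cong]: "sets lam = sets borel" by (rule lam(2))
  have "rcar_mh \<Psi> K lam"
    using Psi_meas K_kernel lam by (intro rcar_mh.intro) (simp_all add: markov_kernel_def)
  then interpret rcar_moment \<Psi> K lam p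
  proof (rule rcar_moment.intro, intro rcar_moment_axioms.intro)
    show "1 \<le> p" by (rule p1)
    show "integrable lam (\<lambda>\<xi>. norm \<xi> ^ p)" using lam_moment by (intro integrableI_nonneg) auto
    show "AE z in K u. norm z \<le> norm u" for u
    proof (cases "u = 0")
      case True
      show ?thesis using A2a(2) unfolding True by eventually_elim simp
    next
      case False
      then have "AE z in K u. norm z < norm u" using A2a(1) by simp
      then show ?thesis by eventually_elim simp
    qed
  qed
  obtain L where L: "0 < L" and Lip: "\<And>u v. \<bar>\<Psi> u - \<Psi> v\<bar> \<le>
      L * max 1 (max (norm_pow q u) (norm_pow q v)) * norm (u - v)"
    using A1d by blast
  have np: "norm_pow q w \<le> 1 + V w" for w :: 'a
    by (rule order_trans[OF norm_pow_le[OF q_nonneg qp]]) (simp add: V_def)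
  have Lip': "\<bar>\<Psi> u - \<Psi> v\<bar> \<le> L * (1 + V u + V v) * norm (u - v)" for u v
  proof -
    have "max 1 (max (norm_pow q u) (norm_pow q v)) \<le> 1 + V u + V v"
      using np[of u] np[of v] V_nonneg[of u] V_nonneg[of v] by (intro max.boundedI) linarith+
    then have "L * max 1 (max (norm_pow q u) (norm_pow q v)) * norm (u - v) \<le> L * (1 + V u + V v) * norm (u - v)"
      using L by (intro mult_right_mono mult_left_mono) auto
    then show ?thesis using Lip[of u v] by linarith
  qed
  obtain b \<beta> \<epsilon> where b: "0 < b" "b < \<beta>" "\<beta> < 1" and \<epsilon>: "0 < \<epsilon>"
    and good: "\<And>u. \<epsilon> \<le> measure (K u) {z. norm (z - \<beta> *\<^sub>R u) \<le> b * (1 - \<beta>) * norm u}"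
    using A2b by blast
  obtain l c where l: "0 \<le> l" "l < 1" "0 \<le> c"
    and dr: "\<And>u. (\<integral>\<^sup>+w. ennreal (V w) \<partial>P u) \<le> ennreal (l * V u + c)"
  proof -
    have "0 < \<beta>" "b < 1" using b by auto
    with drift[of \<beta> b \<epsilon>] b \<epsilon> good A1c show ?thesis using that by auto
  qed
  have below: "\<exists>a>0. \<forall>u w. norm u \<le> R \<longrightarrow> norm w \<le> R \<longrightarrow> a \<le> accept u w" for R
  proof -
    obtain M1 where M1: "\<And>w. norm w \<le> max 1 R \<Longrightarrow> \<Psi> w \<le> M1"
    proof -
      have "0 < max 1 R" by simp
      then obtain M1 where "\<forall>w\<in>cball 0 (max 1 R). \<Psi> w \<le> M1" using A1a by blast
      then show ?thesis by (intro that[of M1]) simp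
    qed
    obtain M2 M3 where M2: "0 \<le> M2" and M3: "\<And>u. M3 - M2 * ln (1 + norm_pow q u) \<le> \<Psi> u"
      using A1b by blast
    define B where "B = M3 - M2 * ln (2 + max 1 R ^ p) - M1"
    have "min 1 (exp B) \<le> accept u w" if u: "norm u \<le> R" and w: "norm w \<le> R" for u w
    proof -
      have "norm u ^ p \<le> max 1 R ^ p" using u by (intro power_mono) auto
      then have "1 + norm_pow q u \<le> 2 + max 1 R ^ p" using np[of u] unfolding V_def by linarith
      moreover have "0 < 1 + norm_pow q u" by (simp add: norm_pow_def add_pos_nonneg)
      ultimately have "ln (1 + norm_pow q u) \<le> ln (2 + max 1 R ^ p)" by (intro ln_mono)
      then have "M2 * ln (1 + norm_pow q u) \<le> M2 * ln (2 + max 1 R ^ p)" using M2 by (rule mult_left_mono)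
      moreover have "\<Psi> w \<le> M1" using w by (intro M1) simp
      ultimately have "B \<le> \<Psi> u - \<Psi> w" using M3[of u] unfolding B_def by linarith
      then show ?thesis unfolding mh_accept_def by (intro min.mono) auto
    qed
    then show ?thesis by (intro exI[of _ "min 1 (exp B)"]) auto
  qed
  obtain W :: "'a \<Rightarrow> 'a \<Rightarrow> ('a \<times> 'a) measure" and \<beta>c where
    W: "\<And>u v. is_coupling (W u v) (K u) (K v)"
    and closer: "\<And>u v. u \<noteq> v \<Longrightarrow> AE (x, y) in W u v. norm (x - y) < norm (u - v)"
    and \<beta>c: "0 < \<beta>c" "\<beta>c < 1"
    and sup: "(SUP (u, v)\<in>{(u, v). u \<noteq> v}.
        ennreal (inverse (norm (u - v))) * (\<integral>\<^sup>+(x, y). ennreal (norm (x - y)) \<partial>W u v)) \<le> ennreal \<beta>c"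
    using A2c by blast
  interpret rcar_ergodic \<Psi> K lam p L l c \<beta>c W
  proof
    show "AE w in W u v. norm (fst w - snd w) \<le> norm (u - v)" if "u \<noteq> v" for u v
      using closer[OF that] by eventually_elim (simp add: case_prod_unfold)
    show "(\<integral>\<^sup>+w. ennreal (norm (fst w - snd w)) \<partial>W u v) \<le> ennreal (\<beta>c * norm (u - v))" if uv: "u \<noteq> v" for u v
    proof -
      let ?I = "\<integral>\<^sup>+w. ennreal (norm (fst w - snd w)) \<partial>W u v"
      have "ennreal (inverse (norm (u - v))) * ?I \<le> ennreal \<beta>c"
        using SUP_upper2[of "(u, v)" "{(u, v). u \<noteq> v}"] sup uv
        by (intro order_trans[OF _ sup] SUP_upper2[of "(u, v)"]) (auto simp: case_prod_unfold)
      then have "ennreal (norm (u - v)) * (ennreal (inverse (norm (u - v))) * ?I) \<le> ennreal (norm (u - v)) * ennreal \<beta>c"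
        by (rule mult_left_mono) simp
      also have "ennreal (norm (u - v)) * (ennreal (inverse (norm (u - v))) * ?I) = ?I"
        using uv by (simp add: mult.assoc[symmetric] ennreal_mult[symmetric])
      also have "ennreal (norm (u - v)) * ennreal \<beta>c = ennreal (\<beta>c * norm (u - v))"
        using \<beta>c by (simp add: ennreal_mult[symmetric] mult.commute)
      finally show ?thesis .
    qed
  qed (use L Lip' l dr below \<beta>c W in auto)
  show ?thesis by (rule unique_invariant)
qed

end
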